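(* Let $T_K\in\mathscr{C}^\alpha$ be self-adjoint. Denote $\mathcal{E}(\epsilon):=\sup\sigma(T_{K_{\epsilon A}})$ and $\mathcal{E}_\epsilon:=\sup\sigma(T_{K_{A_\epsilon}})$, where $K_{\epsilon A}(x,y)=e^{i\phi^{\epsilon A}(x,y)}K(x,y)$ and $K_{A_\epsilon}(x,y)=e^{i\phi^{A_\epsilon}(x,y)}K(x,y)$, with the phases defined in the context. The following statements hold true uniformly in $|\epsilon|\le 1/2$: (1) If $1\le\alpha<2$, then there exists a numerical constant $C_\alpha>0$, with $\lim_{\alpha\nearrow 2}C_\alpha=\infty$, such that $$|\mathcal{E}(\epsilon)-\mathcal{E}(0)|\le C_\alpha\,\|T_K\|_\alpha\,|\epsilon|^{\alpha/2}.$$ (2) If $\alpha\ge 2$, then there exists a numerical constant $C>0$ such that $$|\mathcal{E}(\epsilon)-\mathcal{E}(0)|\le C\,\|T_K\|_2\,|\epsilon|\,\ln(1/|\epsilon|).$$ (3) Let $\alpha\ge 2$ and assume that either $B$ is a constant magnetic field, or the magnetic field perturbation comes from a slowly varying vector potential $A_\epsilon$. Then there exists a numerical constant $C>0$ such that $$\max\{|\mathcal{E}(\epsilon)-\mathcal{E}(0)|,\ |\mathcal{E}_\epsilon-\mathcal{E}_0|\}\le C\,\|T_K\|_2\,|\epsilon|.$$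
   Context: Write $\langle x\rangle:=(1+|x|^2)^{1/2}$ for $x\in\mathbb{R}^d$; $\sigma(T)$ denotes the spectrum of $T$. The class $\mathscr{C}^\alpha$. For $\alpha\ge 0$, a bounded linear operator $T_K$ on $L^2(\mathbb{R}^d)$ has off-diagonal polynomial decay of order $\alpha$ if it is defined by an integral kernel $K$ such that $$\|T_K\|_\alpha:=\max\Big\{\sup_{x\in\mathbb{R}^d}\int_{\mathbb{R}^d}|K(x,y)|\langle x-y\rangle^\alpha dy,\ \sup_{y\in\mathbb{R}^d}\int_{\mathbb{R}^d}|K(x,y)|\langle x-y\rangle^\alpha dx\Big\}<\infty.$$ $\mathscr{C}^\alpha$ denotes the complex linear space of these operators with the norm $\|\cdot\|_\alpha$, including by definition the identity operator. Magnetic field. A magnetic field is a closed two-form on $\mathbb{R}^d$ of the form $B=dA$ with bounded real components $B_{jk}(x)=-B_{kj}(x)=\partial_jA_k(x)-\partial_kA_j(x)$. Its flux through the triangle with vertices $x,y,x'\in\mathbb{R}^d$ is $$\Phi^B(x,y,x'):=\sum_{j,k}(y_j-x_j)(x'_k-y_k)\int_0^1dt\int_0^tds\,B_{jk}\big(x+t(y-x)+s(x'-y)\big).$$ Working in the transverse gauge, $\sum_{j=1}^d x_jA_j(x)=0$, the phase is $$\phi^A(x,y):=-\int_{[x,y]}A=-\Phi^B(0,x,y),$$ where $[x,y]$ is the oriented segment from $x$ to $y$. It is real and antisymmetric, and $\phi^{\epsilon A}=\epsilon\phi^A$ for $\epsilon\in\mathbb{R}$. Slowly varying case. This is the situation where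 the magnetic field perturbation comes from a slowly varying vector potential $A_\epsilon(x):=A(\epsilon x)$, where all the components of $dA$ are globally bounded together with their first order partial derivatives. The magnetic field perturbation is then $\epsilon B_\epsilon$ with $B_\epsilon(x):=(dA)(\epsilon x)$, and $$\phi^{A_\epsilon}(x,x'):=-\epsilon\,\Phi^{B_\epsilon}(0,x,x').$$ Since the phases are antisymmetric, for self-adjoint $T_K\in\mathscr{C}^\alpha$ the operators $T_{K_{\epsilon A}}$ and $T_{K_{A_\epsilon}}$ with integral kernels $K_{\epsilon A}$ and $K_{A_\epsilon}$ belong to $\mathscr{C}^\alpha$ and are self-adjoint. *)

theory Defs
  imports "HOL-Analysis.Analysis"
begin

section \<open>Operators on the space of square-integrable functions\<close>

text \<open>Elements of $L^2$ are represented by Borel functions; equality in $L^2$ is equality almost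
  everywhere, so operators act on representatives and all operator identities hold almost
  everywhere.\<close>

definition L2 :: "('a::euclidean_space \<Rightarrow> complex) set" where
  "L2 = {f. f \<in> borel_measurable lborel \<and> integrable lborel (\<lambda>x. (cmod (f x))\<^sup>2)}"

definition L2_norm :: "('a::euclidean_space \<Rightarrow> complex) \<Rightarrow> real" where
  "L2_norm f = sqrt (LINT x|lborel. (cmod (f x))\<^sup>2)"

definition L2_inner :: "('a::euclidean_space \<Rightarrow> complex) \<Rightarrow> ('a \<Rightarrow> complex) \<Rightarrow> complex" where
  "L2_inner f g = (LINT x|lborel. cnj (f x) * g x)"

text \<open>Additivity and boundedness make such an operator respect equality almost everywhere.\<close>

definition L2_bounded_linear ::
  "(('a::euclidean_space \<Rightarrow> complex) \<Rightarrow> ('a \<Rightarrow> complex)) \<Rightarrow> bool" where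
  "L2_bounded_linear T \<longleftrightarrow>
     (\<forall>f\<in>L2. T f \<in> L2) \<and>
     (\<forall>f\<in>L2. \<forall>g\<in>L2. AE x in lborel. T (\<lambda>y. f y + g y) x = T f x + T g x) \<and>
     (\<forall>a. \<forall>f\<in>L2. AE x in lborel. T (\<lambda>y. a * f y) x = a * T f x) \<and>
     (\<exists>C. \<forall>f\<in>L2. L2_norm (T f) \<le> C * L2_norm f)"

definition L2_selfadjoint ::
  "(('a::euclidean_space \<Rightarrow> complex) \<Rightarrow> ('a \<Rightarrow> complex)) \<Rightarrow> bool" where
  "L2_selfadjoint T \<longleftrightarrow> (\<forall>f\<in>L2. \<forall>g\<in>L2. L2_inner (T f) g = L2_inner f (T g))"

definition L2_resolvent_set ::
  "(('a::euclidean_space \<Rightarrow> complex) \<Rightarrow> ('a \<Rightarrow> complex)) \<Rightarrow> complex set" where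
  "L2_resolvent_set T = {z. \<exists>R. L2_bounded_linear R \<and>
     (\<forall>f\<in>L2. (AE x in lborel. R (\<lambda>y. T f y - z * f y) x = f x) \<and>
             (AE x in lborel. T (R f) x - z * R f x = f x))}"

definition L2_spectrum ::
  "(('a::euclidean_space \<Rightarrow> complex) \<Rightarrow> ('a \<Rightarrow> complex)) \<Rightarrow> complex set" where
  "L2_spectrum T = - L2_resolvent_set T"

text \<open>Only used for self-adjoint operators, whose spectrum is real.\<close>

definition sup_spectrum ::
  "(('a::euclidean_space \<Rightarrow> complex) \<Rightarrow> ('a \<Rightarrow> complex)) \<Rightarrow> real" where
  "sup_spectrum T = Sup {t::real. complex_of_real t \<in> L2_spectrum T}"


section \<open>Off-diagonal polynomial decay\<close>

text \<open>The class contains the identity and is a linear space, so its elements are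
  $c\,\mathbf{1} + T_K$ with $c$ a complex number. The term $c\,\mathbf{1}$ is carried as a
  separate coefficient; it stands for the kernel $c\,\delta(x-y)$ and hence adds $|c|$ to every
  norm.\<close>

definition kernel_op ::
  "complex \<Rightarrow> ('a::euclidean_space \<Rightarrow> 'a \<Rightarrow> complex) \<Rightarrow> ('a \<Rightarrow> complex) \<Rightarrow> ('a \<Rightarrow> complex)" where
  "kernel_op c K f = (\<lambda>x. c * f x + (LINT y|lborel. K x y * f y))"

definition japanese_bracket :: "'a::euclidean_space \<Rightarrow> real" where
  "japanese_bracket x = sqrt (1 + (norm x)\<^sup>2)"

definition kernel_norm :: "real \<Rightarrow> ('a::euclidean_space \<Rightarrow> 'a \<Rightarrow> complex) \<Rightarrow> ennreal" where
  "kernel_norm \<alpha> K = max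
     (SUP x. \<integral>\<^sup>+ y. ennreal (cmod (K x y) * japanese_bracket (x - y) powr \<alpha>) \<partial>lborel)
     (SUP y. \<integral>\<^sup>+ x. ennreal (cmod (K x y) * japanese_bracket (x - y) powr \<alpha>) \<partial>lborel)"

definition decay_class :: "real \<Rightarrow> (complex \<times> ('a::euclidean_space \<Rightarrow> 'a \<Rightarrow> complex)) set" where
  "decay_class \<alpha> = {(c, K). (\<lambda>(x, y). K x y) \<in> borel_measurable (borel \<Otimes>\<^sub>M borel) \<and>
                            kernel_norm \<alpha> K < \<infinity>}"

definition decay_norm :: "real \<Rightarrow> complex \<Rightarrow> ('a::euclidean_space \<Rightarrow> 'a \<Rightarrow> complex) \<Rightarrow> real" where
  "decay_norm \<alpha> c K = cmod c + enn2real (kernel_norm \<alpha> K)"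


section \<open>Magnetic fields and phases\<close>

definition partial_deriv :: "'n::finite \<Rightarrow> (real^'n \<Rightarrow> real) \<Rightarrow> real^'n \<Rightarrow> real" where
  "partial_deriv j f x = deriv (\<lambda>t. f (x + t *\<^sub>R axis j 1)) 0"

definition mag_field :: "(real^'n \<Rightarrow> real^'n) \<Rightarrow> real^'n \<Rightarrow> 'n::finite \<Rightarrow> 'n \<Rightarrow> real" where
  "mag_field A x j k =
     partial_deriv j (\<lambda>y. A y $ k) x - partial_deriv k (\<lambda>y. A y $ j) x"

text \<open>A continuously differentiable vector potential in the transverse gauge, whose field has
  components bounded by $M$.\<close>

definition transverse_potential :: "real \<Rightarrow> (real^'n \<Rightarrow> real^'n::finite) \<Rightarrow> bool" where
  "transverse_potential M A \<longleftrightarrow>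
     (\<exists>A' :: real^'n \<Rightarrow> (real^'n) \<Rightarrow>\<^sub>L (real^'n).
        (\<forall>x. (A has_derivative blinfun_apply (A' x)) (at x)) \<and> continuous_on UNIV A') \<and>
     (\<forall>x. (\<Sum>j\<in>UNIV. x $ j * A x $ j) = 0) \<and>
     (\<forall>x j k. \<bar>mag_field A x j k\<bar> \<le> M)"

definition constant_field :: "(real^'n \<Rightarrow> real^'n::finite) \<Rightarrow> bool" where
  "constant_field A \<longleftrightarrow> (\<forall>x y. mag_field A x = mag_field A y)"

definition bounded_field_gradient :: "real \<Rightarrow> (real^'n \<Rightarrow> real^'n::finite) \<Rightarrow> bool" where
  "bounded_field_gradient M A \<longleftrightarrow>
     (\<forall>x i j k. (\<lambda>t. mag_field A (x + t *\<^sub>R axis i 1) j k) differentiable (at (0::real)) \<and>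
                \<bar>partial_deriv i (\<lambda>y. mag_field A y j k) x\<bar> \<le> M)"

definition flux ::
  "(real^'n \<Rightarrow> 'n \<Rightarrow> 'n \<Rightarrow> real) \<Rightarrow> real^'n \<Rightarrow> real^'n \<Rightarrow> real^'n::finite \<Rightarrow> real" where
  "flux B x y x' =
     (\<Sum>j\<in>UNIV. \<Sum>k\<in>UNIV. (y $ j - x $ j) * (x' $ k - y $ k) *
        integral {0..1} (\<lambda>t. integral {0..t} (\<lambda>s.
          B (x + t *\<^sub>R (y - x) + s *\<^sub>R (x' - y)) j k)))"

definition phase :: "(real^'n \<Rightarrow> real^'n) \<Rightarrow> real^'n \<Rightarrow> real^'n::finite \<Rightarrow> real" where
  "phase A x y = - integral {0..1} (\<lambda>t. \<Sum>j\<in>UNIV. (y $ j - x $ j) * A (x + t *\<^sub>R (y - x)) $ j)"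

text \<open>The phase of $A_\epsilon(x) = A(\epsilon x)$, whose field is $\epsilon B_\epsilon$ with
  $B_\epsilon(x) = (dA)(\epsilon x)$.\<close>

definition slow_phase :: "real \<Rightarrow> (real^'n \<Rightarrow> real^'n) \<Rightarrow> real^'n \<Rightarrow> real^'n::finite \<Rightarrow> real" where
  "slow_phase \<epsilon> A x x' = - \<epsilon> * flux (\<lambda>y. mag_field A (\<epsilon> *\<^sub>R y)) 0 x x'"

text \<open>The phases vanish on the diagonal, so the coefficient of the identity is unchanged.\<close>

definition edge ::
  "(real^'n \<Rightarrow> real^'n) \<Rightarrow> complex \<Rightarrow> (real^'n \<Rightarrow> real^'n \<Rightarrow> complex) \<Rightarrow> real \<Rightarrow> real" where
  "edge A c K \<epsilon> =
     sup_spectrum (kernel_op c (\<lambda>x y. cis (phase (\<lambda>z. \<epsilon> *\<^sub>R A z) x y) * K x y))"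

definition slow_edge ::
  "(real^'n \<Rightarrow> real^'n) \<Rightarrow> complex \<Rightarrow> (real^'n \<Rightarrow> real^'n \<Rightarrow> complex) \<Rightarrow> real \<Rightarrow> real" where
  "slow_edge A c K \<epsilon> = sup_spectrum (kernel_op c (\<lambda>x y. cis (slow_phase \<epsilon> A x y) * K x y))"

end

theory Submission
  imports Defs "HOL-Probability.Characteristic_Functions" "HOL-Real_Asymp.Real_Asymp"
begin

text \<open>
  The operators are bounded and self-adjoint, so \<open>\<E>\<close> is the supremum of the numerical range, and lower
  bounds for it come from trial functions. A phase \<open>q\<close> is added to an operator by taking an almost
  maximising \<open>f\<close> and the functions
  \<open>f\<^sub>u x = exp (- \<bar>s x - u\<bar>\<^sup>2) cis (q x (u / s)) f x\<close>: averaging their quadratic forms over \<open>u\<close>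
  multiplies the kernel by a Gaussian average of \<open>cis\<close> of the flux through the triangle \<open>x, y, u / s\<close>.
  With \<open>s = sqrt h\<close> and a field of size \<open>h\<close> the flux is of order \<open>sqrt h \<bar>x - y\<bar>\<close>, and errors of second
  order in it are harmless. For a constant or slowly varying field the first-order term is odd
  about the midpoint of \<open>x\<close> and \<open>y\<close>, so it averages to zero, which gives the Lipschitz bound. For a
  general field it is cancelled by averaging over \<open>h\<close> and \<open>- h\<close> instead, which gives the approximate
  midpoint convexity \<open>\<E>(\<epsilon>) \<le> (\<E>(\<epsilon> + h) + \<E>(\<epsilon> - h)) / 2 + C h powr (\<alpha> / 2)\<close>; iterating it dyadically
  yields the Hoelder bound for \<open>\<alpha> < 2\<close> and the logarithm for \<open>\<alpha> = 2\<close>.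
\<close>

text \<open>The scale is fixed by a balance. Localising at distance \<open>1/s\<close> damps the
  kernel by \<open>exp (- s^2 |x - y|^2 / 2)\<close>, an error of order
  \<open>(s |x - y|)^2\<close>. The point \<open>u / s\<close> typically lies at distance
  \<open>1/s\<close> from the midpoint of \<open>x\<close> and \<open>y\<close>, so a field of size
  \<open>h\<close> sends a flux of order \<open>h |x - y| / s\<close> through the triangle; its
  square matches the first error exactly when \<open>s^2 = h\<close>. A kernel with a weight of
  order \<alpha> < 2 cannot pay for \<open>|x - y|^2\<close>, so the bounded second-order errors are
  interpolated down to the power \<alpha>, whence the exponent \<open>\<alpha> / 2\<close>. Only
  closed loops enter, so all errors depend on \<open>x - y\<close> and not on the position, although
  the phases themselves may grow with the position.

  Trial functions bound an edge from one side only. The other side comes from removing a phase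
  instead of adding it, or from reflecting \<epsilon>.

  A separate obstacle: self-adjointness is given for the unperturbed operator only. Since the phases
  act on the kernel and not on the multiple of the identity, these two have to be shown Hermitian
  separately before the perturbed operators can be treated by their forms.\<close>

type_synonym 'a operator = "('a \<Rightarrow> complex) \<Rightarrow> 'a \<Rightarrow> complex"
type_synonym 'a kernel = "'a \<Rightarrow> 'a \<Rightarrow> complex"
type_synonym 'n vector_field = "real^'n \<Rightarrow> real^'n"

abbreviation lborel2 :: "('a::euclidean_space \<times> 'a) measure" where
  "lborel2 \<equiv> lborel \<Otimes>\<^sub>M lborel"

section \<open>The spectrum of bounded self-adjoint operators\<close>

lemma borel_measurable_cnj [measurable (raw)]:
  "f \<in> borel_measurable M \<Longrightarrow> (\<lambda>x. cnj (f x)) \<in> borel_measurable M"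
  by (rule measurable_compose[OF _ borel_measurable_continuous_onI]) (auto intro: continuous_intros)

lemma L2_measurable: "f \<in> L2 \<Longrightarrow> f \<in> borel_measurable borel"
  by (simp add: L2_def)

lemma L2_integrable: "f \<in> L2 \<Longrightarrow> integrable lborel (\<lambda>x. (cmod (f x))\<^sup>2)"
  by (simp add: L2_def)

lemma L2_integrable_mult:
  assumes "f \<in> L2" "g \<in> L2"
  shows "integrable lborel (\<lambda>x. cnj (f x) * g x)"
proof (rule Bochner_Integration.integrable_bound)
  show "integrable lborel (\<lambda>x. (cmod (f x))\<^sup>2 + (cmod (g x))\<^sup>2)"
    using assms by (intro Bochner_Integration.integrable_add L2_integrable)
  show "(\<lambda>x. cnj (f x) * g x) \<in> borel_measurable lborel"
    using assms[THEN L2_measurable] by measurable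
  have "cmod (f x) * cmod (g x) \<le> (cmod (f x))\<^sup>2 + (cmod (g x))\<^sup>2" for x
    using sum_squares_bound[of "cmod (f x)" "cmod (g x)"]
      mult_nonneg_nonneg[OF norm_ge_zero norm_ge_zero, of "f x" "g x"] by linarith
  then show "AE x in lborel. norm (cnj (f x) * g x) \<le> norm ((cmod (f x))\<^sup>2 + (cmod (g x))\<^sup>2)"
    by (simp add: norm_mult)
qed

lemma L2_add:
  assumes "f \<in> L2" "g \<in> L2"
  shows "(\<lambda>x. f x + g x) \<in> L2"
proof -
  note [measurable] = assms[THEN L2_measurable]
  have "integrable lborel (\<lambda>x. (cmod (f x + g x))\<^sup>2)"
  proof (rule Bochner_Integration.integrable_bound)
    show "integrable lborel (\<lambda>x. 2 * (cmod (f x))\<^sup>2 + 2 * (cmod (g x))\<^sup>2)"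
      using assms by (intro Bochner_Integration.integrable_add Bochner_Integration.integrable_mult_right L2_integrable)
    have "(cmod (f x + g x))\<^sup>2 \<le> 2 * (cmod (f x))\<^sup>2 + 2 * (cmod (g x))\<^sup>2" for x
    proof -
      have "(cmod (f x + g x))\<^sup>2 \<le> (cmod (f x) + cmod (g x))\<^sup>2"
        by (intro power_mono norm_triangle_ineq) auto
      also have "\<dots> \<le> 2 * (cmod (f x))\<^sup>2 + 2 * (cmod (g x))\<^sup>2"
        using sum_squares_bound[of "cmod (f x)" "cmod (g x)"] by (simp add: power2_sum)
      finally show ?thesis .
    qed
    then show "AE x in lborel. norm ((cmod (f x + g x))\<^sup>2) \<le> norm (2 * (cmod (f x))\<^sup>2 + 2 * (cmod (g x))\<^sup>2)"
      by simp
  qed auto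
  then show ?thesis by (simp add: L2_def)
qed

lemma L2_cmult: "f \<in> L2 \<Longrightarrow> (\<lambda>x. a * f x) \<in> L2"
  by (auto simp: L2_def norm_mult power_mult_distrib)

lemma L2_diff: "f \<in> L2 \<Longrightarrow> g \<in> L2 \<Longrightarrow> (\<lambda>x. f x - g x) \<in> L2"
  using L2_add[of f "\<lambda>x. -1 * g x"] L2_cmult[of g "-1"] by simp

lemma L2_inner_add_right:
  "f \<in> L2 \<Longrightarrow> g \<in> L2 \<Longrightarrow> h \<in> L2 \<Longrightarrow> L2_inner f (\<lambda>x. g x + h x) = L2_inner f g + L2_inner f h"
  by (simp add: L2_inner_def distrib_left L2_integrable_mult)

lemma L2_inner_add_left:
  "f \<in> L2 \<Longrightarrow> g \<in> L2 \<Longrightarrow> h \<in> L2 \<Longrightarrow> L2_inner (\<lambda>x. f x + g x) h = L2_inner f h + L2_inner g h"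
  by (simp add: L2_inner_def distrib_right L2_integrable_mult)

lemma L2_inner_cmult_right: "L2_inner f (\<lambda>x. a * g x) = a * L2_inner f g"
  by (simp add: L2_inner_def mult.left_commute flip: integral_mult_right_zero)

lemma L2_inner_cmult_left: "L2_inner (\<lambda>x. a * f x) g = cnj a * L2_inner f g"
  by (simp add: L2_inner_def mult.assoc flip: integral_mult_right_zero)

lemma L2_inner_commute: "L2_inner g f = cnj (L2_inner f g)"
proof -
  have "L2_inner g f = (LINT x|lborel. cnj (cnj (f x) * g x))"
    by (simp add: L2_inner_def mult.commute)
  also have "\<dots> = cnj (L2_inner f g)"
    unfolding L2_inner_def by (rule Bochner_Integration.integral_cnj)
  finally show ?thesis .
qed

lemma L2_inner_cong_AE:
  assumes "AE x in lborel. f x = f' x" "AE x in lborel. g x = g' x"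
    "f \<in> L2" "f' \<in> L2" "g \<in> L2" "g' \<in> L2"
  shows "L2_inner f g = L2_inner f' g'"
proof -
  note [measurable] = assms(3-)[THEN L2_measurable]
  show ?thesis
    unfolding L2_inner_def using assms(1,2) by (intro integral_cong_AE) auto
qed

lemma L2_norm_nonneg: "0 \<le> L2_norm f"
  by (simp add: L2_norm_def)

lemma L2_norm_sq: "(L2_norm f)\<^sup>2 = (LINT x|lborel. (cmod (f x))\<^sup>2)"
  by (simp add: L2_norm_def)

lemma L2_inner_self: "L2_inner f f = of_real ((L2_norm f)\<^sup>2)"
proof -
  have "cnj (f x) * f x = complex_of_real ((cmod (f x))\<^sup>2)" for x
    by (simp only: complex_norm_square mult.commute)
  then show ?thesis
    unfolding L2_norm_sq L2_inner_def by (simp only: integral_complex_of_real)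
qed

lemma L2_norm_cong_AE:
  assumes "AE x in lborel. f x = f' x" "f \<in> L2" "f' \<in> L2"
  shows "L2_norm f = L2_norm f'"
proof -
  note [measurable] = assms(2-)[THEN L2_measurable]
  show ?thesis
    unfolding L2_norm_def using assms(1) by (intro arg_cong[where f=sqrt] integral_cong_AE) auto
qed

lemma L2_norm_eq_0_iff:
  assumes "f \<in> L2"
  shows "L2_norm f = 0 \<longleftrightarrow> (AE x in lborel. f x = 0)"
  using integral_nonneg_eq_0_iff_AE[OF L2_integrable[OF assms]] by (simp add: L2_norm_def)

lemma L2_norm_cmult: "L2_norm (\<lambda>x. a * f x) = cmod a * L2_norm f"
  by (simp add: L2_norm_def norm_mult power_mult_distrib real_sqrt_mult)

lemma L2_norm_add_sq:
  assumes "f \<in> L2" "g \<in> L2"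
  shows "(L2_norm (\<lambda>x. f x + g x))\<^sup>2 = (L2_norm f)\<^sup>2 + 2 * Re (L2_inner f g) + (L2_norm g)\<^sup>2"
proof -
  have "of_real ((L2_norm (\<lambda>x. f x + g x))\<^sup>2) = L2_inner f f + L2_inner f g + (L2_inner g f + L2_inner g g)"
    unfolding L2_inner_self[symmetric] using assms
    by (simp add: L2_add L2_inner_add_right L2_inner_add_left)
  then have "(L2_norm (\<lambda>x. f x + g x))\<^sup>2 = Re (L2_inner f f + L2_inner f g + (L2_inner g f + L2_inner g g))"
    by (metis Re_complex_of_real)
  also have "\<dots> = (L2_norm f)\<^sup>2 + 2 * Re (L2_inner f g) + (L2_norm g)\<^sup>2"
    by (subst L2_inner_commute[of g]) (simp add: L2_inner_self)
  finally show ?thesis .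
qed

text \<open>The squares of the norms of \<open>f + g\<close> and \<open>f - g\<close> are
  nonnegative. This stands in for Cauchy--Schwarz wherever only the existence of some constant
  matters.\<close>

lemma L2_form_abs_le:
  assumes "f \<in> L2" "g \<in> L2"
  shows "2 * \<bar>Re (L2_inner f g)\<bar> \<le> (L2_norm f)\<^sup>2 + (L2_norm g)\<^sup>2"
proof -
  have "(L2_norm (\<lambda>x. f x - g x))\<^sup>2 = (L2_norm f)\<^sup>2 - 2 * Re (L2_inner f g) + (L2_norm g)\<^sup>2"
    using L2_norm_add_sq[OF assms(1) L2_cmult[OF assms(2), of "-1"]]
    unfolding L2_inner_cmult_right L2_norm_cmult by simp
  then show ?thesis
    using L2_norm_add_sq[OF assms] zero_le_power2[of "L2_norm (\<lambda>x. f x - g x)"]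
      zero_le_power2[of "L2_norm (\<lambda>x. f x + g x)"] by linarith
qed

lemma L2_norm_add_sq_le:
  assumes "f \<in> L2" "g \<in> L2"
  shows "(L2_norm (\<lambda>x. f x + g x))\<^sup>2 \<le> 2 * (L2_norm f)\<^sup>2 + 2 * (L2_norm g)\<^sup>2"
  using L2_norm_add_sq[OF assms] L2_form_abs_le[OF assms] by linarith

section \<open>Bounded operators acting on representatives\<close>

lemma L2_bounded_linearD:
  assumes "L2_bounded_linear T"
  shows "f \<in> L2 \<Longrightarrow> T f \<in> L2"
    and "f \<in> L2 \<Longrightarrow> g \<in> L2 \<Longrightarrow> AE x in lborel. T (\<lambda>y. f y + g y) x = T f x + T g x"
    and "f \<in> L2 \<Longrightarrow> AE x in lborel. T (\<lambda>y. a * f y) x = a * T f x"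
  using assms by (auto simp: L2_bounded_linear_def)

lemma L2_bounded_linear_bound:
  assumes "L2_bounded_linear T"
  obtains C where "0 < C" "\<And>f. f \<in> L2 \<Longrightarrow> L2_norm (T f) \<le> C * L2_norm f"
proof -
  obtain C where C: "\<And>f. f \<in> L2 \<Longrightarrow> L2_norm (T f) \<le> C * L2_norm f"
    using assms unfolding L2_bounded_linear_def by blast
  have "L2_norm (T f) \<le> (\<bar>C\<bar> + 1) * L2_norm f" if "f \<in> L2" for f
  proof -
    have "C * L2_norm f \<le> (\<bar>C\<bar> + 1) * L2_norm f"
      by (intro mult_right_mono L2_norm_nonneg) linarith
    then show ?thesis using C[OF that] by linarith
  qed
  then show thesis by (intro that[of "\<bar>C\<bar> + 1"]) auto
qed

lemma L2_bounded_linearI: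
  assumes "\<And>f. f \<in> L2 \<Longrightarrow> T f \<in> L2"
    and "\<And>f g. f \<in> L2 \<Longrightarrow> g \<in> L2 \<Longrightarrow> AE x in lborel. T (\<lambda>y. f y + g y) x = T f x + T g x"
    and "\<And>a f. f \<in> L2 \<Longrightarrow> AE x in lborel. T (\<lambda>y. a * f y) x = a * T f x"
    and "\<And>f. f \<in> L2 \<Longrightarrow> (L2_norm (T f))\<^sup>2 \<le> C * (L2_norm f)\<^sup>2"
  shows "L2_bounded_linear T"
proof -
  have "L2_norm (T f) \<le> sqrt C * L2_norm f" if "f \<in> L2" for f
    using real_sqrt_le_mono[OF assms(4)[OF that]] by (simp add: real_sqrt_mult L2_norm_nonneg)
  then show ?thesis using assms(1-3) unfolding L2_bounded_linear_def by blast
qed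

lemma L2_bounded_linear_bound_sq:
  assumes "L2_bounded_linear T"
  obtains C where "0 < C" "\<And>f. f \<in> L2 \<Longrightarrow> (L2_norm (T f))\<^sup>2 \<le> C * (L2_norm f)\<^sup>2"
proof -
  obtain C where C: "0 < C" "\<And>f. f \<in> L2 \<Longrightarrow> L2_norm (T f) \<le> C * L2_norm f"
    using L2_bounded_linear_bound[OF assms] by metis
  have "(L2_norm (T f))\<^sup>2 \<le> C\<^sup>2 * (L2_norm f)\<^sup>2" if "f \<in> L2" for f
    using power_mono[OF C(2)[OF that] L2_norm_nonneg, of 2] by (simp add: power_mult_distrib)
  then show thesis using that[of "C\<^sup>2"] C(1) by auto
qed

text \<open>The difference of the arguments has norm zero, hence so has its image by boundedness.
  Every composition needs this: the identities for the inner operator hold only almost everywhere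
  and must be carried through the outer one.\<close>

lemma L2_bounded_linear_cong_AE:
  assumes T: "L2_bounded_linear T" and "f \<in> L2" "g \<in> L2" and eq: "AE x in lborel. f x = g x"
  shows "AE x in lborel. T f x = T g x"
proof -
  let ?h = "\<lambda>x. f x - g x"
  have h: "?h \<in> L2" using assms by (intro L2_diff)
  obtain C where C: "\<And>f. f \<in> L2 \<Longrightarrow> L2_norm (T f) \<le> C * L2_norm f"
    using L2_bounded_linear_bound[OF T] by metis
  have "L2_norm ?h = 0"
    using eq by (subst L2_norm_eq_0_iff[OF h]) auto
  then have "L2_norm (T ?h) = 0"
    using C[OF h] L2_norm_nonneg[of "T ?h"] by simp
  then have "AE x in lborel. T ?h x = 0"
    using L2_norm_eq_0_iff L2_bounded_linearD(1)[OF T h] by blast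
  moreover have "AE x in lborel. T (\<lambda>y. g y + ?h y) x = T g x + T ?h x"
    using L2_bounded_linearD(2)[OF T \<open>g \<in> L2\<close> h] .
  ultimately show ?thesis by (auto simp: eventually_conj_iff)
qed

text \<open>Affine functions of \<open>T\<close> are what the resolvent arguments work with:
  \<open>1 - (t - T) / l\<close> for a point \<open>t\<close> above the form, and
  \<open>m - T\<close> at its supremum \<open>m\<close>.\<close>

lemma L2_bounded_linear_affine:
  fixes T :: "'a::euclidean_space operator"
  assumes T: "L2_bounded_linear T"
  shows "L2_bounded_linear (\<lambda>f x. a * f x + b * T f x)"
proof -
  obtain C where C: "\<And>f. f \<in> L2 \<Longrightarrow> (L2_norm (T f))\<^sup>2 \<le> C * (L2_norm f)\<^sup>2"
    using L2_bounded_linear_bound_sq[OF T] by metis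
  show ?thesis
  proof (rule L2_bounded_linearI)
    fix f :: "'a \<Rightarrow> complex" assume f: "f \<in> L2"
    note Tf = L2_bounded_linearD(1)[OF T f]
    show "(\<lambda>x. a * f x + b * T f x) \<in> L2"
      by (intro L2_add L2_cmult f Tf)
    have "(L2_norm (\<lambda>x. a * f x + b * T f x))\<^sup>2 \<le> 2 * (cmod a * L2_norm f)\<^sup>2 + 2 * (cmod b * L2_norm (T f))\<^sup>2"
      using L2_norm_add_sq_le[OF L2_cmult[OF f] L2_cmult[OF Tf]] unfolding L2_norm_cmult .
    also have "\<dots> \<le> 2 * (cmod a * L2_norm f)\<^sup>2 + 2 * ((cmod b)\<^sup>2 * (C * (L2_norm f)\<^sup>2))"
      by (auto simp: power_mult_distrib intro!: mult_left_mono C f)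
    finally show "(L2_norm (\<lambda>x. a * f x + b * T f x))\<^sup>2 \<le> (2 * (cmod a)\<^sup>2 + 2 * ((cmod b)\<^sup>2 * C)) * (L2_norm f)\<^sup>2"
      by (simp add: algebra_simps)
    show "AE x in lborel. a * (c * f x) + b * T (\<lambda>y. c * f y) x = c * (a * f x + b * T f x)" for c
      using L2_bounded_linearD(3)[OF T f, of c] by (auto simp: algebra_simps)
    fix g :: "'a \<Rightarrow> complex" assume g: "g \<in> L2"
    show "AE x in lborel. a * (f x + g x) + b * T (\<lambda>y. f y + g y) x = a * f x + b * T f x + (a * g x + b * T g x)"
      using L2_bounded_linearD(2)[OF T f g] by (auto simp: algebra_simps)
  qed
qed

lemma L2_bounded_linear_funpow:
  fixes T :: "'a::euclidean_space operator"
  assumes T: "L2_bounded_linear T"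
  shows "L2_bounded_linear (T ^^ n)"
proof (induction n)
  case 0
  show ?case by (rule L2_bounded_linearI[where C=1]) auto
next
  case (Suc n)
  obtain C where C: "0 < C" "\<And>f. f \<in> L2 \<Longrightarrow> (L2_norm (T f))\<^sup>2 \<le> C * (L2_norm f)\<^sup>2"
    using L2_bounded_linear_bound_sq[OF T] by metis
  obtain D where D: "0 < D" "\<And>f. f \<in> L2 \<Longrightarrow> (L2_norm ((T ^^ n) f))\<^sup>2 \<le> D * (L2_norm f)\<^sup>2"
    using L2_bounded_linear_bound_sq[OF Suc] by metis
  note n = L2_bounded_linearD[OF Suc] and T1 = L2_bounded_linearD[OF T]
  show ?case
  proof (rule L2_bounded_linearI[where C="C * D"])
    fix f :: "'a \<Rightarrow> complex" assume f: "f \<in> L2"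
    show "(T ^^ Suc n) f \<in> L2" using f n(1) T1(1) by simp
    show "(L2_norm ((T ^^ Suc n) f))\<^sup>2 \<le> C * D * (L2_norm f)\<^sup>2"
      using order_trans[OF C(2)[OF n(1)[OF f]] mult_left_mono[OF D(2)[OF f], of C]] C(1)
      by (simp add: mult.assoc)
    show "AE x in lborel. (T ^^ Suc n) (\<lambda>y. a * f y) x = a * (T ^^ Suc n) f x" for a
    proof -
      have "AE x in lborel. T ((T ^^ n) (\<lambda>y. a * f y)) x = T (\<lambda>y. a * (T ^^ n) f y) x"
        by (intro L2_bounded_linear_cong_AE[OF T] n L2_cmult f)
      then show ?thesis
        using T1(3)[OF n(1)[OF f], of a] by auto
    qed
    fix g :: "'a \<Rightarrow> complex" assume g: "g \<in> L2"
    have "AE x in lborel. T ((T ^^ n) (\<lambda>y. f y + g y)) x = T (\<lambda>y. (T ^^ n) f y + (T ^^ n) g y) x"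
      by (intro L2_bounded_linear_cong_AE[OF T] n L2_add f g)
    then show "AE x in lborel. (T ^^ Suc n) (\<lambda>y. f y + g y) x = (T ^^ Suc n) f x + (T ^^ Suc n) g x"
      using T1(2)[OF n(1)[OF f] n(1)[OF g]] by auto
  qed
qed

lemma L2_selfadjoint_affine:
  assumes T: "L2_bounded_linear T" "L2_selfadjoint T"
  shows "L2_selfadjoint (\<lambda>f x. of_real a * f x + of_real b * T f x)"
  unfolding L2_selfadjoint_def
proof (intro ballI)
  fix f g :: "'a \<Rightarrow> complex" assume f: "f \<in> L2" and g: "g \<in> L2"
  have "L2_inner (T f) g = L2_inner f (T g)"
    using T(2) f g by (simp add: L2_selfadjoint_def)
  then show "L2_inner (\<lambda>x. of_real a * f x + of_real b * T f x) g =
      L2_inner f (\<lambda>x. of_real a * g x + of_real b * T g x)"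
    using f g L2_bounded_linearD(1)[OF T(1)]
    by (simp add: L2_inner_add_left L2_inner_add_right L2_cmult L2_inner_cmult_right L2_inner_cmult_left)
qed

text \<open>The constant is far from the operator norm; only its finiteness is used, to make shifted
  operators nonnegative and to bound the set of Rayleigh quotients.\<close>

lemma L2_bounded_linear_form:
  fixes T :: "'a::euclidean_space operator"
  assumes T: "L2_bounded_linear T"
  obtains C where "0 < C" "\<And>f. f \<in> L2 \<Longrightarrow> \<bar>Re (L2_inner f (T f))\<bar> \<le> C * (L2_norm f)\<^sup>2"
proof -
  obtain C where C: "0 < C" "\<And>f. f \<in> L2 \<Longrightarrow> (L2_norm (T f))\<^sup>2 \<le> C * (L2_norm f)\<^sup>2"
    using L2_bounded_linear_bound_sq[OF T] by metis
  have "\<bar>Re (L2_inner f (T f))\<bar> \<le> (1 + C) * (L2_norm f)\<^sup>2" if f: "f \<in> L2" for f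
    using L2_form_abs_le[OF f L2_bounded_linearD(1)[OF T f]] C(2)[OF f] by (simp add: algebra_simps)
  then show thesis using C(1) by (intro that[of "1 + C"]) auto
qed

text \<open>Expanding \<open>0 \<le> \<langle>h, S h\<rangle>\<close> for \<open>h = f - S f / q\<close>.\<close>

lemma L2_norm_le_form:
  assumes S: "L2_bounded_linear S" "L2_selfadjoint S" and "0 < q"
    and pos: "\<And>f. f \<in> L2 \<Longrightarrow> 0 \<le> Re (L2_inner f (S f))"
    and le: "\<And>f. f \<in> L2 \<Longrightarrow> Re (L2_inner f (S f)) \<le> q * (L2_norm f)\<^sup>2"
    and f: "f \<in> L2"
  shows "(L2_norm (S f))\<^sup>2 \<le> q * Re (L2_inner f (S f))"
proof -
  define a where "a = complex_of_real (- 1 / q)"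
  let ?g = "S f"
  let ?h = "\<lambda>x. f x + a * ?g x"
  note SL2 = L2_bounded_linearD(1)[OF S(1)]
  have g: "?g \<in> L2" and ag: "(\<lambda>x. a * ?g x) \<in> L2" using f by (auto intro: SL2 L2_cmult)
  have h: "?h \<in> L2" using f ag by (intro L2_add)
  have "AE x in lborel. S ?h x = S f x + a * S ?g x"
    using L2_bounded_linearD(2)[OF S(1) f ag] L2_bounded_linearD(3)[OF S(1) g, of a] by auto
  then have "L2_inner ?h (S ?h) = L2_inner ?h (\<lambda>x. S f x + a * S ?g x)"
    by (intro L2_inner_cong_AE SL2 h L2_add L2_cmult f g) auto
  also have "\<dots> = L2_inner f (S f) + a * L2_inner f (S ?g) + (cnj a * L2_inner ?g (S f) + cnj a * a * L2_inner ?g (S ?g))"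
    using f g ag
    by (simp add: L2_inner_add_right L2_inner_add_left SL2 L2_cmult L2_add
        L2_inner_cmult_left L2_inner_cmult_right algebra_simps)
  \<comment> \<open>Self-adjointness turns both cross terms of the expansion into the squared norm
    of \<open>S f\<close>.\<close>
  also have "L2_inner f (S ?g) = L2_inner ?g ?g"
    using S(2) f g by (simp add: L2_selfadjoint_def)
  finally have "Re (L2_inner ?h (S ?h)) =
      Re (L2_inner f (S f)) - 2 / q * (L2_norm ?g)\<^sup>2 + 1 / q\<^sup>2 * Re (L2_inner ?g (S ?g))"
    by (simp add: L2_inner_self a_def power2_eq_square)
  \<comment> \<open>The form bound is applied at \<open>S f\<close> itself. It gives back
    \<open>1 / q\<close> of the \<open>2 / q\<close> subtracted by the cross terms, and the
    remaining \<open>1 / q\<close> is the claim.\<close>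
  moreover have "1 / q\<^sup>2 * Re (L2_inner ?g (S ?g)) \<le> 1 / q\<^sup>2 * (q * (L2_norm ?g)\<^sup>2)"
    by (intro mult_left_mono le g) auto
  ultimately have "0 \<le> Re (L2_inner f (S f)) - 1 / q * (L2_norm ?g)\<^sup>2"
    using pos[OF h] \<open>0 < q\<close> by (simp add: power2_eq_square)
  then show ?thesis using \<open>0 < q\<close> by (simp add: field_simps)
qed

section \<open>Pointwise Neumann series\<close>

lemma nn_integral_L2_norm:
  assumes "f \<in> L2"
  shows "(\<integral>\<^sup>+ x. ennreal ((cmod (f x))\<^sup>2) \<partial>lborel) = ennreal ((L2_norm f)\<^sup>2)"
  unfolding L2_norm_sq by (intro nn_integral_eq_integral L2_integrable assms) auto

lemma L2I_nn_integral:
  assumes [measurable]: "f \<in> borel_measurable borel" and "0 \<le> B"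
    and le: "(\<integral>\<^sup>+ x. ennreal ((cmod (f x))\<^sup>2) \<partial>lborel) \<le> ennreal B"
  shows "f \<in> L2" "(L2_norm f)\<^sup>2 \<le> B"
proof -
  have "(\<integral>\<^sup>+ x. ennreal (norm ((cmod (f x))\<^sup>2)) \<partial>lborel) < \<infinity>"
    using le by (simp add: order_le_less_trans)
  then show f: "f \<in> L2"
    by (auto simp: L2_def intro!: integrableI_bounded)
  show "(L2_norm f)\<^sup>2 \<le> B"
    using le \<open>0 \<le> B\<close> unfolding nn_integral_L2_norm[OF f] by simp
qed

lemma L2_norm_funpow_le:
  assumes S: "L2_bounded_linear S"
    and bd: "\<And>f. f \<in> L2 \<Longrightarrow> (L2_norm (S f))\<^sup>2 \<le> s\<^sup>2 * (L2_norm f)\<^sup>2" and f: "f \<in> L2"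
  shows "(L2_norm ((S ^^ n) f))\<^sup>2 \<le> s ^ n * s ^ n * (L2_norm f)\<^sup>2"
proof (induction n)
  case (Suc n)
  have "(L2_norm ((S ^^ Suc n) f))\<^sup>2 \<le> s\<^sup>2 * (L2_norm ((S ^^ n) f))\<^sup>2"
    using bd[OF L2_bounded_linearD(1)[OF L2_bounded_linear_funpow[OF S] f]] by simp
  also have "\<dots> \<le> s\<^sup>2 * (s ^ n * s ^ n * (L2_norm f)\<^sup>2)"
    using Suc by (intro mult_left_mono) auto
  finally show ?case by (simp add: power2_eq_square algebra_simps)
qed simp

text \<open>Weighted Cauchy--Schwarz \<open>(\<Sum>a\<^sub>n)\<^sup>2 \<le> \<Sum>s\<^sup>n \<cdot> \<Sum>s\<^sup>-\<^sup>n a\<^sub>n\<^sup>2\<close> replaces the completeness of \<open>L\<^sup>2\<close>: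
  the Neumann series converges pointwise almost everywhere.\<close>

lemma neumann_majorant:
  fixes S :: "'a::euclidean_space operator"
  assumes S: "L2_bounded_linear S" and s: "0 < s" "s < 1"
    and bd: "\<And>f. f \<in> L2 \<Longrightarrow> (L2_norm (S f))\<^sup>2 \<le> s\<^sup>2 * (L2_norm f)\<^sup>2"
    and f: "f \<in> L2"
  shows "(\<integral>\<^sup>+ x. (\<Sum>n. ennreal (cmod ((S ^^ n) f x)))\<^sup>2 \<partial>lborel) \<le> ennreal ((L2_norm f)\<^sup>2 / (1 - s)\<^sup>2)"
proof -
  have SL2: "(S ^^ n) f \<in> L2" for n
    using L2_bounded_linearD(1)[OF L2_bounded_linear_funpow[OF S] f] .
  note [measurable] = L2_measurable[OF SL2]
  note norm = L2_norm_funpow_le[OF S bd f]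
  have geom: "(\<Sum>n. ennreal (s ^ n)) = ennreal (1 / (1 - s))"
    using s by (subst suminf_ennreal2) (auto simp: suminf_geometric)
  have weighted: "(\<Sum>n. ennreal (cmod ((S ^^ n) f x)))\<^sup>2
      \<le> ennreal (1 / (1 - s)) * (\<Sum>n. ennreal ((1 / s) ^ n * (cmod ((S ^^ n) f x))\<^sup>2))" for x
  proof -
    \<comment> \<open>Each term is split as \<open>t^n\<close> times \<open>t^-n a\<close> with
      \<open>t^2 = s\<close>, so that the two sums of squares carry the weights \<open>s^n\<close>
      and \<open>s^-n\<close>.\<close>
    define t where "t = sqrt s"
    have t: "0 < t" and st: "t\<^sup>2 = s"
      using s by (auto simp: t_def)
    have tn: "(t ^ n)\<^sup>2 = s ^ n" for n
      unfolding st[symmetric] by (simp only: power_mult[symmetric] mult.commute)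
    have 1: "ennreal (t ^ n) * ennreal ((1 / t) ^ n * a) = ennreal a" for n a
      using t by (simp add: ennreal_mult'[symmetric] power_one_over)
    have 2: "(ennreal (t ^ n))\<^sup>2 = ennreal (s ^ n)" for n
      using t tn[of n] by (simp add: ennreal_power)
    have 3: "(ennreal ((1 / t) ^ n * cmod z))\<^sup>2 = ennreal ((1 / s) ^ n * (cmod z)\<^sup>2)" for n z
      using t tn[of n] by (simp add: ennreal_power power_mult_distrib power_one_over power_divide)
    show ?thesis
      using Cauchy_Schwarz_nn_integral[of "\<lambda>n. ennreal (t ^ n)" "count_space UNIV"
          "\<lambda>n. ennreal ((1 / t) ^ n * cmod ((S ^^ n) f x))"]
      by (simp only: nn_integral_count_space_nat 1 2 3 geom measurable_count_space borel_measurable_count_space)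
  qed
  have "(\<integral>\<^sup>+ x. (\<Sum>n. ennreal (cmod ((S ^^ n) f x)))\<^sup>2 \<partial>lborel)
      \<le> (\<integral>\<^sup>+ x. ennreal (1 / (1 - s)) * (\<Sum>n. ennreal ((1 / s) ^ n * (cmod ((S ^^ n) f x))\<^sup>2)) \<partial>lborel)"
    by (intro nn_integral_mono weighted)
  also have "\<dots> = ennreal (1 / (1 - s)) * (\<Sum>n. \<integral>\<^sup>+ x. ennreal ((1 / s) ^ n * (cmod ((S ^^ n) f x))\<^sup>2) \<partial>lborel)"
    by (subst nn_integral_cmult, measurable, subst nn_integral_suminf) auto
  \<comment> \<open>The squared norm of the \<open>n\<close>-th iterate decays like
    \<open>s^(2 n)\<close>; against the weight \<open>s^-n\<close> a summable \<open>s^n\<close>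
    survives.\<close>
  also have "\<dots> \<le> ennreal (1 / (1 - s)) * (\<Sum>n. ennreal (s ^ n) * ennreal ((L2_norm f)\<^sup>2))"
  proof (intro mult_left_mono suminf_le allI summableI)
    fix n
    have "(\<integral>\<^sup>+ x. ennreal ((1 / s) ^ n * (cmod ((S ^^ n) f x))\<^sup>2) \<partial>lborel) = ennreal ((1 / s) ^ n) * ennreal ((L2_norm ((S ^^ n) f))\<^sup>2)"
      using s by (simp add: ennreal_mult nn_integral_cmult nn_integral_L2_norm[OF SL2])
    also have "\<dots> \<le> ennreal ((1 / s) ^ n) * ennreal (s ^ n * s ^ n * (L2_norm f)\<^sup>2)"
      by (intro mult_left_mono ennreal_leI norm) auto
    also have "\<dots> = ennreal (s ^ n) * ennreal ((L2_norm f)\<^sup>2)"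
      using s by (simp add: ennreal_mult[symmetric] power_divide)
    finally show "(\<integral>\<^sup>+ x. ennreal ((1 / s) ^ n * (cmod ((S ^^ n) f x))\<^sup>2) \<partial>lborel) \<le> ennreal (s ^ n) * ennreal ((L2_norm f)\<^sup>2)" .
  qed simp
  also have "\<dots> = ennreal ((L2_norm f)\<^sup>2 / (1 - s)\<^sup>2)"
    unfolding ennreal_suminf_multc geom using s by (simp add: ennreal_mult[symmetric] power2_eq_square)
  finally show ?thesis .
qed

text \<open>The inverse of \<open>1 - S\<close> is the pointwise sum of \<open>(S ^^ n) f\<close>,
  which the majorant shows to converge absolutely almost everywhere and to be square-integrable.
  That it is a left inverse is an index shift. For the right inverse \<open>S\<close> would have to
  be exchanged with a pointwise series, so commutation of \<open>S\<close> and \<open>R\<close> is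
  proved instead.\<close>

lemma neumann_series:
  fixes S :: "'a::euclidean_space operator"
  assumes S: "L2_bounded_linear S" and s: "0 < s" "s < 1"
    and bd: "\<And>f. f \<in> L2 \<Longrightarrow> (L2_norm (S f))\<^sup>2 \<le> s\<^sup>2 * (L2_norm f)\<^sup>2"
  obtains R where "L2_bounded_linear R"
    "\<And>f. f \<in> L2 \<Longrightarrow> AE x in lborel. R (\<lambda>y. f y - S f y) x = f x"
    "\<And>f. f \<in> L2 \<Longrightarrow> AE x in lborel. R f x - S (R f) x = f x"
proof -
  define R where "R f x = (\<Sum>n. (S ^^ n) f x)" for f x
  note Sn = L2_bounded_linearD[OF L2_bounded_linear_funpow[OF S]] and S1 = L2_bounded_linearD[OF S]
  have summ: "AE x in lborel. summable (\<lambda>n. cmod ((S ^^ n) f x))" if f: "f \<in> L2" for f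
  proof -
    note [measurable] = L2_measurable[OF Sn(1)[OF f]]
    have "AE x in lborel. (\<Sum>n. ennreal (cmod ((S ^^ n) f x)))\<^sup>2 \<noteq> \<infinity>"
    proof (rule nn_integral_PInf_AE)
      show "(\<lambda>x. (\<Sum>n. ennreal (cmod ((S ^^ n) f x)))\<^sup>2) \<in> borel_measurable lborel"
        by measurable
      have "(\<integral>\<^sup>+ x. (\<Sum>n. ennreal (cmod ((S ^^ n) f x)))\<^sup>2 \<partial>lborel) < \<infinity>"
        by (rule order_le_less_trans[OF neumann_majorant[OF S s bd f]]) auto
      then show "(\<integral>\<^sup>+ x. (\<Sum>n. ennreal (cmod ((S ^^ n) f x)))\<^sup>2 \<partial>lborel) \<noteq> \<infinity>"
        by (rule less_imp_neq)
    qed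
    then show ?thesis
    proof eventually_elim
      case (elim x)
      then have "(\<Sum>n. ennreal (cmod ((S ^^ n) f x))) \<noteq> top"
        by (auto simp: power2_eq_square)
      then show ?case by (intro summable_suminf_not_top) auto
    qed
  qed
  have R: "R f \<in> L2" "(L2_norm (R f))\<^sup>2 \<le> 1 / (1 - s)\<^sup>2 * (L2_norm f)\<^sup>2" if f: "f \<in> L2" for f
  proof -
    note [measurable] = L2_measurable[OF Sn(1)[OF f]]
    have meas: "R f \<in> borel_measurable borel"
      unfolding R_def[abs_def] by measurable
    have "(\<integral>\<^sup>+ x. ennreal ((cmod (R f x))\<^sup>2) \<partial>lborel) \<le> (\<integral>\<^sup>+ x. (\<Sum>n. ennreal (cmod ((S ^^ n) f x)))\<^sup>2 \<partial>lborel)"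
    proof (intro nn_integral_mono_AE)
      show "AE x in lborel. ennreal ((cmod (R f x))\<^sup>2) \<le> (\<Sum>n. ennreal (cmod ((S ^^ n) f x)))\<^sup>2"
        using summ[OF f]
      proof eventually_elim
        case (elim x)
        have "cmod (R f x) \<le> (\<Sum>n. cmod ((S ^^ n) f x))"
          unfolding R_def by (rule summable_norm[OF elim])
        then have "ennreal ((cmod (R f x))\<^sup>2) \<le> ennreal ((\<Sum>n. cmod ((S ^^ n) f x))\<^sup>2)"
          by (intro ennreal_leI power_mono) auto
        then show ?case
          by (simp add: suminf_ennreal2 elim ennreal_power suminf_nonneg)
      qed
    qed
    also note neumann_majorant[OF S s bd f]
    finally have "(\<integral>\<^sup>+ x. ennreal ((cmod (R f x))\<^sup>2) \<partial>lborel) \<le> ennreal ((L2_norm f)\<^sup>2 / (1 - s)\<^sup>2)" .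
    from L2I_nn_integral[OF meas _ this]
    show "R f \<in> L2" "(L2_norm (R f))\<^sup>2 \<le> 1 / (1 - s)\<^sup>2 * (L2_norm f)\<^sup>2" by auto
  qed
  have bR: "L2_bounded_linear R"
  proof (rule L2_bounded_linearI)
    fix f :: "'a \<Rightarrow> complex" assume f: "f \<in> L2"
    show "R f \<in> L2" "(L2_norm (R f))\<^sup>2 \<le> 1 / (1 - s)\<^sup>2 * (L2_norm f)\<^sup>2" using R[OF f] .
    show "AE x in lborel. R (\<lambda>y. a * f y) x = a * R f x" for a
    proof -
      have "AE x in lborel. \<forall>n. (S ^^ n) (\<lambda>y. a * f y) x = a * (S ^^ n) f x"
        unfolding AE_all_countable by (intro allI Sn f)
      then show ?thesis using summ[OF f]
        by eventually_elim (auto simp: R_def suminf_mult summable_norm_cancel)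
    qed
    fix g :: "'a \<Rightarrow> complex" assume g: "g \<in> L2"
    have "AE x in lborel. \<forall>n. (S ^^ n) (\<lambda>y. f y + g y) x = (S ^^ n) f x + (S ^^ n) g x"
      unfolding AE_all_countable by (intro allI Sn f g)
    then show "AE x in lborel. R (\<lambda>y. f y + g y) x = R f x + R g x"
      using summ[OF f] summ[OF g]
      by eventually_elim (auto simp: R_def suminf_add summable_norm_cancel)
  qed
  note R1 = L2_bounded_linearD[OF bR]
  have RS: "AE x in lborel. R f x = f x + R (S f) x" if f: "f \<in> L2" for f
    using summ[OF f]
  proof eventually_elim
    case (elim x)
    have "(\<Sum>n. (S ^^ Suc n) f x) = R f x - (S ^^ 0) f x"
      unfolding R_def by (rule suminf_split_head[OF summable_norm_cancel[OF elim]])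
    moreover have "(S ^^ Suc n) f = (S ^^ n) (S f)" for n
      by (simp only: funpow_Suc_right o_apply)
    ultimately show ?case by (simp add: R_def)
  qed
  \<comment> \<open>The size of the commutator of \<open>S\<close> and \<open>R\<close> at
    \<open>f\<close>. Inserting the index shift \<open>R f = f + R (S f)\<close> shows that it is
    unchanged when \<open>f\<close> is replaced by \<open>S f\<close>; iterating, it is bounded by a
    multiple of the norm of \<open>(S ^^ n) f\<close>, which tends to zero.\<close>
  define H where "H f = L2_norm (\<lambda>x. S (R f) x - R (S f) x)" for f
  have H_step: "H f = H (S f)" if f: "f \<in> L2" for f
    unfolding H_def
  proof (rule L2_norm_cong_AE)
    have "AE x in lborel. S (R f) x = S (\<lambda>y. f y + R (S f) y) x"
      using RS[OF f] by (intro L2_bounded_linear_cong_AE[OF S]) (auto intro: R1 S1 f L2_add)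
    moreover have "AE x in lborel. S (\<lambda>y. f y + R (S f) y) x = S f x + S (R (S f)) x"
      by (intro S1 R1 f)
    ultimately show "AE x in lborel. S (R f) x - R (S f) x = S (R (S f)) x - R (S (S f)) x"
      using RS[OF S1(1)[OF f]] by eventually_elim simp
  qed (intro L2_diff S1 R1 f)+
  have H_pow: "H f = H ((S ^^ n) f)" if f: "f \<in> L2" for f n
  proof (induction n)
    case (Suc n)
    then show ?case using H_step[OF Sn(1)[OF f, of n]] by simp
  qed simp
  obtain C where C: "0 < C" "\<And>f. f \<in> L2 \<Longrightarrow> (L2_norm (S f))\<^sup>2 \<le> C * (L2_norm f)\<^sup>2"
    using L2_bounded_linear_bound_sq[OF S] by metis
  obtain D where D: "0 < D" "\<And>f. f \<in> L2 \<Longrightarrow> (L2_norm (R f))\<^sup>2 \<le> D * (L2_norm f)\<^sup>2"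
    using L2_bounded_linear_bound_sq[OF bR] by metis
  have H_bound: "(H f)\<^sup>2 \<le> 4 * (C * D) * (L2_norm f)\<^sup>2" if f: "f \<in> L2" for f
  proof -
    have "(H f)\<^sup>2 \<le> 2 * (L2_norm (S (R f)))\<^sup>2 + 2 * (L2_norm (\<lambda>x. - 1 * R (S f) x))\<^sup>2"
      using L2_norm_add_sq_le[OF S1(1)[OF R1(1)[OF f]] L2_cmult[OF R1(1)[OF S1(1)[OF f]], of "-1"]]
      by (simp add: H_def)
    also have "\<dots> = 2 * (L2_norm (S (R f)))\<^sup>2 + 2 * (L2_norm (R (S f)))\<^sup>2"
      unfolding L2_norm_cmult by simp
    also have "\<dots> \<le> 2 * (C * (D * (L2_norm f)\<^sup>2)) + 2 * (D * (C * (L2_norm f)\<^sup>2))"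
      using order_trans[OF C(2)[OF R1(1)[OF f]] mult_left_mono[OF D(2)[OF f], of C]]
        order_trans[OF D(2)[OF S1(1)[OF f]] mult_left_mono[OF C(2)[OF f], of D]] C(1) D(1)
      by linarith
    finally show ?thesis by (simp add: algebra_simps)
  qed
  have H0: "H f = 0" if f: "f \<in> L2" for f
  proof -
    have le: "(H f)\<^sup>2 \<le> 4 * (C * D) * (s ^ n * s ^ n * (L2_norm f)\<^sup>2)" for n
    proof -
      have "(H f)\<^sup>2 = (H ((S ^^ n) f))\<^sup>2" using H_pow[OF f, of n] by simp
      also have "\<dots> \<le> 4 * (C * D) * (L2_norm ((S ^^ n) f))\<^sup>2"
        by (rule H_bound[OF Sn(1)[OF f]])
      also have "\<dots> \<le> 4 * (C * D) * (s ^ n * s ^ n * (L2_norm f)\<^sup>2)"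
        using C(1) D(1) by (intro mult_left_mono L2_norm_funpow_le[OF S bd f]) auto
      finally show ?thesis .
    qed
    have "(\<lambda>n. 4 * (C * D) * (s ^ n * s ^ n * (L2_norm f)\<^sup>2)) \<longlonglongrightarrow> 4 * (C * D) * (0 * 0 * (L2_norm f)\<^sup>2)"
      using s by (intro tendsto_intros LIMSEQ_power_zero) auto
    from LIMSEQ_le_const[OF this, of "(H f)\<^sup>2"] le have "(H f)\<^sup>2 \<le> 0" by auto
    then show ?thesis by simp
  qed
  have comm: "AE x in lborel. S (R f) x = R (S f) x" if f: "f \<in> L2" for f
  proof -
    have "(\<lambda>x. S (R f) x - R (S f) x) \<in> L2" by (intro L2_diff S1 R1 f)
    from L2_norm_eq_0_iff[OF this] H0[OF f] show ?thesis by (simp add: H_def)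
  qed
  show thesis
  proof (rule that[OF bR])
    fix f :: "'a \<Rightarrow> complex" assume f: "f \<in> L2"
    have "AE x in lborel. R (\<lambda>y. f y + - 1 * S f y) x = R f x + R (\<lambda>y. - 1 * S f y) x"
      by (intro R1 f L2_cmult S1)
    moreover have "AE x in lborel. R (\<lambda>y. - 1 * S f y) x = - 1 * R (S f) x"
      by (intro R1 S1 f)
    ultimately show "AE x in lborel. R (\<lambda>y. f y - S f y) x = f x"
      using RS[OF f] by eventually_elim simp
    show "AE x in lborel. R f x - S (R f) x = f x"
      using RS[OF f] comm[OF f] by eventually_elim simp
  qed
qed

section \<open>The supremum of the form and the top of the spectrum\<close>

lemma L2_nonzero:
  obtains f :: "'a::euclidean_space \<Rightarrow> complex" where "f \<in> L2" "0 < L2_norm f"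
proof
  let ?f = "indicator (cbox 0 One) :: 'a \<Rightarrow> complex"
  have eq: "(cmod (?f x))\<^sup>2 = indicator (cbox 0 One) x" for x by (auto simp: indicator_def)
  have "integrable lborel (\<lambda>x. (cmod (?f x))\<^sup>2)"
    unfolding eq by (auto simp: emeasure_lborel_cbox_eq)
  then show "?f \<in> L2" by (simp add: L2_def)
  have "measure lborel (cbox 0 One :: 'a set) = 1"
    by (simp add: measure_lborel_cbox_eq)
  then show "0 < L2_norm ?f" unfolding L2_norm_def eq by simp
qed

lemma L2_form_sup:
  fixes T :: "'a::euclidean_space operator"
  assumes T: "L2_bounded_linear T"
  obtains m where "\<And>f. f \<in> L2 \<Longrightarrow> Re (L2_inner f (T f)) \<le> m * (L2_norm f)\<^sup>2"
    and "\<And>\<delta>. 0 < \<delta> \<Longrightarrow> \<exists>f\<in>L2. 0 < L2_norm f \<and> (m - \<delta>) * (L2_norm f)\<^sup>2 < Re (L2_inner f (T f))"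
proof -
  obtain C where Q: "0 < C" "\<And>f. f \<in> L2 \<Longrightarrow> \<bar>Re (L2_inner f (T f))\<bar> \<le> C * (L2_norm f)\<^sup>2"
    using L2_bounded_linear_form[OF T] by metis
  define W where "W = {Re (L2_inner f (T f)) / (L2_norm f)\<^sup>2 |f. f \<in> L2 \<and> 0 < L2_norm f}"
  have bdd: "bdd_above W"
  proof (rule bdd_aboveI)
    fix w assume "w \<in> W"
    then obtain f where f: "f \<in> L2" "0 < L2_norm f" and w: "w = Re (L2_inner f (T f)) / (L2_norm f)\<^sup>2"
      by (auto simp: W_def)
    have "Re (L2_inner f (T f)) \<le> C * (L2_norm f)\<^sup>2"
      using Q(2)[OF f(1)] by linarith
    then show "w \<le> C" using f(2) by (simp add: w divide_le_eq)
  qed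
  obtain f0 :: "'a \<Rightarrow> complex" where f0: "f0 \<in> L2" "0 < L2_norm f0" using L2_nonzero .
  then have ne: "W \<noteq> {}" by (auto simp: W_def)
  show thesis
  proof (rule that[of "Sup W"])
    fix f :: "'a \<Rightarrow> complex" assume f: "f \<in> L2"
    show "Re (L2_inner f (T f)) \<le> Sup W * (L2_norm f)\<^sup>2"
    proof (cases "L2_norm f = 0")
      case True
      then show ?thesis using Q(2)[OF f] by simp
    next
      case False
      then have pos: "0 < L2_norm f" using L2_norm_nonneg[of f] by simp
      then have "Re (L2_inner f (T f)) / (L2_norm f)\<^sup>2 \<le> Sup W"
        using f by (intro cSup_upper bdd) (auto simp: W_def)
      then show ?thesis using pos by (simp add: divide_le_eq)
    qed
  next
    fix \<delta> :: real assume "0 < \<delta>"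
    then obtain w where "w \<in> W" "Sup W - \<delta> < w"
      using less_cSupE[of "Sup W - \<delta>" W] ne by auto
    then obtain f where "f \<in> L2" "0 < L2_norm f" "Sup W - \<delta> < Re (L2_inner f (T f)) / (L2_norm f)\<^sup>2"
      by (auto simp: W_def)
    then show "\<exists>f\<in>L2. 0 < L2_norm f \<and> (Sup W - \<delta>) * (L2_norm f)\<^sup>2 < Re (L2_inner f (T f))"
      by (auto simp: less_divide_eq intro!: bexI[of _ f])
  qed
qed

lemma L2_form_affine:
  assumes T: "L2_bounded_linear T" and f: "f \<in> L2"
  shows "Re (L2_inner f (\<lambda>x. of_real a * f x + of_real b * T f x)) =
    a * (L2_norm f)\<^sup>2 + b * Re (L2_inner f (T f))"
  using f L2_bounded_linearD(1)[OF T f]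
  by (simp add: L2_inner_add_right L2_cmult L2_inner_cmult_right L2_inner_self)

text \<open>For large \<open>l\<close> the operator \<open>S = 1 - (t - T) / l\<close> satisfies
  \<open>0 <= S <= q\<close> in the sense of forms, with \<open>q = 1 - (t - m) / l < 1\<close>. For
  such \<open>S\<close> the form inequality bounds the norm by \<open>q\<close>, and the Neumann
  series inverts \<open>1 - S = (t - T) / l\<close>.\<close>

lemma above_form_in_resolvent_set:
  fixes T :: "'a::euclidean_space operator"
  assumes T: "L2_bounded_linear T" "L2_selfadjoint T"
    and m: "\<And>f. f \<in> L2 \<Longrightarrow> Re (L2_inner f (T f)) \<le> m * (L2_norm f)\<^sup>2" and "m < t"
  shows "complex_of_real t \<in> L2_resolvent_set T"
proof -
  obtain C where C: "0 < C" "\<And>f. f \<in> L2 \<Longrightarrow> \<bar>Re (L2_inner f (T f))\<bar> \<le> C * (L2_norm f)\<^sup>2"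
    using L2_bounded_linear_form[OF T(1)] by metis
  \<comment> \<open>\<open>l\<close> exceeds \<open>t - m\<close>, which makes \<open>q\<close>
    positive, and is at least \<open>t + C\<close>, which makes \<open>S\<close>
    nonnegative.\<close>
  define l where "l = \<bar>t\<bar> + \<bar>m\<bar> + C"
  have l: "0 < l" "t - m < l" "t + C \<le> l" using C(1) by (auto simp: l_def)
  define S where "S f x = of_real (1 - t / l) * f x + of_real (1 / l) * T f x" for f x
  have S: "L2_bounded_linear S" "L2_selfadjoint S"
    unfolding S_def[abs_def] by (intro L2_bounded_linear_affine L2_selfadjoint_affine T)+
  have QS: "Re (L2_inner f (S f)) = (1 - t / l) * (L2_norm f)\<^sup>2 + 1 / l * Re (L2_inner f (T f))"
    if f: "f \<in> L2" for f
    unfolding S_def[abs_def] by (rule L2_form_affine[OF T(1) f])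
  define q where "q = 1 - (t - m) / l"
  have q: "0 < q" "q < 1" using l \<open>m < t\<close> by (auto simp: q_def field_simps)
  have pos: "0 \<le> Re (L2_inner f (S f))" if f: "f \<in> L2" for f
  proof -
    have "- (C * (L2_norm f)\<^sup>2) \<le> Re (L2_inner f (T f))"
      using C(2)[OF f] by linarith
    moreover have "C * (L2_norm f)\<^sup>2 \<le> (l - t) * (L2_norm f)\<^sup>2"
      using l by (intro mult_right_mono) auto
    ultimately have "0 \<le> ((l - t) * (L2_norm f)\<^sup>2 + Re (L2_inner f (T f))) / l"
      using l(1) by (intro divide_nonneg_pos) linarith+
    also have "\<dots> = Re (L2_inner f (S f))"
      unfolding QS[OF f] using l(1) by (simp add: field_simps)
    finally show ?thesis .
  qed
  have le: "Re (L2_inner f (S f)) \<le> q * (L2_norm f)\<^sup>2" if f: "f \<in> L2" for f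
  proof -
    have "1 / l * Re (L2_inner f (T f)) \<le> 1 / l * (m * (L2_norm f)\<^sup>2)"
      using l(1) by (intro mult_left_mono m f) auto
    then show ?thesis unfolding QS[OF f] q_def by (simp add: diff_divide_distrib algebra_simps)
  qed
  have "(L2_norm (S f))\<^sup>2 \<le> q\<^sup>2 * (L2_norm f)\<^sup>2" if f: "f \<in> L2" for f
    using order_trans[OF L2_norm_le_form[OF S q(1) pos le f] mult_left_mono[OF le[OF f], of q]] q(1)
    by (simp add: power2_eq_square mult.assoc)
  then obtain R where R: "L2_bounded_linear R"
    "\<And>f. f \<in> L2 \<Longrightarrow> AE x in lborel. R (\<lambda>y. f y - S f y) x = f x"
    "\<And>f. f \<in> L2 \<Longrightarrow> AE x in lborel. R f x - S (R f) x = f x"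
    using neumann_series[OF S(1) q] by blast
  \<comment> \<open>The sign and the scale come from \<open>T - t = - l (1 - S)\<close>.\<close>
  define b where "b = complex_of_real (- 1 / l)"
  have b: "b \<noteq> 0" using l(1) by (simp add: b_def)
  have Tt: "T f x - of_real t * f x = (f x - S f x) / b" for f x
    using l(1) by (simp add: S_def b_def field_simps)
  have "L2_bounded_linear (\<lambda>f x. 0 * f x + b * R f x)"
    by (rule L2_bounded_linear_affine[OF R(1)])
  then have bR: "L2_bounded_linear (\<lambda>f x. b * R f x)" by simp
  note R1 = L2_bounded_linearD[OF R(1)] and T1 = L2_bounded_linearD[OF T(1)] and S1 = L2_bounded_linearD[OF S(1)]
  show ?thesis
    unfolding L2_resolvent_set_def mem_Collect_eq
  proof (intro exI[of _ "\<lambda>f x. b * R f x"] conjI bR ballI)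
    fix f :: "'a \<Rightarrow> complex" assume f: "f \<in> L2"
    have "AE x in lborel. R (\<lambda>y. (1 / b) * (f y - S f y)) x = (1 / b) * R (\<lambda>y. f y - S f y) x"
      by (intro R1 L2_diff f S1)
    then show "AE x in lborel. b * R (\<lambda>y. T f y - complex_of_real t * f y) x = f x"
      unfolding Tt using R(2)[OF f] by eventually_elim (simp add: b)
    have "AE x in lborel. T (\<lambda>x. b * R f x) x = b * T (R f) x"
      by (intro T1 R1 f)
    then show "AE x in lborel. T (\<lambda>x. b * R f x) x - complex_of_real t * (b * R f x) = f x"
      using R(3)[OF f]
    proof eventually_elim
      case (elim x)
      have "T (\<lambda>x. b * R f x) x - complex_of_real t * (b * R f x) = b * (T (R f) x - of_real t * R f x)"
        by (simp add: elim(1) algebra_simps)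
      also have "\<dots> = f x" unfolding Tt elim(2) using b by simp
      finally show ?case .
    qed
  qed
qed

text \<open>An inverse of \<open>T - m\<close> would bound the norm of \<open>f\<close> by that of
  \<open>S f\<close> for \<open>S = m - T\<close>. Since \<open>S\<close> is nonnegative, the
  squared norm of \<open>S f\<close> is at most \<open>q\<close> times its form at \<open>f\<close>,
  which is arbitrarily small on almost maximising \<open>f\<close>.\<close>

lemma form_sup_in_spectrum:
  fixes T :: "'a::euclidean_space operator"
  assumes T: "L2_bounded_linear T" "L2_selfadjoint T"
    and m: "\<And>f. f \<in> L2 \<Longrightarrow> Re (L2_inner f (T f)) \<le> m * (L2_norm f)\<^sup>2"
    and m': "\<And>\<delta>. 0 < \<delta> \<Longrightarrow> \<exists>f\<in>L2. 0 < L2_norm f \<and> (m - \<delta>) * (L2_norm f)\<^sup>2 < Re (L2_inner f (T f))"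
  shows "complex_of_real m \<in> L2_spectrum T"
proof (rule ccontr)
  assume "complex_of_real m \<notin> L2_spectrum T"
  then obtain R where R: "L2_bounded_linear R"
    "\<And>f. f \<in> L2 \<Longrightarrow> AE x in lborel. R (\<lambda>y. T f y - of_real m * f y) x = f x"
    by (auto simp: L2_spectrum_def L2_resolvent_set_def)
  obtain C where C: "0 < C" "\<And>f. f \<in> L2 \<Longrightarrow> \<bar>Re (L2_inner f (T f))\<bar> \<le> C * (L2_norm f)\<^sup>2"
    using L2_bounded_linear_form[OF T(1)] by metis
  obtain D where D: "0 < D" "\<And>f. f \<in> L2 \<Longrightarrow> (L2_norm (R f))\<^sup>2 \<le> D * (L2_norm f)\<^sup>2"
    using L2_bounded_linear_bound_sq[OF R(1)] by metis
  define S where "S f x = of_real m * f x + of_real (- 1) * T f x" for f x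
  have S: "L2_bounded_linear S" "L2_selfadjoint S"
    unfolding S_def[abs_def] by (intro L2_bounded_linear_affine L2_selfadjoint_affine T)+
  have QS: "Re (L2_inner f (S f)) = m * (L2_norm f)\<^sup>2 - Re (L2_inner f (T f))" if f: "f \<in> L2" for f
    using L2_form_affine[OF T(1) f, of m "-1"] by (simp add: S_def[abs_def])
  define q where "q = \<bar>m\<bar> + C"
  have q: "0 < q" using C(1) by (simp add: q_def)
  have pos: "0 \<le> Re (L2_inner f (S f))" if f: "f \<in> L2" for f
    using m[OF f] by (simp add: QS[OF f])
  have le: "Re (L2_inner f (S f)) \<le> q * (L2_norm f)\<^sup>2" if f: "f \<in> L2" for f
  proof -
    have "- Re (L2_inner f (T f)) \<le> C * (L2_norm f)\<^sup>2" using C(2)[OF f] by linarith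
    moreover have "m * (L2_norm f)\<^sup>2 \<le> \<bar>m\<bar> * (L2_norm f)\<^sup>2" by (intro mult_right_mono) auto
    ultimately show ?thesis unfolding QS[OF f] q_def by (simp add: algebra_simps)
  qed
  \<comment> \<open>Chosen so that the chain of estimates below ends at half of the squared norm of
    \<open>f\<close>.\<close>
  define \<delta> where "\<delta> = 1 / (2 * D * q)"
  have "0 < \<delta>" using D(1) q by (simp add: \<delta>_def)
  from m'[OF this] obtain f where f: "f \<in> L2" "0 < L2_norm f"
    and lt: "(m - \<delta>) * (L2_norm f)\<^sup>2 < Re (L2_inner f (T f))" by blast
  note S1 = L2_bounded_linearD[OF S(1)] and R1 = L2_bounded_linearD[OF R(1)] and T1 = L2_bounded_linearD[OF T(1)]
  have diff: "(\<lambda>y. T f y - of_real m * f y) = (\<lambda>y. - 1 * S f y)"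
    by (auto simp: S_def)
  have "L2_norm (R (\<lambda>y. - 1 * S f y)) = L2_norm f"
    using R(2)[OF f(1)] unfolding diff by (intro L2_norm_cong_AE R1 L2_cmult S1 f)
  then have "(L2_norm f)\<^sup>2 \<le> D * (L2_norm (\<lambda>y. - 1 * S f y))\<^sup>2"
    using D(2)[OF L2_cmult[OF S1(1)[OF f(1)], of "-1"]] by simp
  also have "\<dots> = D * (L2_norm (S f))\<^sup>2"
    unfolding L2_norm_cmult by simp
  also have "\<dots> \<le> D * (q * Re (L2_inner f (S f)))"
    using D(1) by (intro mult_left_mono L2_norm_le_form[OF S q pos le f(1)]) auto
  also have "\<dots> < D * (q * (\<delta> * (L2_norm f)\<^sup>2))"
    using D(1) q lt by (intro mult_strict_left_mono) (auto simp: QS[OF f(1)] algebra_simps)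
  also have "\<dots> = (L2_norm f)\<^sup>2 / 2"
    using D(1) q by (simp add: \<delta>_def)
  finally show False by simp
qed

text \<open>The supremum \<open>m\<close> of the form belongs to the spectrum and everything real
  above it to the resolvent set, so the supremum of the spectrum is a maximum. From here on the
  spectrum is accessed only through these two properties of the form.\<close>

lemma sup_spectrum_form:
  fixes T :: "'a::euclidean_space operator"
  assumes T: "L2_bounded_linear T" "L2_selfadjoint T"
  shows "f \<in> L2 \<Longrightarrow> Re (L2_inner f (T f)) \<le> sup_spectrum T * (L2_norm f)\<^sup>2"
    and "0 < \<delta> \<Longrightarrow> \<exists>f\<in>L2. 0 < L2_norm f \<and> (sup_spectrum T - \<delta>) * (L2_norm f)\<^sup>2 < Re (L2_inner f (T f))"
proof -
  obtain m where m: "\<And>f. f \<in> L2 \<Longrightarrow> Re (L2_inner f (T f)) \<le> m * (L2_norm f)\<^sup>2"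
    and m': "\<And>\<delta>. 0 < \<delta> \<Longrightarrow> \<exists>f\<in>L2. 0 < L2_norm f \<and> (m - \<delta>) * (L2_norm f)\<^sup>2 < Re (L2_inner f (T f))"
    using L2_form_sup[OF T(1)] by metis
  have "sup_spectrum T = m"
    unfolding sup_spectrum_def
  proof (rule cSup_eq_maximum)
    show "m \<in> {t. complex_of_real t \<in> L2_spectrum T}"
      using form_sup_in_spectrum[OF T m m'] by simp
    show "t \<le> m" if "t \<in> {t. complex_of_real t \<in> L2_spectrum T}" for t
    proof (rule ccontr)
      assume "\<not> t \<le> m"
      then have "complex_of_real t \<in> L2_resolvent_set T"
        by (intro above_form_in_resolvent_set[OF T m]) auto
      with that show False by (simp add: L2_spectrum_def)
    qed
  qed
  then show "f \<in> L2 \<Longrightarrow> Re (L2_inner f (T f)) \<le> sup_spectrum T * (L2_norm f)\<^sup>2"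
    and "0 < \<delta> \<Longrightarrow> \<exists>f\<in>L2. 0 < L2_norm f \<and> (sup_spectrum T - \<delta>) * (L2_norm f)\<^sup>2 < Re (L2_inner f (T f))"
    using m m' by auto
qed

section \<open>Integral operators\<close>

text \<open>The hypothesis of Schur's test with one constant for rows and columns. It sees only the
  modulus of \<open>K\<close>, hence is inherited by every kernel with a phase factor; the
  nonnegative integrals make finiteness part of the bound.\<close>

definition schur_bound :: "real \<Rightarrow> ('a::euclidean_space \<Rightarrow> 'a \<Rightarrow> complex) \<Rightarrow> bool" where
  "schur_bound B K \<longleftrightarrow> 0 \<le> B \<and> (\<lambda>(x, y). K x y) \<in> borel_measurable (borel \<Otimes>\<^sub>M borel) \<and>
     (\<forall>x. (\<integral>\<^sup>+ y. ennreal (cmod (K x y)) \<partial>lborel) \<le> ennreal B) \<and>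
     (\<forall>y. (\<integral>\<^sup>+ x. ennreal (cmod (K x y)) \<partial>lborel) \<le> ennreal B)"

lemma measurable_uncurry_comp:
  assumes "(\<lambda>(x, y). K x y) \<in> borel_measurable (borel \<Otimes>\<^sub>M borel)"
    "f \<in> measurable M borel" "g \<in> measurable M borel"
  shows "(\<lambda>x. K (f x) (g x)) \<in> borel_measurable M"
  using measurable_compose[OF measurable_Pair[OF assms(2,3)] assms(1)] by simp

lemma schur_bound_measurable:
  "schur_bound B K \<Longrightarrow> f \<in> measurable M borel \<Longrightarrow> g \<in> measurable M borel \<Longrightarrow>
    (\<lambda>x. K (f x) (g x)) \<in> borel_measurable M"
  unfolding schur_bound_def by (blast intro: measurable_uncurry_comp)

lemma schur_bound_nonneg: "schur_bound B K \<Longrightarrow> 0 \<le> B"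
  by (simp add: schur_bound_def)

lemma schur_boundD:
  assumes "schur_bound B K"
  shows "(\<integral>\<^sup>+ y. ennreal (cmod (K x y)) \<partial>lborel) \<le> ennreal B"
    and "(\<integral>\<^sup>+ x. ennreal (cmod (K x y)) \<partial>lborel) \<le> ennreal B"
  using assms by (auto simp: schur_bound_def)

text \<open>Schur's test in bilinear form: by the inequality of arithmetic and geometric means the
  integrand is at most \<open>(|f x|^2 + |g y|^2) |K x y| / 2\<close>, and the two parts are
  integrated along rows and along columns. Keeping the moduli inside lets the same bound control
  error kernels later.\<close>

lemma schur_nn_integral:
  fixes K :: "'a::euclidean_space kernel"
  assumes K: "schur_bound B K" and f: "f \<in> L2" and g: "g \<in> L2"
  shows "(\<integral>\<^sup>+ (x, y). ennreal (cmod (f x) * cmod (K x y) * cmod (g y)) \<partial>lborel2)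
    \<le> ennreal (B * (((L2_norm f)\<^sup>2 + (L2_norm g)\<^sup>2) / 2))"
proof -
  note [measurable] = f[THEN L2_measurable] g[THEN L2_measurable] schur_bound_measurable[OF K]
  have B: "0 \<le> B" using K by (rule schur_bound_nonneg)
  have amgm: "a * k * b \<le> a\<^sup>2 * k / 2 + b\<^sup>2 * k / 2" if "0 \<le> k" for a b k :: real
  proof -
    have "2 * a * b * k \<le> (a\<^sup>2 + b\<^sup>2) * k"
      by (intro mult_right_mono sum_squares_bound that)
    then show ?thesis by (simp add: field_simps)
  qed
  have "(\<integral>\<^sup>+ (x, y). ennreal (cmod (f x) * cmod (K x y) * cmod (g y)) \<partial>lborel2)
      \<le> (\<integral>\<^sup>+ (x, y). ennreal ((cmod (f x))\<^sup>2 / 2) * ennreal (cmod (K x y)) + ennreal ((cmod (g y))\<^sup>2 / 2) * ennreal (cmod (K x y)) \<partial>lborel2)"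
    by (intro nn_integral_mono) (auto simp: ennreal_mult[symmetric] ennreal_plus[symmetric] simp del: ennreal_plus intro!: ennreal_leI order_trans[OF amgm])
  also have "\<dots> = (\<integral>\<^sup>+ (x, y). ennreal ((cmod (f x))\<^sup>2 / 2) * ennreal (cmod (K x y)) \<partial>lborel2)
      + (\<integral>\<^sup>+ (x, y). ennreal ((cmod (g y))\<^sup>2 / 2) * ennreal (cmod (K x y)) \<partial>lborel2)"
    unfolding case_prod_beta' by (intro nn_integral_add) measurable
  also have "(\<integral>\<^sup>+ (x, y). ennreal ((cmod (f x))\<^sup>2 / 2) * ennreal (cmod (K x y)) \<partial>lborel2)
      = (\<integral>\<^sup>+ x. ennreal ((cmod (f x))\<^sup>2 / 2) * (\<integral>\<^sup>+ y. ennreal (cmod (K x y)) \<partial>lborel) \<partial>lborel)"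
    unfolding case_prod_beta' by (subst lborel.nn_integral_fst[symmetric]) (auto simp: nn_integral_cmult)
  also have "(\<integral>\<^sup>+ (x, y). ennreal ((cmod (g y))\<^sup>2 / 2) * ennreal (cmod (K x y)) \<partial>lborel2)
      = (\<integral>\<^sup>+ y. ennreal ((cmod (g y))\<^sup>2 / 2) * (\<integral>\<^sup>+ x. ennreal (cmod (K x y)) \<partial>lborel) \<partial>lborel)"
    unfolding case_prod_beta' by (subst lborel_pair.nn_integral_snd[symmetric]) (auto simp: nn_integral_cmult)
  also have "(\<integral>\<^sup>+ x. ennreal ((cmod (f x))\<^sup>2 / 2) * (\<integral>\<^sup>+ y. ennreal (cmod (K x y)) \<partial>lborel) \<partial>lborel)
      \<le> (\<integral>\<^sup>+ x. ennreal ((cmod (f x))\<^sup>2) * ennreal (B / 2) \<partial>lborel)"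
    by (intro nn_integral_mono order_trans[OF mult_left_mono[OF schur_boundD(1)[OF K]]])
       (auto simp: ennreal_mult[symmetric] B)
  also have "\<dots> = ennreal ((L2_norm f)\<^sup>2 * (B / 2))"
    using B by (subst nn_integral_multc) (auto simp: nn_integral_L2_norm[OF f] ennreal_mult[symmetric])
  also have "(\<integral>\<^sup>+ y. ennreal ((cmod (g y))\<^sup>2 / 2) * (\<integral>\<^sup>+ x. ennreal (cmod (K x y)) \<partial>lborel) \<partial>lborel)
      \<le> (\<integral>\<^sup>+ y. ennreal ((cmod (g y))\<^sup>2) * ennreal (B / 2) \<partial>lborel)"
    by (intro nn_integral_mono order_trans[OF mult_left_mono[OF schur_boundD(2)[OF K]]])
       (auto simp: ennreal_mult[symmetric] B)
  also have "\<dots> = ennreal ((L2_norm g)\<^sup>2 * (B / 2))"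
    using B by (subst nn_integral_multc) (auto simp: nn_integral_L2_norm[OF g] ennreal_mult[symmetric])
  also have "ennreal ((L2_norm f)\<^sup>2 * (B / 2)) + ennreal ((L2_norm g)\<^sup>2 * (B / 2)) = ennreal (B * (((L2_norm f)\<^sup>2 + (L2_norm g)\<^sup>2) / 2))"
    using B by (simp add: ennreal_plus[symmetric] field_simps del: ennreal_plus)
  finally show ?thesis by (simp add: add_mono)
qed

lemma schur_form:
  fixes K :: "'a::euclidean_space kernel"
  assumes K: "schur_bound B K" and f: "f \<in> L2" and g: "g \<in> L2"
  shows "integrable lborel2 (\<lambda>(x, y). cnj (f x) * K x y * g y)"
    and "cmod (LINT (x, y)|lborel2. cnj (f x) * K x y * g y)
      \<le> B * (((L2_norm f)\<^sup>2 + (L2_norm g)\<^sup>2) / 2)"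
proof -
  note [measurable] = f[THEN L2_measurable] g[THEN L2_measurable] schur_bound_measurable[OF K]
  have B: "0 \<le> B" using K by (rule schur_bound_nonneg)
  have eq: "(\<integral>\<^sup>+ p. ennreal (norm (case p of (x, y) \<Rightarrow> cnj (f x) * K x y * g y)) \<partial>lborel2)
    = (\<integral>\<^sup>+ (x, y). ennreal (cmod (f x) * cmod (K x y) * cmod (g y)) \<partial>lborel2)"
    by (simp add: case_prod_beta' norm_mult)
  show int: "integrable lborel2 (\<lambda>(x, y). cnj (f x) * K x y * g y)"
    using schur_nn_integral[OF K f g] unfolding eq[symmetric]
    by (intro integrableI_bounded) (auto simp: case_prod_beta' order_le_less_trans)
  have "ennreal (cmod (LINT (x, y)|lborel2. cnj (f x) * K x y * g y))
      \<le> ennreal (B * (((L2_norm f)\<^sup>2 + (L2_norm g)\<^sup>2) / 2))"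
    using order_trans[OF integral_norm_bound_ennreal[OF int]] schur_nn_integral[OF K f g]
    unfolding eq by simp
  then show "cmod (LINT (x, y)|lborel2. cnj (f x) * K x y * g y)
      \<le> B * (((L2_norm f)\<^sup>2 + (L2_norm g)\<^sup>2) / 2)"
    using B by (subst (asm) ennreal_le_iff) auto
qed

text \<open>Splitting \<open>|K f|\<close> as \<open>sqrt |K|\<close> times
  \<open>sqrt |K| |f|\<close>, Cauchy--Schwarz bounds the square of the inner integral by the row
  bound times the integral of \<open>|K| |f|^2\<close>, and Fubini brings in the column bound.
  Finiteness also yields the absolute convergence almost everywhere on which additivity of the
  operator rests.\<close>

lemma kernel_part_L2:
  fixes K :: "'a::euclidean_space kernel"
  assumes K: "schur_bound B K" and f: "f \<in> L2"
  shows "AE x in lborel. integrable lborel (\<lambda>y. K x y * f y)"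
    and "(\<lambda>x. LINT y|lborel. K x y * f y) \<in> L2"
    and "(L2_norm (\<lambda>x. LINT y|lborel. K x y * f y))\<^sup>2 \<le> B\<^sup>2 * (L2_norm f)\<^sup>2"
proof -
  note [measurable] = f[THEN L2_measurable] schur_bound_measurable[OF K]
  have B: "0 \<le> B" using K by (rule schur_bound_nonneg)
  define N where "N x = (\<integral>\<^sup>+ y. ennreal (cmod (K x y * f y)) \<partial>lborel)" for x
  have N_meas [measurable]: "N \<in> borel_measurable borel"
    unfolding N_def[abs_def] by measurable
  have N_sq: "(N x)\<^sup>2 \<le> ennreal B * (\<integral>\<^sup>+ y. ennreal (cmod (K x y)) * ennreal ((cmod (f y))\<^sup>2) \<partial>lborel)" for x
  proof -
    have "N x = (\<integral>\<^sup>+ y. ennreal (sqrt (cmod (K x y))) * ennreal (sqrt (cmod (K x y)) * cmod (f y)) \<partial>lborel)"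
      unfolding N_def
      by (intro nn_integral_cong) (simp add: ennreal_mult[symmetric] mult.assoc[symmetric] norm_mult)
    then have "(N x)\<^sup>2 \<le> (\<integral>\<^sup>+ y. (ennreal (sqrt (cmod (K x y))))\<^sup>2 \<partial>lborel) *
        (\<integral>\<^sup>+ y. (ennreal (sqrt (cmod (K x y)) * cmod (f y)))\<^sup>2 \<partial>lborel)"
      by (simp add: Cauchy_Schwarz_nn_integral)
    also have "\<dots> = (\<integral>\<^sup>+ y. ennreal (cmod (K x y)) \<partial>lborel) *
        (\<integral>\<^sup>+ y. ennreal (cmod (K x y)) * ennreal ((cmod (f y))\<^sup>2) \<partial>lborel)"
      by (simp add: ennreal_power power_mult_distrib ennreal_mult)
    also have "\<dots> \<le> ennreal B * (\<integral>\<^sup>+ y. ennreal (cmod (K x y)) * ennreal ((cmod (f y))\<^sup>2) \<partial>lborel)"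
      by (intro mult_right_mono schur_boundD(1)[OF K]) auto
    finally show ?thesis .
  qed
  have "(\<integral>\<^sup>+ x. (N x)\<^sup>2 \<partial>lborel) \<le> (\<integral>\<^sup>+ x. ennreal B * (\<integral>\<^sup>+ y. ennreal (cmod (K x y)) * ennreal ((cmod (f y))\<^sup>2) \<partial>lborel) \<partial>lborel)"
    by (intro nn_integral_mono N_sq)
  also have "\<dots> = ennreal B * (\<integral>\<^sup>+ x. \<integral>\<^sup>+ y. ennreal (cmod (K x y)) * ennreal ((cmod (f y))\<^sup>2) \<partial>lborel \<partial>lborel)"
    by (intro nn_integral_cmult) measurable
  also have "(\<integral>\<^sup>+ x. \<integral>\<^sup>+ y. ennreal (cmod (K x y)) * ennreal ((cmod (f y))\<^sup>2) \<partial>lborel \<partial>lborel)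
      = (\<integral>\<^sup>+ y. \<integral>\<^sup>+ x. ennreal (cmod (K x y)) * ennreal ((cmod (f y))\<^sup>2) \<partial>lborel \<partial>lborel)"
    by (rule lborel_pair.Fubini'[symmetric]) measurable
  also have "\<dots> = (\<integral>\<^sup>+ y. (\<integral>\<^sup>+ x. ennreal (cmod (K x y)) \<partial>lborel) * ennreal ((cmod (f y))\<^sup>2) \<partial>lborel)"
    by (intro nn_integral_cong nn_integral_multc) measurable
  also have "\<dots> \<le> (\<integral>\<^sup>+ y. ennreal B * ennreal ((cmod (f y))\<^sup>2) \<partial>lborel)"
    by (intro nn_integral_mono mult_right_mono schur_boundD(2)[OF K]) auto
  also have "\<dots> = ennreal B * ennreal ((L2_norm f)\<^sup>2)"
    by (simp add: nn_integral_cmult nn_integral_L2_norm[OF f])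
  finally have N_int: "(\<integral>\<^sup>+ x. (N x)\<^sup>2 \<partial>lborel) \<le> ennreal (B\<^sup>2 * (L2_norm f)\<^sup>2)"
    using B by (simp add: mult_left_mono ennreal_mult[symmetric] power2_eq_square mult.assoc)
  have "AE x in lborel. (N x)\<^sup>2 \<noteq> \<infinity>"
    by (rule nn_integral_PInf_AE, measurable) (use N_int in \<open>auto simp: top_unique\<close>)
  then show AE_int: "AE x in lborel. integrable lborel (\<lambda>y. K x y * f y)"
  proof eventually_elim
    case (elim x)
    then have "N x \<noteq> top" by (auto simp: power2_eq_square)
    then show ?case
      by (intro integrableI_bounded) (auto simp: N_def less_top[symmetric])
  qed
  have meas: "(\<lambda>x. LINT y|lborel. K x y * f y) \<in> borel_measurable borel"
    by measurable
  have "(\<integral>\<^sup>+ x. ennreal ((cmod (LINT y|lborel. K x y * f y))\<^sup>2) \<partial>lborel) \<le> (\<integral>\<^sup>+ x. (N x)\<^sup>2 \<partial>lborel)"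
  proof (intro nn_integral_mono_AE)
    show "AE x in lborel. ennreal ((cmod (LINT y|lborel. K x y * f y))\<^sup>2) \<le> (N x)\<^sup>2"
      using AE_int
    proof eventually_elim
      case (elim x)
      then have "ennreal (cmod (LINT y|lborel. K x y * f y)) \<le> N x"
        unfolding N_def by (rule integral_norm_bound_ennreal)
      then show ?case by (metis ennreal_power norm_ge_zero power_mono zero_le)
    qed
  qed
  with N_int have "(\<integral>\<^sup>+ x. ennreal ((cmod (LINT y|lborel. K x y * f y))\<^sup>2) \<partial>lborel) \<le> ennreal (B\<^sup>2 * (L2_norm f)\<^sup>2)"
    by (rule order_trans[rotated])
  from L2I_nn_integral[OF meas _ this]
  show "(\<lambda>x. LINT y|lborel. K x y * f y) \<in> L2"
    and "(L2_norm (\<lambda>x. LINT y|lborel. K x y * f y))\<^sup>2 \<le> B\<^sup>2 * (L2_norm f)\<^sup>2" by auto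
qed

lemma L2_bounded_linear_kernel_op:
  fixes K :: "'a::euclidean_space kernel"
  assumes K: "schur_bound B K"
  shows "L2_bounded_linear (kernel_op c K)"
proof -
  have "L2_bounded_linear (\<lambda>f x. LINT y|lborel. K x y * f y)"
  proof (rule L2_bounded_linearI)
    fix f :: "'a \<Rightarrow> complex" assume f: "f \<in> L2"
    note int = kernel_part_L2(1)[OF K f]
    show "(\<lambda>x. LINT y|lborel. K x y * f y) \<in> L2"
      "(L2_norm (\<lambda>x. LINT y|lborel. K x y * f y))\<^sup>2 \<le> B\<^sup>2 * (L2_norm f)\<^sup>2"
      using kernel_part_L2[OF K f] by auto
    have "(LINT y|lborel. K x y * (a * f y)) = a * (LINT y|lborel. K x y * f y)" for a x
      by (simp add: mult.left_commute flip: integral_mult_right_zero)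
    then show "AE x in lborel. (LINT y|lborel. K x y * (a * f y)) = a * (LINT y|lborel. K x y * f y)" for a
      by simp
    fix g :: "'a \<Rightarrow> complex" assume g: "g \<in> L2"
    show "AE x in lborel. (LINT y|lborel. K x y * (f y + g y)) =
        (LINT y|lborel. K x y * f y) + (LINT y|lborel. K x y * g y)"
      using int kernel_part_L2(1)[OF K g] by eventually_elim (simp add: distrib_left)
  qed
  from L2_bounded_linear_affine[OF this, of c 1] show ?thesis
    by (simp add: kernel_op_def[abs_def])
qed

lemma L2_inner_kernel_op:
  fixes K :: "'a::euclidean_space kernel"
  assumes K: "schur_bound B K" and f: "f \<in> L2" and g: "g \<in> L2"
  shows "L2_inner f (kernel_op c K g) =
    c * L2_inner f g + (LINT (x, y)|lborel2. cnj (f x) * K x y * g y)"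
proof -
  have "L2_inner f (kernel_op c K g) = c * L2_inner f g + L2_inner f (\<lambda>x. LINT y|lborel. K x y * g y)"
    unfolding kernel_op_def using f g
    by (simp add: L2_inner_add_right L2_cmult kernel_part_L2(2)[OF K] L2_inner_cmult_right)
  also have "L2_inner f (\<lambda>x. LINT y|lborel. K x y * g y) = (LINT x|lborel. LINT y|lborel. cnj (f x) * K x y * g y)"
    unfolding L2_inner_def by (simp add: mult.assoc)
  also have "\<dots> = (LINT (x, y)|lborel2. cnj (f x) * K x y * g y)"
    by (rule lborel_pair.integral_fst[OF schur_form(1)[OF K f g]])
  finally show ?thesis .
qed

section \<open>Phase factors on Hermitian kernels\<close>

lemma schur_bound_cis:
  assumes K: "schur_bound B K" and p: "(\<lambda>(x, y). p x y) \<in> borel_measurable (borel \<Otimes>\<^sub>M borel)"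
  shows "schur_bound B (\<lambda>x y. cis (p x y) * K x y)"
proof -
  note [measurable] = schur_bound_measurable[OF K] measurable_uncurry_comp[OF p]
  have "(\<lambda>z. cis (p (fst z) (snd z)) * K (fst z) (snd z)) \<in> borel_measurable (borel \<Otimes>\<^sub>M borel)"
    unfolding cis_conv_exp by measurable
  then show ?thesis
    using K by (auto simp: schur_bound_def norm_mult case_prod_beta')
qed

lemma schur_bound_adjoint:
  assumes K: "schur_bound B K"
  shows "schur_bound B (\<lambda>x y. cnj (K y x))"
proof -
  note [measurable] = schur_bound_measurable[OF K]
  have "(\<lambda>z. cnj (K (snd z) (fst z))) \<in> borel_measurable (borel \<Otimes>\<^sub>M borel)"
    by measurable
  then show ?thesis
    using K by (auto simp: schur_bound_def case_prod_beta')
qed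

lemma schur_form_swap:
  assumes K: "schur_bound B K" and f: "f \<in> L2" and g: "g \<in> L2"
  shows "cnj (LINT (x, y)|lborel2. cnj (g x) * K x y * f y) =
    (LINT (x, y)|lborel2. cnj (f x) * cnj (K y x) * g y)"
proof -
  note [measurable] = f[THEN L2_measurable] g[THEN L2_measurable] schur_bound_measurable[OF K]
  let ?h = "\<lambda>(x, y). cnj (f x) * cnj (K y x) * g y"
  have "cnj (LINT (x, y)|lborel2. cnj (g x) * K x y * f y) =
      (LINT p|lborel2. cnj (case p of (x, y) \<Rightarrow> cnj (g x) * K x y * f y))"
    by (rule Bochner_Integration.integral_cnj[symmetric])
  also have "\<dots> = (LINT (x, y)|lborel2. ?h (y, x))"
    by (intro Bochner_Integration.integral_cong) (auto simp: mult_ac)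
  also have "\<dots> = integral\<^sup>L lborel2 ?h"
    by (rule lborel_pair.integral_product_swap) (simp add: case_prod_beta')
  finally show ?thesis .
qed

text \<open>Symmetry of the sum of \<open>c\<close> times the identity and the integral operator
  does not survive a phase on the kernel alone unless both summands are symmetric. The separation
  works because the identity lives on the diagonal, which an integral kernel does not see.\<close>

lemma selfadjoint_kernel_hermitian:
  fixes K :: "'a::euclidean_space kernel"
  assumes K: "schur_bound B K" and sa: "L2_selfadjoint (kernel_op c K)"
  shows "cnj c = c" and "AE p in lborel2. K (fst p) (snd p) = cnj (K (snd p) (fst p))"
proof -
  define k where "k = cnj c - c"
  define D where "D p = K (fst p) (snd p) - cnj (K (snd p) (fst p))" for p
  note Ka = schur_bound_adjoint[OF K]
  note [measurable] = schur_bound_measurable[OF K]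
  have D_meas [measurable]: "D \<in> borel_measurable (borel \<Otimes>\<^sub>M borel)"
    unfolding D_def[abs_def] by measurable
  have form: "integrable lborel2 (\<lambda>(x, y). cnj (f x) * D (x, y) * g y)"
    "(LINT (x, y)|lborel2. cnj (f x) * D (x, y) * g y) = k * L2_inner f g"
    if f: "f \<in> L2" and g: "g \<in> L2" for f g
  proof -
    note i1 = schur_form(1)[OF K f g] and i2 = schur_form(1)[OF Ka f g]
    have eq: "(\<lambda>(x, y). cnj (f x) * D (x, y) * g y) =
        (\<lambda>p. (case p of (x, y) \<Rightarrow> cnj (f x) * K x y * g y) - (case p of (x, y) \<Rightarrow> cnj (f x) * cnj (K y x) * g y))"
      by (auto simp: D_def algebra_simps fun_eq_iff)
    show "integrable lborel2 (\<lambda>(x, y). cnj (f x) * D (x, y) * g y)"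
      unfolding eq by (intro Bochner_Integration.integrable_diff i1 i2)
    have "L2_inner (kernel_op c K f) g = cnj (L2_inner g (kernel_op c K f))"
      by (rule L2_inner_commute)
    also have "\<dots> = cnj c * L2_inner f g + (LINT (x, y)|lborel2. cnj (f x) * cnj (K y x) * g y)"
      unfolding L2_inner_kernel_op[OF K g f] complex_cnj_add complex_cnj_mult schur_form_swap[OF K f g]
      by (simp add: L2_inner_commute[of f g])
    finally have "cnj c * L2_inner f g + (LINT (x, y)|lborel2. cnj (f x) * cnj (K y x) * g y)
        = c * L2_inner f g + (LINT (x, y)|lborel2. cnj (f x) * K x y * g y)"
      using sa f g by (simp add: L2_selfadjoint_def L2_inner_kernel_op[OF K f g])
    then show "(LINT (x, y)|lborel2. cnj (f x) * D (x, y) * g y) = k * L2_inner f g"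
      unfolding eq Bochner_Integration.integral_diff[OF i1 i2] by (simp add: k_def algebra_simps)
  qed
  text \<open>The complex measures \<open>D dx dy\<close> and \<open>k dx\<close> on the diagonal agree on rectangles, hence on
    all Borel sets; but the diagonal is a null set for the first one.\<close>
  have box: "k * measure lborel Q = 0 \<and> (AE p in lborel2. indicator (Q \<times> Q) p *\<^sub>R D p = 0)"
    if Q: "Q \<in> sets borel" "emeasure lborel Q < \<infinity>" for Q
  proof -
    \<comment> \<open>\<open>D\<close> need not be integrable over the whole product; its
      restriction to a square of finite measure is.\<close>
    define F where "F p = indicator (Q \<times> Q) p *\<^sub>R D p" for p
    define d where "d x = (x, x)" for x :: 'a
    have ind: "indicator (A \<inter> Q) \<in> L2" if "A \<in> sets borel" for A :: "'a set"
    proof -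
      have eq: "(cmod (indicator (A \<inter> Q) x))\<^sup>2 = indicator (A \<inter> Q) x" for x
        by (auto simp: indicator_def)
      have "emeasure lborel (A \<inter> Q) < \<infinity>"
        using Q by (intro order_le_less_trans[OF emeasure_mono[of "A \<inter> Q" Q]]) auto
      then have "integrable lborel (\<lambda>x. (cmod (indicator (A \<inter> Q) x))\<^sup>2)"
        unfolding eq using that Q by auto
      then show ?thesis using that Q by (simp add: L2_def)
    qed
    have rect: "(LINT p:X \<times> Y|lborel2. F p) = k * measure lborel (X \<inter> Y \<inter> Q)"
      if X: "X \<in> sets borel" and Y: "Y \<in> sets borel" for X Y
    proof -
      have "(LINT p:X \<times> Y|lborel2. F p) =
        (LINT (x, y)|lborel2. cnj (indicator (X \<inter> Q) x) * D (x, y) * indicator (Y \<inter> Q) y)"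
        unfolding set_lebesgue_integral_def
        by (intro Bochner_Integration.integral_cong) (auto simp: F_def indicator_def)
      also have "\<dots> = k * L2_inner (indicator (X \<inter> Q)) (indicator (Y \<inter> Q))"
        by (intro form ind X Y)
      also have "L2_inner (indicator (X \<inter> Q)) (indicator (Y \<inter> Q)) = (LINT x|lborel. complex_of_real (indicator (X \<inter> Y \<inter> Q) x))"
        unfolding L2_inner_def by (intro Bochner_Integration.integral_cong) (auto simp: indicator_def)
      also have "\<dots> = measure lborel (X \<inter> Y \<inter> Q)"
        using X Y Q by (simp add: integral_complex_of_real)
      finally show ?thesis .
    qed
    have F_int: "integrable lborel2 F"
    proof -
      have "F = (\<lambda>(x, y). cnj (indicator (UNIV \<inter> Q) x) * D (x, y) * indicator (UNIV \<inter> Q) y)"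
        by (auto simp: F_def indicator_def)
      then show ?thesis using form(1)[OF ind ind, of UNIV UNIV] by simp
    qed
    have Q_int: "integrable lborel (\<lambda>x. k * indicator Q x)"
    proof -
      have "(\<lambda>x. k * indicator Q x) = (\<lambda>x. k * complex_of_real (indicator Q x))"
        by (auto simp: indicator_def)
      then show ?thesis using Q by simp
    qed
    have d_meas: "d \<in> lborel \<rightarrow>\<^sub>M lborel2"
      unfolding d_def by measurable
    have dsets: "d -` S \<in> sets lborel" if "S \<in> sets lborel2" for S
      using measurable_sets[OF d_meas that] by simp
    have F_set: "set_integrable lborel2 S F" if "S \<in> sets lborel2" for S
      unfolding set_integrable_def by (intro integrable_mult_indicator that F_int)
    have Q_set: "set_integrable lborel S (\<lambda>x. k * indicator Q x)" if "S \<in> sets lborel" for S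
      unfolding set_integrable_def by (intro integrable_mult_indicator that Q_int)
    \<comment> \<open>Both sides are countably additive and complex valued, so equality on
      rectangles is extended by a Dynkin argument over complements and disjoint unions.\<close>
    have all: "(LINT p:S|lborel2. F p) = (LINT x:d -` S|lborel. k * indicator Q x)"
      if "S \<in> sets lborel2" for S
    proof -
      have "S \<in> sigma_sets (space lborel \<times> space lborel) {a \<times> b |a b. a \<in> sets lborel \<and> b \<in> sets (lborel :: 'a measure)}"
        using that unfolding sets_pair_measure .
      then show ?thesis
      proof (induction S rule: sigma_sets_induct_disjoint[OF Int_stable_pair_measure_generator pair_measure_closed, consumes 1, case_names basic empty compl union])
        case (basic S)
        then obtain X Y where S: "S = X \<times> Y" "X \<in> sets borel" "Y \<in> sets borel" by auto
        have "(LINT x:d -` S|lborel. k * indicator Q x) = (LINT x|lborel. k * complex_of_real (indicator (X \<inter> Y \<inter> Q) x))"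
          unfolding set_lebesgue_integral_def
          by (intro Bochner_Integration.integral_cong) (auto simp: S d_def indicator_def)
        also have "\<dots> = k * measure lborel (X \<inter> Y \<inter> Q)"
          using S Q by (simp add: integral_complex_of_real)
        finally show ?case by (simp only: S(1) rect[OF S(2,3)])
      next
        case empty
        then show ?case by (simp add: set_lebesgue_integral_def)
      next
        case (compl S)
        have S: "S \<in> sets lborel2"
          using compl(1) unfolding sets_pair_measure .
        have F_split: "(LINT p:(UNIV - S)|lborel2. F p) = (LINT p:UNIV|lborel2. F p) - (LINT p:S|lborel2. F p)"
        proof -
          have "(LINT p:(UNIV - S) \<union> S|lborel2. F p) = (LINT p:(UNIV - S)|lborel2. F p) + (LINT p:S|lborel2. F p)"
            using S sets.compl_sets[OF S] by (intro set_integral_Un F_set) (auto simp: space_pair_measure)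
          then show ?thesis by (simp add: algebra_simps)
        qed
        have Q_split: "(LINT x:d -` (UNIV - S)|lborel. k * indicator Q x) = (LINT x:UNIV|lborel. k * indicator Q x) - (LINT x:d -` S|lborel. k * indicator Q x)"
        proof -
          have "(LINT x:d -` (UNIV - S) \<union> d -` S|lborel. k * indicator Q x) = (LINT x:d -` (UNIV - S)|lborel. k * indicator Q x) + (LINT x:d -` S|lborel. k * indicator Q x)"
            using S sets.compl_sets[OF S] by (intro set_integral_Un Q_set dsets) (auto simp: space_pair_measure)
          moreover have "d -` (UNIV - S) \<union> d -` S = UNIV" by auto
          ultimately show ?thesis by (simp add: algebra_simps)
        qed
        have "(LINT p:UNIV|lborel2. F p) = (LINT x:UNIV|lborel. k * indicator Q x)"
        proof -
          have "(LINT p:UNIV|lborel2. F p) = k * measure lborel Q"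
            using rect[of UNIV UNIV] by simp
          also have "\<dots> = (LINT x|lborel. k * complex_of_real (indicator Q x))"
            using Q by (simp add: integral_complex_of_real)
          also have "\<dots> = (LINT x:UNIV|lborel. k * indicator Q x)"
            unfolding set_lebesgue_integral_def
            by (intro Bochner_Integration.integral_cong) (auto simp: indicator_def)
          finally show ?thesis .
        qed
        then show ?case using F_split Q_split compl(2) by simp
      next
        case (union A)
        have A: "A i \<in> sets lborel2" for i
          using union(2) unfolding sets_pair_measure by auto
        have disj: "i \<noteq> j \<Longrightarrow> A i \<inter> A j = {}" for i j
          using union(1) by (auto simp: disjoint_family_on_def)
        then have disj': "i \<noteq> j \<Longrightarrow> d -` A i \<inter> d -` A j = {}" for i j
          by blast
        have "(LINT p:(\<Union>i. A i)|lborel2. F p) = (\<Sum>i. (LINT p:A i|lborel2. F p))"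
          by (intro lebesgue_integral_countable_add A disj F_set sets.countable_UN) (use A in auto)
        also have "\<dots> = (\<Sum>i. (LINT x:d -` A i|lborel. k * indicator Q x))"
          using union(3) by simp
        also have "\<dots> = (LINT x:(\<Union>i. d -` A i)|lborel. k * indicator Q x)"
          by (intro lebesgue_integral_countable_add[symmetric] dsets A Q_set sets.countable_UN disj')
             (use dsets[OF A] in auto)
        also have "(\<Union>i. d -` A i) = d -` (\<Union>i. A i)" by auto
        finally show ?case .
      qed
    qed
    define \<Delta> where "\<Delta> = {p :: 'a \<times> 'a. fst p = snd p}"
    have \<Delta>: "\<Delta> \<in> sets lborel2"
    proof -
      have "{p \<in> space lborel2. fst p = (snd p :: 'a)} \<in> sets lborel2"
        by measurable
      then show ?thesis by (simp add: \<Delta>_def space_pair_measure)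
    qed
    have "AE p in lborel2. (p :: 'a \<times> 'a) \<notin> \<Delta>"
    proof (rule lborel_pair.AE_pair_measure)
      show "{p \<in> space lborel2. p \<notin> \<Delta>} \<in> sets lborel2"
        using sets.compl_sets[OF \<Delta>] by (simp add: set_diff_eq)
      show "AE x in lborel. AE y in lborel. ((x :: 'a), (y :: 'a)) \<notin> \<Delta>"
        using AE_lborel_singleton by (auto simp: \<Delta>_def eq_commute)
    qed
    then have "(LINT p:\<Delta>|lborel2. F p) = (LINT p|(lborel2 :: ('a \<times> 'a) measure). (0::complex))"
      unfolding set_lebesgue_integral_def
    proof (intro integral_cong_AE)
      show "(\<lambda>p. indicat_real \<Delta> p *\<^sub>R F p) \<in> borel_measurable lborel2"
        by (rule borel_measurable_integrable[OF integrable_mult_indicator[OF \<Delta> F_int]])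
    qed (auto simp: indicator_def)
    then have "0 = (LINT x:d -` \<Delta>|lborel. k * indicator Q x)"
      using all[OF \<Delta>] by simp
    also have "\<dots> = (LINT x|lborel. k * complex_of_real (indicator Q x))"
      unfolding set_lebesgue_integral_def
      by (intro Bochner_Integration.integral_cong) (auto simp: indicator_def d_def \<Delta>_def)
    also have "\<dots> = k * measure lborel Q"
      using Q by (simp add: integral_complex_of_real)
    finally have kQ: "k * measure lborel Q = 0" by simp
    \<comment> \<open>\<open>kQ\<close> leaves two cases, \<open>k = 0\<close> or \<open>Q\<close> a
      null set. In both the measure on the diagonal vanishes, so the density \<open>F\<close> has
      integral zero over every measurable set.\<close>
    have "(LINT p:S|lborel2. F p) = 0" if S: "S \<in> sets lborel2" for S
    proof -
      have "(LINT x:d -` S|lborel. k * indicator Q x) = 0"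
      proof (cases "k = 0")
        case True
        then show ?thesis by simp
      next
        case False
        then have "emeasure lborel Q = 0"
          using kQ Q(2) by (simp add: emeasure_eq_ennreal_measure)
        then have "AE x in lborel. x \<notin> Q"
          using Q(1) by (intro AE_not_in) (auto simp: null_sets_def)
        then have "(LINT x:d -` S|lborel. k * indicator Q x) = (LINT x|(lborel :: 'a measure). (0::complex))"
          unfolding set_lebesgue_integral_def
        proof (intro integral_cong_AE)
          show "(\<lambda>x. indicat_real (d -` S) x *\<^sub>R (k * indicator Q x)) \<in> borel_measurable lborel"
            by (rule borel_measurable_integrable[OF integrable_mult_indicator[OF dsets[OF S] Q_int]])
        qed (auto simp: indicator_def)
        then show ?thesis by simp
      qed
      then show ?thesis using all[OF S] by simp
    qed
    then have "AE p in lborel2. F p = 0"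
      by (intro sigma_finite_measure.density_zero[OF _ F_int] lborel_pair.sigma_finite_measure_axioms)
    with kQ show ?thesis by (simp add: F_def)
  qed
  have "k * measure lborel (cbox 0 One :: 'a set) = 0"
    using box[of "cbox 0 One"] by (auto simp: emeasure_lborel_cbox_eq)
  moreover have "measure lborel (cbox 0 One :: 'a set) = 1"
    by (simp add: measure_lborel_cbox_eq)
  ultimately show "cnj c = c" by (simp add: k_def)
  \<comment> \<open>Countably many balls exhaust the space, so the exceptional null sets can be
    united.\<close>
  have "AE p in lborel2. \<forall>n. indicator (ball 0 (real n) \<times> ball 0 (real n)) p *\<^sub>R D p = 0"
    unfolding AE_all_countable
  proof
    fix n show "AE p in lborel2. indicator (ball 0 (real n) \<times> ball 0 (real n)) p *\<^sub>R D p = 0"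
      using box[of "ball 0 (real n)"] emeasure_lborel_ball_finite[of "0::'a" "real n"] by simp
  qed
  then show "AE p in lborel2. K (fst p) (snd p) = cnj (K (snd p) (fst p))"
  proof eventually_elim
    case (elim p)
    obtain n :: nat where "max (norm (fst p)) (norm (snd p)) < real n"
      using reals_Archimedean2 by blast
    then have "p \<in> ball 0 (real n) \<times> ball 0 (real n)" by (cases p) auto
    then have "D p = 0" using elim[rule_format, of n] by (simp add: indicator_def)
    then show ?case by (simp add: D_def)
  qed
qed

text \<open>Antisymmetry of \<open>p\<close> makes \<open>cis (p x y)\<close> a Hermitian kernel,
  and a product of Hermitian kernels is Hermitian; \<open>c\<close> is real.\<close>

lemma selfadjoint_cis:
  fixes K :: "'a::euclidean_space kernel"
  assumes K: "schur_bound B K" and sa: "L2_selfadjoint (kernel_op c K)"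
    and p: "(\<lambda>(x, y). p x y) \<in> borel_measurable (borel \<Otimes>\<^sub>M borel)"
    and anti: "\<And>x y. p y x = - p x y"
  shows "L2_selfadjoint (kernel_op c (\<lambda>x y. cis (p x y) * K x y))"
  unfolding L2_selfadjoint_def
proof (intro ballI)
  fix f g :: "'a \<Rightarrow> complex" assume f: "f \<in> L2" and g: "g \<in> L2"
  let ?K = "\<lambda>x y. cis (p x y) * K x y"
  have K': "schur_bound B ?K" by (rule schur_bound_cis[OF K p])
  note herm = selfadjoint_kernel_hermitian[OF K sa]
  have "L2_inner (kernel_op c ?K f) g = cnj (L2_inner g (kernel_op c ?K f))"
    by (rule L2_inner_commute)
  also have "\<dots> = c * L2_inner f g + (LINT (x, y)|lborel2. cnj (f x) * cnj (?K y x) * g y)"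
    unfolding L2_inner_kernel_op[OF K' g f] complex_cnj_add complex_cnj_mult[of c] schur_form_swap[OF K' f g]
    by (simp add: L2_inner_commute[of f g] herm(1))
  also have "(LINT (x, y)|lborel2. cnj (f x) * cnj (?K y x) * g y) =
      (LINT (x, y)|lborel2. cnj (f x) * ?K x y * g y)"
  proof (rule integral_cong_AE)
    show "(\<lambda>(x, y). cnj (f x) * cnj (?K y x) * g y) \<in> borel_measurable lborel2"
      using schur_form(1)[OF schur_bound_adjoint[OF K'] f g] by (rule borel_measurable_integrable)
    show "(\<lambda>(x, y). cnj (f x) * ?K x y * g y) \<in> borel_measurable lborel2"
      using schur_form(1)[OF K' f g] by (rule borel_measurable_integrable)
    show "AE q in lborel2. (case q of (x, y) \<Rightarrow> cnj (f x) * cnj (?K y x) * g y) =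
        (case q of (x, y) \<Rightarrow> cnj (f x) * ?K x y * g y)"
      using herm(2)
    proof eventually_elim
      case (elim q)
      obtain x y where q: "q = (x, y)" by (cases q)
      from elim show ?case by (simp add: q anti[of x y] cis_cnj)
    qed
  qed
  also have "c * L2_inner f g + \<dots> = L2_inner f (kernel_op c ?K g)"
    by (rule L2_inner_kernel_op[OF K' f g, symmetric])
  finally show "L2_inner (kernel_op c ?K f) g = L2_inner f (kernel_op c ?K g)" .
qed

section \<open>Averaged trial functions\<close>

text \<open>The factor two in the exponent is what a product of two localising factors
  \<open>exp (- |.|^2)\<close> leaves around the midpoint of their centres. The function is not
  normalised; its mass is divided out at the end.\<close>

definition gauss :: "'a::euclidean_space \<Rightarrow> real" where
  "gauss u = exp (- 2 * (norm u)\<^sup>2)"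

lemma gauss_pos: "0 < gauss u"
  by (simp add: gauss_def)

lemma gauss_measurable [measurable]: "gauss \<in> borel_measurable borel"
  unfolding gauss_def[abs_def] by measurable

text \<open>The integral factorises over the coordinates into normal densities of variance
  \<open>1 / (2 a)\<close>.\<close>

lemma integrable_exp_norm:
  assumes "0 < a"
  shows "integrable lborel (\<lambda>u::'a::euclidean_space. exp (- a * (norm u)\<^sup>2))"
proof -
  have one: "integrable lborel (\<lambda>x::real. exp (- a * x\<^sup>2))"
  proof -
    define \<sigma> where "\<sigma> = sqrt (1 / (2 * a))"
    have \<sigma>: "0 < \<sigma>" "\<sigma>\<^sup>2 = 1 / (2 * a)" using assms by (auto simp: \<sigma>_def)
    have "integrable lborel (\<lambda>x. sqrt (2 * pi * \<sigma>\<^sup>2) * normal_density 0 \<sigma> x)"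
      using \<sigma>(1) by (intro integrable_mult_right integrable_normal_density)
    moreover have "sqrt (2 * pi * \<sigma>\<^sup>2) * normal_density 0 \<sigma> x = exp (- a * x\<^sup>2)" for x
    proof -
      have "sqrt (2 * pi * \<sigma>\<^sup>2) \<noteq> 0" using \<sigma> by auto
      moreover have "- (x - 0)\<^sup>2 / (2 * \<sigma>\<^sup>2) = - a * x\<^sup>2" using assms by (simp add: \<sigma>(2))
      ultimately show ?thesis unfolding normal_density_def by simp
    qed
    ultimately show ?thesis by simp
  qed
  have fin: "(\<integral>\<^sup>+ x. ennreal (exp (- a * x\<^sup>2)) \<partial>(lborel :: real measure)) < \<infinity>"
    using one by (simp add: integrable_iff_bounded)
  have "exp (- a * (norm u)\<^sup>2) = (\<Prod>b\<in>Basis. exp (- a * (u \<bullet> b)\<^sup>2))" for u :: 'a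
  proof -
    have "- a * (norm u)\<^sup>2 = (\<Sum>b\<in>Basis. - a * (u \<bullet> b)\<^sup>2)"
      unfolding power2_norm_eq_inner by (subst euclidean_inner) (simp add: power2_eq_square sum_distrib_left)
    then show ?thesis by (simp only: exp_sum finite_Basis)
  qed
  then have "(\<integral>\<^sup>+ u. ennreal (exp (- a * (norm u)\<^sup>2)) \<partial>(lborel :: 'a measure)) =
      (\<integral>\<^sup>+ u. (\<Prod>b\<in>Basis. ennreal (exp (- a * (u \<bullet> b)\<^sup>2))) \<partial>(lborel :: 'a measure))"
    by (simp add: prod_ennreal)
  also have "\<dots> = (\<Prod>b\<in>(Basis::'a set). (\<integral>\<^sup>+ x. ennreal (exp (- a * x\<^sup>2)) \<partial>(lborel :: real measure)))"
    by (rule nn_integral_lborel_prod) auto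
  also have "\<dots> < \<infinity>"
    using fin by (simp add: power_less_top_ennreal)
  finally show ?thesis by (intro integrableI_bounded) auto
qed

lemma integrable_gauss: "integrable lborel (gauss :: 'a::euclidean_space \<Rightarrow> real)"
  unfolding gauss_def[abs_def] by (rule integrable_exp_norm) simp

text \<open>Half of the exponent absorbs the polynomial, by \<open>1 + t <= exp t\<close>.\<close>

lemma integrable_gauss_moment:
  "integrable lborel (\<lambda>v::'a::euclidean_space. gauss v * (1 + (norm v)\<^sup>2))"
proof (rule Bochner_Integration.integrable_bound)
  show "integrable lborel (\<lambda>v::'a. exp (- 1 * (norm v)\<^sup>2))"
    by (rule integrable_exp_norm) simp
  have "exp (- 2 * t) * (1 + t) \<le> exp (- 1 * t)" if "0 \<le> t" for t :: real
  proof -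
    have "exp (- 2 * t) * (1 + t) \<le> exp (- 2 * t) * exp t"
      by (intro mult_left_mono exp_ge_add_one_self) auto
    also have "\<dots> = exp (- 1 * t)" by (simp add: exp_add[symmetric])
    finally show ?thesis .
  qed
  then show "AE v::'a in lborel. norm (gauss v * (1 + (norm v)\<^sup>2)) \<le> norm (exp (- 1 * (norm v)\<^sup>2))"
    by (auto simp: gauss_def abs_mult)
qed measurable

lemma gauss_mass_pos: "0 < (LINT v::'a::euclidean_space|lborel. gauss v)"
proof -
  have "(LINT v::'a|lborel. gauss v) \<noteq> 0"
  proof
    assume "(LINT v::'a|lborel. gauss v) = 0"
    then have "AE v::'a in lborel. gauss v = 0"
      using integral_nonneg_eq_0_iff_AE[OF integrable_gauss] gauss_pos[THEN less_imp_le] by blast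
    then have "AE v::'a in lborel. v \<notin> UNIV"
      by eventually_elim (simp add: gauss_def)
    then have "(UNIV :: 'a set) \<in> null_sets lborel"
      by (subst (asm) AE_iff_null_sets[symmetric]) auto
    then show False by (simp add: null_sets_def)
  qed
  moreover have "0 \<le> (LINT v::'a|lborel. gauss v)"
    by (intro Bochner_Integration.integral_nonneg) (simp add: gauss_def)
  ultimately show ?thesis by simp
qed

lemma lborel_translate:
  fixes f :: "'a::euclidean_space \<Rightarrow> 'b::{banach, second_countable_topology}"
  shows "(LINT u|lborel. f u) = (LINT v|lborel. f (a + v))"
    and "integrable lborel (\<lambda>v. f (a + v)) \<longleftrightarrow> integrable lborel f"
proof -
  have eq: "integrable lborel (\<lambda>v. f (a + v)) \<longleftrightarrow> integrable lborel f" for f :: "'a \<Rightarrow> 'b" and a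
  proof -
    have imp: "integrable lborel (\<lambda>v. f (a + v))" if "integrable lborel f" for f :: "'a \<Rightarrow> 'b" and a
    proof -
      have "integrable (distr lborel borel ((+) a)) f" using that by (simp add: lborel_distr_plus)
      then show ?thesis by (subst (asm) integrable_distr_eq) (use that in auto)
    qed
    show ?thesis using imp[where f=f and a=a] imp[where f="\<lambda>v. f (a + v)" and a="- a"] by auto
  qed
  show "(LINT u|lborel. f u) = (LINT v|lborel. f (a + v))"
  proof (cases "f \<in> borel_measurable borel")
    case True
    have "(LINT u|lborel. f u) = (LINT u|distr lborel borel ((+) a). f u)" by (simp add: lborel_distr_plus)
    also have "\<dots> = (LINT v|lborel. f (a + v))" by (rule integral_distr) (use True in auto)
    finally show ?thesis .
  next
    \<comment> \<open>A function that is not measurable is not integrable, nor are its translates,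
      so both integrals take the default value zero.\<close>
    case False
    then have "\<not> integrable lborel f" by auto
    then show ?thesis using eq[where a=a and f=f] by (simp add: not_integrable_integral_eq)
  qed
  show "integrable lborel (\<lambda>v. f (a + v)) \<longleftrightarrow> integrable lborel f" by (rule eq)
qed

text \<open>The parallelogram law for \<open>s x - u\<close> and \<open>s y - u\<close>. It
  separates a damping in \<open>x - y\<close> from a Gaussian in \<open>u\<close> centred at
  \<open>s\<close> times the midpoint of \<open>x\<close> and \<open>y\<close>; this centring is
  what later makes terms linear in \<open>v\<close> average to zero.\<close>

lemma gauss_split:
  "exp (- (norm (s *\<^sub>R x - u))\<^sup>2) * exp (- (norm (s *\<^sub>R y - u))\<^sup>2) =
    exp (- (s\<^sup>2 * (norm (x - y))\<^sup>2 / 2)) * gauss (u - s *\<^sub>R ((1/2) *\<^sub>R (x + y)))"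
proof -
  define a b where "a = s *\<^sub>R x - u" and "b = s *\<^sub>R y - u"
  have d: "s\<^sup>2 * (norm (x - y))\<^sup>2 = (norm (a - b))\<^sup>2"
    by (simp add: a_def b_def scaleR_diff_right[symmetric] power_mult_distrib)
  have m: "u - s *\<^sub>R ((1/2) *\<^sub>R (x + y)) = (- 1/2) *\<^sub>R (a + b)"
    by (simp add: a_def b_def algebra_simps flip: scaleR_add_left)
  have "(norm a)\<^sup>2 + (norm b)\<^sup>2 = (norm (a - b))\<^sup>2 / 2 + (norm (a + b))\<^sup>2 / 2"
    by (simp add: power2_norm_eq_inner inner_simps inner_commute field_simps)
  then show ?thesis
    unfolding gauss_def exp_add[symmetric] d m a_def[symmetric] b_def[symmetric]
    by (simp add: power_mult_distrib power_divide)
qed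

text \<open>The argument of \<open>cis\<close> is the sum of \<open>q\<close> around the closed
  triangle with third vertex \<open>u / s\<close>, written in the variable
  \<open>v = u - s m\<close> with \<open>m\<close> the midpoint of \<open>x\<close> and
  \<open>y\<close>. For \<open>q = 0\<close> the value is the Gaussian mass.\<close>

definition avg_phase :: "real \<Rightarrow> ('a::euclidean_space \<Rightarrow> 'a \<Rightarrow> real) \<Rightarrow> 'a \<Rightarrow> 'a \<Rightarrow> complex" where
  "avg_phase s q x y = (LINT v|lborel. gauss v *\<^sub>R
     cis (q x y + q y ((1/2) *\<^sub>R (x + y) + (1/s) *\<^sub>R v) + q ((1/2) *\<^sub>R (x + y) + (1/s) *\<^sub>R v) x))"

lemma avg_phase_translate:
  assumes "s \<noteq> 0"
  shows "(LINT u|lborel. (exp (- (norm (s *\<^sub>R x - u))\<^sup>2) * exp (- (norm (s *\<^sub>R y - u))\<^sup>2)) *\<^sub>R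
      cis (q x y + q y ((1/s) *\<^sub>R u) + q ((1/s) *\<^sub>R u) x)) =
    exp (- (s\<^sup>2 * (norm (x - y))\<^sup>2 / 2)) *\<^sub>R avg_phase s q x y"
proof -
  define m where "m = (1/2) *\<^sub>R (x + y)"
  have "(LINT u|lborel. (exp (- (norm (s *\<^sub>R x - u))\<^sup>2) * exp (- (norm (s *\<^sub>R y - u))\<^sup>2)) *\<^sub>R
      cis (q x y + q y ((1/s) *\<^sub>R u) + q ((1/s) *\<^sub>R u) x)) =
    (LINT v|lborel. exp (- (s\<^sup>2 * (norm (x - y))\<^sup>2 / 2)) *\<^sub>R (gauss v *\<^sub>R
      cis (q x y + q y (m + (1/s) *\<^sub>R v) + q (m + (1/s) *\<^sub>R v) x)))"
    unfolding gauss_split m_def[symmetric]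
    by (subst lborel_translate(1)[of _ "s *\<^sub>R m"]) (use assms in \<open>simp add: scaleR_add_right\<close>)
  also have "\<dots> = exp (- (s\<^sup>2 * (norm (x - y))\<^sup>2 / 2)) *\<^sub>R avg_phase s q x y"
    unfolding avg_phase_def m_def[symmetric] by (rule integral_scaleR_right)
  finally show ?thesis .
qed

section \<open>Spectral edges for general phases\<close>

text \<open>Indexed by a phase function instead of a potential and a coupling, so that an already
  perturbed operator can be the starting point of the next perturbation.\<close>

definition phase_edge :: "complex \<Rightarrow> ('a::euclidean_space \<Rightarrow> 'a \<Rightarrow> complex) \<Rightarrow> ('a \<Rightarrow> 'a \<Rightarrow> real) \<Rightarrow> real" where
  "phase_edge c K p = sup_spectrum (kernel_op c (\<lambda>x y. cis (p x y) * K x y))"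

definition antisym_phase :: "('a::euclidean_space \<Rightarrow> 'a \<Rightarrow> real) \<Rightarrow> bool" where
  "antisym_phase p \<longleftrightarrow> (\<lambda>(x, y). p x y) \<in> borel_measurable (borel \<Otimes>\<^sub>M borel) \<and> (\<forall>x y. p y x = - p x y)"

lemma antisym_phaseD:
  assumes "antisym_phase p"
  shows "(\<lambda>(x, y). p x y) \<in> borel_measurable (borel \<Otimes>\<^sub>M borel)" and "p y x = - p x y"
  using assms unfolding antisym_phase_def by blast+

lemma antisym_phase_measurable:
  "antisym_phase p \<Longrightarrow> f \<in> measurable M borel \<Longrightarrow> g \<in> measurable M borel \<Longrightarrow>
    (\<lambda>x. p (f x) (g x)) \<in> borel_measurable M"
  unfolding antisym_phase_def by (blast intro: measurable_uncurry_comp)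

lemma antisym_phase_add:
  assumes "antisym_phase p" "antisym_phase q"
  shows "antisym_phase (\<lambda>x y. p x y + q x y)"
proof -
  note [measurable] = assms[THEN antisym_phase_measurable]
  have "(\<lambda>z. p (fst z) (snd z) + q (fst z) (snd z)) \<in> borel_measurable (borel \<Otimes>\<^sub>M borel)"
    by measurable
  moreover have "p y x + q y x = - (p x y + q x y)" for x y
    using antisym_phaseD(2)[OF assms(1), of y x] antisym_phaseD(2)[OF assms(2), of y x] by linarith
  ultimately show ?thesis unfolding antisym_phase_def case_prod_beta' by blast
qed

lemma phase_edge_form:
  fixes K :: "'a::euclidean_space kernel"
  assumes K: "schur_bound B K" "L2_selfadjoint (kernel_op c K)" and p: "antisym_phase p"
  defines "Q \<equiv> \<lambda>f. Re c * (L2_norm f)\<^sup>2 + Re (LINT (x, y)|lborel2. cnj (f x) * (cis (p x y) * K x y) * f y)"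
  shows "f \<in> L2 \<Longrightarrow> Q f \<le> phase_edge c K p * (L2_norm f)\<^sup>2"
    and "0 < \<delta> \<Longrightarrow> \<exists>f\<in>L2. 0 < L2_norm f \<and> (phase_edge c K p - \<delta>) * (L2_norm f)\<^sup>2 < Q f"
proof -
  let ?K = "\<lambda>x y. cis (p x y) * K x y"
  have K': "schur_bound B ?K"
    by (intro schur_bound_cis K antisym_phaseD p)
  have sa: "L2_selfadjoint (kernel_op c ?K)"
    by (intro selfadjoint_cis[OF K] antisym_phaseD p)
  have Q: "Re (L2_inner f (kernel_op c ?K f)) = Q f" if "f \<in> L2" for f
    unfolding L2_inner_kernel_op[OF K' that that] Q_def L2_inner_self by simp
  note form = sup_spectrum_form[OF L2_bounded_linear_kernel_op[OF K'] sa, folded phase_edge_def]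
  show "f \<in> L2 \<Longrightarrow> Q f \<le> phase_edge c K p * (L2_norm f)\<^sup>2"
    using form(1)[of f] Q[of f] by simp
  show "0 < \<delta> \<Longrightarrow> \<exists>f\<in>L2. 0 < L2_norm f \<and> (phase_edge c K p - \<delta>) * (L2_norm f)\<^sup>2 < Q f"
  proof -
    assume "0 < \<delta>"
    from form(2)[OF this] obtain f where "f \<in> L2" "0 < L2_norm f"
      "(phase_edge c K p - \<delta>) * (L2_norm f)\<^sup>2 < Re (L2_inner f (kernel_op c ?K f))" by blast
    then show ?thesis using Q[of f] by (intro bexI[of _ f]) auto
  qed
qed

text \<open>The bound is uniform in the phase. It is the a priori estimate that closes the dyadic
  iteration, where the far end point is otherwise uncontrolled.\<close>

lemma phase_edge_bound:
  fixes K :: "'a::euclidean_space kernel"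
  assumes K: "schur_bound B K" "L2_selfadjoint (kernel_op c K)" and p: "antisym_phase p"
  shows "\<bar>phase_edge c K p\<bar> \<le> cmod c + B"
proof -
  let ?K = "\<lambda>x y. cis (p x y) * K x y"
  let ?I = "\<lambda>f. LINT (x, y)|lborel2. cnj (f x) * ?K x y * f y"
  have K': "schur_bound B ?K"
    by (intro schur_bound_cis K antisym_phaseD p)
  have bd: "\<bar>Re c * (L2_norm f)\<^sup>2 + Re (?I f)\<bar> \<le> (cmod c + B) * (L2_norm f)\<^sup>2" if f: "f \<in> L2" for f
  proof -
    have "\<bar>Re (?I f)\<bar> \<le> B * (L2_norm f)\<^sup>2"
      using order_trans[OF abs_Re_le_cmod schur_form(2)[OF K' f f]] by simp
    moreover have "\<bar>Re c * (L2_norm f)\<^sup>2\<bar> \<le> cmod c * (L2_norm f)\<^sup>2"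
      by (simp add: abs_mult mult_right_mono abs_Re_le_cmod)
    ultimately show ?thesis
      by (auto simp: distrib_right intro: order_trans[OF abs_triangle_ineq])
  qed
  show ?thesis
  proof (rule abs_leI)
    show "phase_edge c K p \<le> cmod c + B"
    proof (rule field_le_epsilon)
      fix e :: real assume "0 < e"
      from phase_edge_form(2)[OF K p this] obtain f where f: "f \<in> L2" "0 < L2_norm f"
        "(phase_edge c K p - e) * (L2_norm f)\<^sup>2 < Re c * (L2_norm f)\<^sup>2 + Re (?I f)" by blast
      then have "(phase_edge c K p - e) * (L2_norm f)\<^sup>2 \<le> (cmod c + B) * (L2_norm f)\<^sup>2"
        using bd[OF f(1)] by linarith
      then show "phase_edge c K p \<le> cmod c + B + e"
        using f(2) by simp
    qed
    obtain f :: "'a \<Rightarrow> complex" where f: "f \<in> L2" "0 < L2_norm f" using L2_nonzero .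
    have "- ((cmod c + B) * (L2_norm f)\<^sup>2) \<le> phase_edge c K p * (L2_norm f)\<^sup>2"
      using bd[OF f(1)] phase_edge_form(1)[OF K p f(1)] by linarith
    then have "(- phase_edge c K p) * (L2_norm f)\<^sup>2 \<le> (cmod c + B) * (L2_norm f)\<^sup>2" by simp
    then show "- phase_edge c K p \<le> cmod c + B"
      using f(2) by (subst (asm) mult_le_cancel_right) auto
  qed
qed

text \<open>Trial functions for the perturbed phase \<open>p + q\<close>: localise \<open>f\<close> at all points \<open>u\<close> on scale
  \<open>1/s\<close>, gauge away \<open>q\<close> locally by \<open>cis (q x u)\<close>, and average over \<open>u\<close>.\<close>

lemma averaged_trial:
  fixes K :: "'a::euclidean_space kernel"
  assumes K: "schur_bound B K" "L2_selfadjoint (kernel_op c K)"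
    and p: "antisym_phase p" and q: "antisym_phase q" and s: "0 < s" and f: "f \<in> L2"
  defines "N \<equiv> LINT v::'a|lborel. gauss v"
  defines "G \<equiv> \<lambda>x y. exp (- (s\<^sup>2 * (norm (x - y))\<^sup>2 / 2)) *\<^sub>R avg_phase s q x y"
  shows "integrable lborel2 (\<lambda>(x, y). cnj (f x) * (cis (p x y) * K x y) * f y * G x y)" (is ?A)
    and "Re c * (N * (L2_norm f)\<^sup>2) + Re (LINT (x, y)|lborel2. cnj (f x) * (cis (p x y) * K x y) * f y * G x y)
      \<le> phase_edge c K (\<lambda>x y. p x y + q x y) * (N * (L2_norm f)\<^sup>2)" (is ?B)
proof -
  note [measurable] = f[THEN L2_measurable] schur_bound_measurable[OF K(1)]
    antisym_phase_measurable[OF p] antisym_phase_measurable[OF q]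
  define g where "g x u = exp (- (norm (s *\<^sub>R x - u))\<^sup>2)" for x u :: 'a
  have g_meas [measurable]: "(\<lambda>z. g (a z) (b z)) \<in> borel_measurable M"
    if "a \<in> measurable M borel" "b \<in> measurable M borel" for a b and M :: "'z measure"
    using that unfolding g_def by measurable
  have gg: "g x u * g y u = exp (- (s\<^sup>2 * (norm (x - y))\<^sup>2 / 2)) * gauss (- (s *\<^sub>R ((1/2) *\<^sub>R (x + y))) + u)" for x y u
    unfolding g_def gauss_split by (simp add: add.commute)
  have gg_int: "integrable lborel (\<lambda>u. g x u * g y u)" for x y
    unfolding gg by (intro integrable_mult_right lborel_translate(2)[THEN iffD2] integrable_gauss)
  have gg_val: "(LINT u|lborel. g x u * g y u) = exp (- (s\<^sup>2 * (norm (x - y))\<^sup>2 / 2)) * N" for x y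
    unfolding gg N_def lborel_translate(1)[of gauss "- (s *\<^sub>R ((1/2) *\<^sub>R (x + y)))"]
    by (rule integral_mult_right_zero)
  have g_le1: "0 < g x u" "g x u \<le> 1" for x u by (auto simp: g_def)
  have N: "0 < N" unfolding N_def by (rule gauss_mass_pos)
  define \<psi> where "\<psi> u x = g x u *\<^sub>R (cis (q x ((1/s) *\<^sub>R u)) * f x)" for u x
  have \<psi>_norm: "(cmod (\<psi> u x))\<^sup>2 = g x u * g x u * (cmod (f x))\<^sup>2" for u x
    by (simp add: \<psi>_def norm_mult power_mult_distrib power2_eq_square)
  have \<psi>_L2: "\<psi> u \<in> L2" for u
  proof -
    have meas: "\<psi> u \<in> borel_measurable borel"
      unfolding \<psi>_def[abs_def] cis_conv_exp by measurable
    have "integrable lborel (\<lambda>x. (cmod (\<psi> u x))\<^sup>2)"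
    proof (rule Bochner_Integration.integrable_bound[OF L2_integrable[OF f]])
      have "g x u * g x u * (cmod (f x))\<^sup>2 \<le> 1 * (cmod (f x))\<^sup>2" for x
        using g_le1[of x u] by (intro mult_right_mono mult_le_one) auto
      then show "AE x in lborel. norm ((cmod (\<psi> u x))\<^sup>2) \<le> norm ((cmod (f x))\<^sup>2)"
        unfolding \<psi>_norm using g_le1 by (auto simp: abs_mult)
    qed (use meas in measurable)
    with meas show ?thesis by (simp add: L2_def)
  qed
  \<comment> \<open>At \<open>x = y\<close> there is no damping, so the squared norms of the trial
    functions integrate over \<open>u\<close> to exactly \<open>N\<close> times that of
    \<open>f\<close>.\<close>
  have fst_int: "integrable lborel2 (\<lambda>(x, u). g x u * g x u * (cmod (f x))\<^sup>2)"
  proof (rule lborel_pair.Fubini_integrable)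
    show "(\<lambda>(x, u). g x u * g x u * (cmod (f x))\<^sup>2) \<in> borel_measurable lborel2"
      unfolding case_prod_beta' by measurable
    have "(LINT u|lborel. norm (g x u * g x u * (cmod (f x))\<^sup>2)) = N * (cmod (f x))\<^sup>2" for x
      using g_le1 gg_val[of x x] by (simp add: abs_mult)
    then have eq: "(\<lambda>x. LINT u|lborel. norm (case (x, u) of (x, u) \<Rightarrow> g x u * g x u * (cmod (f x))\<^sup>2)) = (\<lambda>x. N * (cmod (f x))\<^sup>2)"
      by (simp only: prod.case)
    show "integrable lborel (\<lambda>x. LINT u|lborel. norm (case (x, u) of (x, u) \<Rightarrow> g x u * g x u * (cmod (f x))\<^sup>2))"
      unfolding eq by (intro integrable_mult_right L2_integrable f)
    show "AE x in lborel. integrable lborel (\<lambda>u. case (x, u) of (x, u) \<Rightarrow> g x u * g x u * (cmod (f x))\<^sup>2)"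
      using gg_int by simp
  qed
  have norm_int: "integrable lborel (\<lambda>u. (L2_norm (\<psi> u))\<^sup>2)"
    and norm_val: "(LINT u|lborel. (L2_norm (\<psi> u))\<^sup>2) = N * (L2_norm f)\<^sup>2"
  proof -
    show "integrable lborel (\<lambda>u. (L2_norm (\<psi> u))\<^sup>2)"
      unfolding L2_norm_sq \<psi>_norm by (rule lborel_pair.integrable_snd[OF fst_int])
    have "(LINT u|lborel. (L2_norm (\<psi> u))\<^sup>2) = (LINT x|lborel. LINT u|lborel. g x u * g x u * (cmod (f x))\<^sup>2)"
      unfolding L2_norm_sq \<psi>_norm by (rule lborel_pair.Fubini_integral[OF fst_int])
    also have "\<dots> = N * (L2_norm f)\<^sup>2"
      unfolding L2_norm_sq by (simp add: gg_val)
    finally show "(LINT u|lborel. (L2_norm (\<psi> u))\<^sup>2) = N * (L2_norm f)\<^sup>2" .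
  qed
  define \<Phi> where "\<Phi> z = cnj (f (fst z)) * (cis (p (fst z) (snd z)) * K (fst z) (snd z)) * f (snd z)" for z
  define \<Omega> where "\<Omega> z w = q (fst z) (snd z) + q (snd z) w + q w (fst z)" for z w
  \<comment> \<open>One integrand read in two orders: integrated over \<open>z\<close> it is the
    form of the perturbed kernel at \<open>\<psi> u\<close>, integrated over \<open>u\<close> it is
    the integrand of the form of the kernel with phase \<open>p\<close> at \<open>f\<close>,
    multiplied by \<open>G\<close>.\<close>
  define H where "H z u = \<Phi> z * ((g (fst z) u * g (snd z) u) *\<^sub>R cis (\<Omega> z ((1/s) *\<^sub>R u)))" for z u
  have K': "schur_bound B (\<lambda>x y. cis (p x y) * K x y)"
    by (intro schur_bound_cis K antisym_phaseD p)
  have \<Phi>_int: "integrable lborel2 \<Phi>"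
    using schur_form(1)[OF K' f f] by (simp add: \<Phi>_def[abs_def] case_prod_beta')
  then have \<Phi>_meas [measurable]: "\<Phi> \<in> borel_measurable (borel \<Otimes>\<^sub>M borel)"
    using borel_measurable_integrable by fastforce
  interpret Z: pair_sigma_finite "lborel2 :: ('a \<times> 'a) measure" "lborel :: 'a measure" ..
  have H_int: "integrable (lborel2 \<Otimes>\<^sub>M lborel) (\<lambda>(z, u). H z u)"
  proof (rule Z.Fubini_integrable)
    show "(\<lambda>(z, u). H z u) \<in> borel_measurable (lborel2 \<Otimes>\<^sub>M lborel)"
      unfolding case_prod_beta' H_def \<Omega>_def cis_conv_exp by measurable
    have eq: "(LINT u|lborel. norm (H z u)) = cmod (\<Phi> z) * (exp (- (s\<^sup>2 * (norm (fst z - snd z))\<^sup>2 / 2)) * N)" for z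
      using g_le1 by (simp add: H_def norm_mult abs_mult gg_val less_imp_le)
    have "integrable lborel2 (\<lambda>z. cmod (\<Phi> z) * (exp (- (s\<^sup>2 * (norm (fst z - snd z))\<^sup>2 / 2)) * N))"
    proof (rule Bochner_Integration.integrable_bound)
      show "integrable lborel2 (\<lambda>z. cmod (\<Phi> z) * N)"
        using \<Phi>_int by (intro integrable_mult_left integrable_norm)
      have "exp (- (s\<^sup>2 * (norm (fst z - snd z))\<^sup>2 / 2)) * N \<le> 1 * N" for z :: "'a \<times> 'a"
        using N by (intro mult_right_mono) auto
      then show "AE z in lborel2. norm (cmod (\<Phi> z) * (exp (- (s\<^sup>2 * (norm (fst z - snd z))\<^sup>2 / 2)) * N)) \<le> norm (cmod (\<Phi> z) * N)"
        using N by (auto simp: abs_mult intro!: mult_left_mono)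
    qed measurable
    then show "integrable lborel2 (\<lambda>z. LINT u|lborel. norm (case (z, u) of (z, u) \<Rightarrow> H z u))"
      using eq by simp
    have "integrable lborel (H z)" for z
    proof (rule Bochner_Integration.integrable_bound)
      show "integrable lborel (\<lambda>u. cmod (\<Phi> z) * (g (fst z) u * g (snd z) u))"
        by (intro integrable_mult_right gg_int)
      show "H z \<in> borel_measurable lborel"
        unfolding H_def[abs_def] \<Omega>_def cis_conv_exp by measurable
    qed (auto simp: H_def norm_mult abs_mult mult.commute)
    then show "AE z in lborel2. integrable lborel (\<lambda>u. case (z, u) of (z, u) \<Rightarrow> H z u)"
      by simp
  qed
  have H_G: "(LINT u|lborel. H z u) = \<Phi> z * G (fst z) (snd z)" for z
    unfolding H_def G_def avg_phase_translate[of s, symmetric, OF less_imp_neq[OF s, symmetric]] g_def \<Omega>_def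
    by (rule integral_mult_right_zero)
  have "integrable lborel2 (\<lambda>z. LINT u|lborel. H z u)"
    by (rule Z.integrable_fst[OF H_int])
  then show ?A
    unfolding H_G by (simp add: \<Phi>_def case_prod_beta')
  have H_\<psi>: "(LINT (x, y)|lborel2. cnj (\<psi> u x) * (cis (p x y + q x y) * K x y) * \<psi> u y) =
      (LINT z|lborel2. H z u)" for u
  proof (rule Bochner_Integration.integral_cong[OF refl])
    fix z :: "'a \<times> 'a"
    obtain x y where z: "z = (x, y)" by (cases z)
    let ?w = "(1/s) *\<^sub>R u"
    \<comment> \<open>The conjugated gauge factor at \<open>x\<close> becomes the third side of the
      triangle, and the three phases close to a loop.\<close>
    have "q ?w x = - q x ?w" by (rule antisym_phaseD(2)[OF q])
    then have "cis (\<Omega> (x, y) ?w) = cis (q x y) * cis (q y ?w) * cnj (cis (q x ?w))"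
      by (simp add: \<Omega>_def cis_mult cis_cnj)
    then show "(case z of (x, y) \<Rightarrow> cnj (\<psi> u x) * (cis (p x y + q x y) * K x y) * \<psi> u y) = H z u"
      by (simp add: z \<psi>_def H_def \<Phi>_def cis_mult[symmetric] scaleR_conv_of_real)
  qed
  have pq: "antisym_phase (\<lambda>x y. p x y + q x y)" by (rule antisym_phase_add[OF p q])
  define E where "E = phase_edge c K (\<lambda>x y. p x y + q x y)"
  have trial: "Re c * (L2_norm (\<psi> u))\<^sup>2 + Re (LINT z|lborel2. H z u) \<le> E * (L2_norm (\<psi> u))\<^sup>2" for u
    using phase_edge_form(1)[OF K pq \<psi>_L2[of u]] unfolding H_\<psi> E_def .
  have H_snd: "integrable lborel (\<lambda>u. LINT z|lborel2. H z u)"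
    by (rule Z.integrable_snd[OF H_int])
  have "(LINT u|lborel. Re c * (L2_norm (\<psi> u))\<^sup>2 + Re (LINT z|lborel2. H z u))
      \<le> (LINT u|lborel. E * (L2_norm (\<psi> u))\<^sup>2)"
    using trial H_snd norm_int by (intro integral_mono) auto
  also have "\<dots> = E * (N * (L2_norm f)\<^sup>2)"
    by (simp add: norm_val)
  also have "(LINT u|lborel. Re c * (L2_norm (\<psi> u))\<^sup>2 + Re (LINT z|lborel2. H z u)) =
      Re c * (N * (L2_norm f)\<^sup>2) + Re (LINT u|lborel. LINT z|lborel2. H z u)"
    using H_snd norm_int by (simp add: norm_val)
  also have "(LINT u|lborel. LINT z|lborel2. H z u) = (LINT z|lborel2. LINT u|lborel. H z u)"
    by (rule Z.Fubini_integral[OF H_int])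
  also have "\<dots> = (LINT (x, y)|lborel2. cnj (f x) * (cis (p x y) * K x y) * f y * G x y)"
    unfolding H_G by (simp add: \<Phi>_def case_prod_beta')
  finally show ?B unfolding E_def .
qed

text \<open>For an almost maximising \<open>f\<close> of the phase \<open>p\<close>, the trial
  inequalities for \<open>q1\<close> and \<open>q2\<close> are averaged. The averaged multiplier
  differs from \<open>N\<close> by at most \<open>\<eta> |w|\<close>, and Schur's test for
  \<open>K w\<close> turns this into a form error \<open>\<eta> B'\<close>. Opposite phases exploit
  cancellation between the two; equal ones give a one-sided comparison of two edges.\<close>

lemma phase_edge_average:
  fixes K :: "'a::euclidean_space kernel"
  assumes K: "schur_bound B K" "L2_selfadjoint (kernel_op c K)"
    and p: "antisym_phase p" and q: "antisym_phase q1" "antisym_phase q2" and s: "0 < s"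
    and W: "schur_bound B' (\<lambda>x y. K x y * complex_of_real (w x y))" and "0 \<le> \<eta>"
  defines "N \<equiv> LINT v::'a|lborel. gauss v"
  assumes est: "\<And>x y. cmod (exp (- (s\<^sup>2 * (norm (x - y))\<^sup>2 / 2)) *\<^sub>R
      ((1/2) *\<^sub>R (avg_phase s q1 x y + avg_phase s q2 x y)) - complex_of_real N) \<le> \<eta> * \<bar>w x y\<bar>"
  shows "phase_edge c K p - \<eta> * B' / N \<le>
    (phase_edge c K (\<lambda>x y. p x y + q1 x y) + phase_edge c K (\<lambda>x y. p x y + q2 x y)) / 2"
proof (rule field_le_epsilon)
  fix \<delta> :: real assume "0 < \<delta>"
  define E E1 E2 where "E = phase_edge c K p" and "E1 = phase_edge c K (\<lambda>x y. p x y + q1 x y)"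
    and "E2 = phase_edge c K (\<lambda>x y. p x y + q2 x y)"
  define G where "G q x y = exp (- (s\<^sup>2 * (norm (x - y))\<^sup>2 / 2)) *\<^sub>R avg_phase s q x y" for q and x y :: 'a
  have N: "0 < N" unfolding N_def by (rule gauss_mass_pos)
  have B': "0 \<le> B'" using W by (rule schur_bound_nonneg)
  from phase_edge_form(2)[OF K p \<open>0 < \<delta>\<close>] obtain f where f: "f \<in> L2" "0 < L2_norm f"
    and lt: "(E - \<delta>) * (L2_norm f)\<^sup>2 < Re c * (L2_norm f)\<^sup>2 +
      Re (LINT (x, y)|lborel2. cnj (f x) * (cis (p x y) * K x y) * f y)"
    unfolding E_def by blast
  define \<Phi> where "\<Phi> x y = cnj (f x) * (cis (p x y) * K x y) * f y" for x y
  note avg1 = averaged_trial[OF K p q(1) s f(1), folded N_def E1_def, folded \<Phi>_def G_def]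
  note avg2 = averaged_trial[OF K p q(2) s f(1), folded N_def E2_def, folded \<Phi>_def G_def]
  have \<Phi>_int: "integrable lborel2 (\<lambda>(x, y). \<Phi> x y)"
    unfolding \<Phi>_def by (rule schur_form(1)[OF schur_bound_cis[OF K(1) antisym_phaseD(1)[OF p]] f(1) f(1)])
  define R where "R x y = (1/2) *\<^sub>R (G q1 x y + G q2 x y) - complex_of_real N" for x y
  have R: "cmod (R x y) \<le> \<eta> * \<bar>w x y\<bar>" for x y
    using est[of x y] by (simp add: R_def G_def scaleR_add_right scaleR_left_commute)
  have eqR: "(\<lambda>(x, y). \<Phi> x y * R x y) = (\<lambda>z. (1/2) *\<^sub>R ((case z of (x, y) \<Rightarrow> \<Phi> x y * G q1 x y) + (case z of (x, y) \<Rightarrow> \<Phi> x y * G q2 x y))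
      - complex_of_real N * (case z of (x, y) \<Rightarrow> \<Phi> x y))"
    by (auto simp: R_def algebra_simps fun_eq_iff)
  have R_int: "integrable lborel2 (\<lambda>(x, y). \<Phi> x y * R x y)"
    unfolding eqR using avg1(1) avg2(1) \<Phi>_int
    by (intro Bochner_Integration.integrable_diff integrable_scaleR_right Bochner_Integration.integrable_add integrable_mult_right) auto
  have R_val: "(LINT (x, y)|lborel2. \<Phi> x y * R x y) =
      (1/2) *\<^sub>R ((LINT (x, y)|lborel2. \<Phi> x y * G q1 x y) + (LINT (x, y)|lborel2. \<Phi> x y * G q2 x y))
      - complex_of_real N * (LINT (x, y)|lborel2. \<Phi> x y)"
    unfolding eqR using avg1(1) avg2(1) \<Phi>_int by simp
  have "cmod (LINT (x, y)|lborel2. \<Phi> x y * R x y) \<le> \<eta> * (B' * (L2_norm f)\<^sup>2)"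
  proof -
    note [measurable] = f(1)[THEN L2_measurable] schur_bound_measurable[OF W]
    have "ennreal (cmod (LINT (x, y)|lborel2. \<Phi> x y * R x y)) \<le>
        (\<integral>\<^sup>+ z. norm (case z of (x, y) \<Rightarrow> \<Phi> x y * R x y) \<partial>lborel2)"
      by (rule integral_norm_bound_ennreal[OF R_int])
    also have "\<dots> \<le> (\<integral>\<^sup>+ z. ennreal \<eta> * (case z of (x, y) \<Rightarrow>
        ennreal (cmod (f x) * cmod (K x y * complex_of_real (w x y)) * cmod (f y))) \<partial>lborel2)"
    proof (intro nn_integral_mono)
      fix z :: "'a \<times> 'a"
      obtain x y where z: "z = (x, y)" by (cases z)
      have "cmod (\<Phi> x y * R x y) = cmod (f x) * cmod (K x y) * cmod (f y) * cmod (R x y)"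
        by (simp add: \<Phi>_def norm_mult)
      also have "\<dots> \<le> cmod (f x) * cmod (K x y) * cmod (f y) * (\<eta> * \<bar>w x y\<bar>)"
        by (intro mult_left_mono R) auto
      also have "\<dots> = \<eta> * (cmod (f x) * cmod (K x y * complex_of_real (w x y)) * cmod (f y))"
        by (simp add: norm_mult)
      finally have "cmod (\<Phi> x y * R x y) \<le> \<dots>" .
      then show "ennreal (norm (case z of (x, y) \<Rightarrow> \<Phi> x y * R x y)) \<le> ennreal \<eta> * (case z of (x, y) \<Rightarrow>
          ennreal (cmod (f x) * cmod (K x y * complex_of_real (w x y)) * cmod (f y)))"
        using \<open>0 \<le> \<eta>\<close> by (simp add: z ennreal_mult'[symmetric] ennreal_leI)
    qed
    also have "\<dots> = ennreal \<eta> * (\<integral>\<^sup>+ (x, y). ennreal (cmod (f x) * cmod (K x y * complex_of_real (w x y)) * cmod (f y)) \<partial>lborel2)"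
      unfolding case_prod_beta' by (intro nn_integral_cmult) measurable
    also have "\<dots> \<le> ennreal \<eta> * ennreal (B' * (L2_norm f)\<^sup>2)"
      using schur_nn_integral[OF W f(1) f(1)] by (intro mult_left_mono) auto
    also have "\<dots> = ennreal (\<eta> * (B' * (L2_norm f)\<^sup>2))"
      using \<open>0 \<le> \<eta>\<close> by (simp add: ennreal_mult'[symmetric])
    finally show ?thesis using \<open>0 \<le> \<eta>\<close> B' by (subst (asm) ennreal_le_iff) auto
  qed
  then have "- (\<eta> * (B' * (L2_norm f)\<^sup>2)) \<le> Re (LINT (x, y)|lborel2. \<Phi> x y * R x y)"
    using abs_Re_le_cmod[of "LINT (x, y)|lborel2. \<Phi> x y * R x y"] by linarith
  moreover have "N * ((E - \<delta>) * (L2_norm f)\<^sup>2) \<le>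
      N * (Re c * (L2_norm f)\<^sup>2 + Re (LINT (x, y)|lborel2. \<Phi> x y))"
    using N lt unfolding \<Phi>_def by (intro mult_left_mono) auto
  ultimately have "N * ((E - \<delta>) * (L2_norm f)\<^sup>2) - \<eta> * (B' * (L2_norm f)\<^sup>2) \<le> (E1 + E2) / 2 * (N * (L2_norm f)\<^sup>2)"
    using avg1(2) avg2(2) unfolding R_val by (simp add: field_simps)
  moreover have "(E - \<delta> - \<eta> * B' / N) * (N * (L2_norm f)\<^sup>2) =
      N * ((E - \<delta>) * (L2_norm f)\<^sup>2) - \<eta> * (B' * (L2_norm f)\<^sup>2)"
    using N by (simp add: field_simps)
  ultimately have "(E - \<delta> - \<eta> * B' / N) * (N * (L2_norm f)\<^sup>2) \<le> (E1 + E2) / 2 * (N * (L2_norm f)\<^sup>2)"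
    by linarith
  then have "E - \<delta> - \<eta> * B' / N \<le> (E1 + E2) / 2"
    using N f(2) by (subst (asm) mult_le_cancel_right) auto
  then show "E - \<eta> * B' / N \<le> (E1 + E2) / 2 + \<delta>" by linarith
qed

section \<open>Phases and fluxes\<close>

text \<open>The regularity part of \<open>transverse_potential\<close>, kept apart because Stokes'
  theorem and the loop estimates hold in every gauge.\<close>

definition C1_field :: "(real^'n \<Rightarrow> real^'n::finite) \<Rightarrow> bool" where
  "C1_field A \<longleftrightarrow> (\<exists>A' :: real^'n \<Rightarrow> (real^'n) \<Rightarrow>\<^sub>L (real^'n).
     (\<forall>x. (A has_derivative blinfun_apply (A' x)) (at x)) \<and> continuous_on UNIV A')"

text \<open>For the two-form \<open>b\<close> this is the vector representing
  \<open>b(a, .)\<close>, so its inner product with \<open>w\<close> is the flux density through the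
  parallelogram of \<open>a\<close> and \<open>w\<close>.\<close>

definition contract :: "('n \<Rightarrow> 'n \<Rightarrow> real) \<Rightarrow> real^'n \<Rightarrow> real^'n::finite" where
  "contract b a = (\<chi> k. \<Sum>j\<in>UNIV. a $ j * b j k)"

lemma inner_contract: "contract b a \<bullet> w = (\<Sum>j\<in>UNIV. \<Sum>k\<in>UNIV. a $ j * w $ k * b j k)"
  unfolding contract_def inner_vec_def
  by (subst sum.swap) (simp add: sum_distrib_left sum_distrib_right mult_ac)

text \<open>Crude \<open>l1\<close> estimates in both indices; they are the origin of the factor
  \<open>CARD('n) ^ 2\<close> in the constants \<open>D\<close> below.\<close>

lemma norm_contract_le:
  fixes a :: "real^'n::finite"
  assumes "\<And>j k. \<bar>b j k\<bar> \<le> M"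
  shows "norm (contract b a) \<le> real CARD('n) ^ 2 * M * norm a"
proof -
  have "0 \<le> M" using assms[of undefined undefined] by linarith
  have "norm (contract b a) \<le> (\<Sum>k\<in>UNIV. \<bar>contract b a $ k\<bar>)"
    by (rule norm_le_l1_cart)
  also have "\<dots> \<le> (\<Sum>k\<in>(UNIV::'n set). \<Sum>j\<in>(UNIV::'n set). norm a * M)"
  proof (rule sum_mono)
    fix k :: 'n
    have "\<bar>contract b a $ k\<bar> \<le> (\<Sum>j\<in>UNIV. \<bar>a $ j * b j k\<bar>)"
      by (simp add: contract_def sum_abs)
    also have "\<dots> \<le> (\<Sum>j\<in>(UNIV::'n set). norm a * M)"
      unfolding abs_mult using \<open>0 \<le> M\<close>
      by (intro sum_mono mult_mono component_le_norm_cart assms) auto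
    finally show "\<bar>contract b a $ k\<bar> \<le> (\<Sum>j\<in>(UNIV::'n set). norm a * M)" .
  qed
  finally show ?thesis by (simp add: power2_eq_square mult_ac)
qed

lemma contract_diff: "contract b a - contract b' a = contract (\<lambda>j k. b j k - b' j k) a"
  by (simp add: contract_def vec_eq_iff right_diff_distrib sum_subtractf)

lemma contract_scale: "contract (\<lambda>j k. r * b j k) a = r *\<^sub>R contract b a"
  by (simp add: contract_def vec_eq_iff sum_distrib_left mult_ac)

lemma phase_inner: "phase A x y = - integral {0..1} (\<lambda>t. (y - x) \<bullet> A (x + t *\<^sub>R (y - x)))"
  by (simp add: phase_def inner_vec_def)

lemma phase_scaleR: "phase (\<lambda>z. r *\<^sub>R A z) x y = r * phase A x y"
  by (simp add: phase_inner)

lemma mag_field_antisym: "mag_field A x k j = - mag_field A x j k"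
  by (simp add: mag_field_def)

lemma contract_self: "contract (mag_field A z) w \<bullet> w = 0"
proof -
  have "contract (mag_field A z) w \<bullet> w = (\<Sum>k\<in>UNIV. \<Sum>j\<in>UNIV. w $ j * w $ k * mag_field A z j k)"
    unfolding inner_contract by (rule sum.swap)
  also have "\<dots> = - (contract (mag_field A z) w \<bullet> w)"
    unfolding inner_contract by (subst mag_field_antisym) (simp add: sum_negf mult_ac)
  finally show ?thesis by simp
qed

lemma partial_deriv_component:
  assumes "(A has_derivative D) (at x)"
  shows "partial_deriv j (\<lambda>y. A y $ k) x = D (axis j 1) $ k"
proof -
  have "((\<lambda>t. x + t *\<^sub>R axis j 1) has_derivative (\<lambda>t. t *\<^sub>R axis j 1)) (at (0::real))"
    by (auto intro!: derivative_eq_intros)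
  moreover have "(A has_derivative D) (at (x + 0 *\<^sub>R axis j 1))"
    using assms by simp
  ultimately have "((\<lambda>t. A (x + t *\<^sub>R axis j 1)) has_derivative (\<lambda>t. D (t *\<^sub>R axis j 1))) (at (0::real))"
    by (rule has_derivative_compose)
  then have "((\<lambda>t. A (x + t *\<^sub>R axis j 1) $ k) has_derivative (\<lambda>t. D (t *\<^sub>R axis j 1) $ k)) (at (0::real))"
    by (rule bounded_linear.has_derivative[OF bounded_linear_vec_nth])
  moreover have "(\<lambda>t. D (t *\<^sub>R axis j 1) $ k) = (\<lambda>t. t * (D (axis j 1) $ k))"
    by (simp add: linear_scale[OF has_derivative_linear[OF assms]])
  ultimately have "((\<lambda>t. A (x + t *\<^sub>R axis j 1) $ k) has_field_derivative D (axis j 1) $ k) (at 0)"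
    by (simp add: has_field_derivative_def mult_commute_abs)
  then show ?thesis unfolding partial_deriv_def by (rule DERIV_imp_deriv)
qed

text \<open>The coordinate-free form of \<open>B = dA\<close>: the antisymmetrised derivative,
  obtained by expanding both vectors in the standard basis.\<close>

lemma contract_mag_field:
  assumes A: "(A has_derivative D) (at z)"
  shows "contract (mag_field A z) a \<bullet> w = D a \<bullet> w - D w \<bullet> a"
proof -
  have expand: "D a \<bullet> w = (\<Sum>j\<in>UNIV. \<Sum>k\<in>UNIV. a $ j * w $ k * D (axis j 1) $ k)" for a w
  proof -
    have "D a = D (\<Sum>j\<in>UNIV. a $ j *\<^sub>R axis j 1)"
      using basis_expansion[of a] by (simp add: scalar_mult_eq_scaleR)
    also have "\<dots> = (\<Sum>j\<in>UNIV. a $ j *\<^sub>R D (axis j 1))"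
      using has_derivative_linear[OF A] by (simp add: linear_sum linear_scale)
    finally have "D a \<bullet> w = (\<Sum>j\<in>UNIV. a $ j * (D (axis j 1) \<bullet> w))"
      by (simp add: inner_sum_left)
    also have "\<dots> = (\<Sum>j\<in>UNIV. \<Sum>k\<in>UNIV. a $ j * w $ k * D (axis j 1) $ k)"
      by (simp add: inner_vec_def sum_distrib_left mult_ac)
    finally show ?thesis .
  qed
  have "D w \<bullet> a = (\<Sum>j\<in>UNIV. \<Sum>k\<in>UNIV. a $ j * w $ k * D (axis k 1) $ j)"
    unfolding expand by (subst sum.swap) (simp add: mult_ac)
  then show ?thesis
    unfolding inner_contract expand[of a w] mag_field_def partial_deriv_component[OF A]
    by (simp add: right_diff_distrib sum_subtractf)
qed

lemma C1_fieldE: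
  assumes "C1_field A"
  obtains A' where "\<And>x. (A has_derivative blinfun_apply (A' x)) (at x)" "continuous_on UNIV A'"
  using assms by (auto simp: C1_field_def)

lemma C1_field_continuous:
  assumes "C1_field A"
  shows "continuous_on UNIV A"
proof -
  obtain A' where "\<And>x. (A has_derivative blinfun_apply (A' x)) (at x)"
    using C1_fieldE[OF assms] by metis
  then show ?thesis
    by (meson continuous_at_imp_continuous_on has_derivative_continuous)
qed

lemma continuous_contract_mag_field:
  fixes A :: "'n::finite vector_field"
  assumes "C1_field A" "continuous_on S f"
  shows "continuous_on S (\<lambda>z. mag_field A (f z) j k)"
proof -
  obtain A' where A': "\<And>x. (A has_derivative blinfun_apply (A' x)) (at x)" "continuous_on UNIV A'"
    using C1_fieldE[OF assms(1)] by metis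
  have "continuous_on S (\<lambda>z. A' (f z))"
    by (rule continuous_on_compose2[OF A'(2) assms(2)]) auto
  then have "continuous_on S (\<lambda>z. A' (f z) (axis j 1) $ k - A' (f z) (axis k 1) $ j)"
    by (intro continuous_intros)
  then show ?thesis
    unfolding mag_field_def partial_deriv_component[OF A'(1)] .
qed

section \<open>Circulation around triangles and flux\<close>

lemma continuous_phase:
  fixes A :: "'n::finite vector_field"
  assumes "C1_field A"
  shows "continuous_on UNIV (\<lambda>p. phase A (fst p) (snd p))"
proof -
  have "continuous_on (UNIV \<times> cbox 0 1) (\<lambda>(p :: (real^'n) \<times> (real^'n), t::real). (snd p - fst p) \<bullet> A (fst p + t *\<^sub>R (snd p - fst p)))"
    unfolding case_prod_beta'
    by (intro continuous_intros continuous_on_compose2[OF C1_field_continuous[OF assms]]) auto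
  from integral_continuous_on_param[OF this] show ?thesis
    unfolding phase_inner cbox_interval by (intro continuous_intros)
qed

text \<open>Stokes' theorem on the triangle \<open>x, y, u\<close>: differentiate the circulation along the segment
  from \<open>x\<close> to \<open>y + s (u - y)\<close> with respect to \<open>s\<close>.\<close>

lemma phase_triangle:
  fixes A :: "'n::finite vector_field"
  assumes C1: "C1_field A"
  shows "phase A x y + phase A y u - phase A x u = -
    integral {0..1} (\<lambda>s. integral {0..1} (\<lambda>t.
      t * (contract (mag_field A (x + t *\<^sub>R (y - x + s *\<^sub>R (u - y)))) (y - x) \<bullet> (u - y))))"
proof -
  obtain A' where A': "\<And>x. (A has_derivative blinfun_apply (A' x)) (at x)" and contA': "continuous_on UNIV A'"
    using C1_fieldE[OF C1] by metis
  define w where "w = u - y"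
  define e where "e s = y - x + s *\<^sub>R w" for s
  define P where "P s = integral {0..1} (\<lambda>t. e s \<bullet> A (x + t *\<^sub>R e s))" for s
  define F where "F s t = w \<bullet> A (x + t *\<^sub>R e s) + t * (e s \<bullet> A' (x + t *\<^sub>R e s) w)" for s t
  define b where "b s t = t * (contract (mag_field A (x + t *\<^sub>R e s)) (y - x) \<bullet> w)" for s t
  note cA = continuous_on_compose2[OF C1_field_continuous[OF C1]]
  note cA' = continuous_on_compose2[OF contA']
  have contF: "continuous_on (UNIV \<times> cbox 0 1) (\<lambda>(s, t). F s t)"
    unfolding F_def e_def case_prod_beta' by (intro continuous_intros cA cA') auto
  have contb: "continuous_on UNIV (\<lambda>(s, t). b s t)"
    unfolding b_def e_def case_prod_beta' inner_contract
    by (intro continuous_intros continuous_contract_mag_field[OF C1])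
  have P_deriv: "(P has_vector_derivative integral {0..1} (F s)) (at s within {0..1})" for s
  proof -
    have "((\<lambda>s. integral (cbox 0 1) (\<lambda>t. e s \<bullet> A (x + t *\<^sub>R e s))) has_vector_derivative integral (cbox 0 1) (F s)) (at s within UNIV)"
    proof (rule leibniz_rule_vector_derivative)
      fix s t :: real
      have e: "(e has_vector_derivative w) (at s)"
        unfolding e_def by (auto intro!: derivative_eq_intros simp: has_vector_derivative_def)
      then have "((\<lambda>s. x + t *\<^sub>R e s) has_vector_derivative t *\<^sub>R w) (at s)"
        by (auto intro!: derivative_eq_intros)
      then have "(A \<circ> (\<lambda>s. x + t *\<^sub>R e s) has_vector_derivative A' (x + t *\<^sub>R e s) (t *\<^sub>R w)) (at s)"
        by (rule vector_derivative_diff_chain_within[where S=UNIV, simplified])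
           (use A' in \<open>auto intro: has_derivative_at_withinI\<close>)
      then have "((\<lambda>s. A (x + t *\<^sub>R e s)) has_vector_derivative t *\<^sub>R A' (x + t *\<^sub>R e s) w) (at s)"
        by (simp add: o_def blinfun.scaleR_right)
      from bounded_bilinear.has_vector_derivative[OF bounded_bilinear_inner e this]
      show "((\<lambda>s. e s \<bullet> A (x + t *\<^sub>R e s)) has_vector_derivative F s t) (at s within UNIV)"
        by (simp add: F_def add.commute)
    next
      show "(\<lambda>t. e s \<bullet> A (x + t *\<^sub>R e s)) integrable_on cbox 0 1" for s :: real
        by (intro integrable_continuous continuous_intros cA) auto
    qed (use contF in auto)
    then show ?thesis
      unfolding P_def cbox_interval by (rule has_vector_derivative_within_subset) auto
  qed
  have F_int: "integral {0..1} (F s) = w \<bullet> A (y + s *\<^sub>R w) - integral {0..1} (b s)" for s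
  proof -
    \<comment> \<open>The exterior derivative exchanges the roles of \<open>w\<close> and
      \<open>e s\<close> in the derivative term, after which the sum is the total derivative of
      \<open>t (w . A (x + t e s))\<close>. Replacing \<open>y - x\<close> by \<open>e s\<close> in
      the flux density is free, as they differ by a multiple of \<open>w\<close>.\<close>
    have Fb: "F s t + b s t = w \<bullet> A (x + t *\<^sub>R e s) + t * (w \<bullet> A' (x + t *\<^sub>R e s) (e s))" for t
    proof -
      let ?z = "x + t *\<^sub>R e s"
      have "contract (mag_field A ?z) (y - x) \<bullet> w = A' ?z (y - x) \<bullet> w - A' ?z w \<bullet> (y - x)"
        by (rule contract_mag_field[OF A'])
      also have "\<dots> = A' ?z (e s) \<bullet> w - A' ?z w \<bullet> e s"
        unfolding e_def by (simp add: blinfun.add_right blinfun.diff_right blinfun.scaleR_right inner_simps)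
      finally have eq: "contract (mag_field A ?z) (y - x) \<bullet> w = A' ?z (e s) \<bullet> w - A' ?z w \<bullet> e s" .
      show ?thesis
        unfolding F_def b_def eq by (simp add: algebra_simps inner_commute)
    qed
    have "((\<lambda>t. F s t + b s t) has_integral (1 *\<^sub>R (w \<bullet> A (x + 1 *\<^sub>R e s)) - 0 *\<^sub>R (w \<bullet> A (x + 0 *\<^sub>R e s)))) {0..1}"
    proof (rule fundamental_theorem_of_calculus)
      fix t :: real
      have "((\<lambda>t. x + t *\<^sub>R e s) has_vector_derivative e s) (at t)"
        by (auto intro!: derivative_eq_intros simp: has_vector_derivative_def)
      then have "(A \<circ> (\<lambda>t. x + t *\<^sub>R e s) has_vector_derivative A' (x + t *\<^sub>R e s) (e s)) (at t)"
        by (rule vector_derivative_diff_chain_within[where S=UNIV, simplified])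
           (use A' in \<open>auto intro: has_derivative_at_withinI\<close>)
      then have "((\<lambda>t. A (x + t *\<^sub>R e s)) has_vector_derivative A' (x + t *\<^sub>R e s) (e s)) (at t)"
        by (simp add: o_def)
      from bounded_linear.has_vector_derivative[OF bounded_linear_inner_right this]
      have "((\<lambda>t. w \<bullet> A (x + t *\<^sub>R e s)) has_vector_derivative w \<bullet> A' (x + t *\<^sub>R e s) (e s)) (at t)" .
      from has_vector_derivative_scaleR[OF DERIV_ident this]
      have "((\<lambda>t. t *\<^sub>R (w \<bullet> A (x + t *\<^sub>R e s))) has_vector_derivative F s t + b s t) (at t)"
        unfolding Fb by (simp add: add.commute)
      then show "((\<lambda>t. t *\<^sub>R (w \<bullet> A (x + t *\<^sub>R e s))) has_vector_derivative F s t + b s t) (at t within {0..1})"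
        by (rule has_vector_derivative_at_within)
    qed simp
    then have "integral {0..1} (\<lambda>t. F s t + b s t) = w \<bullet> A (x + e s)"
      by (simp add: integral_unique)
    moreover have "integral {0..1} (\<lambda>t. F s t + b s t) = integral {0..1} (F s) + integral {0..1} (b s)"
    proof (rule Henstock_Kurzweil_Integration.integral_add)
      show "F s integrable_on {0..1}"
        unfolding F_def by (intro integrable_continuous_interval continuous_intros cA cA') auto
      show "b s integrable_on {0..1}"
        unfolding b_def inner_contract
        by (intro integrable_continuous_interval continuous_intros continuous_contract_mag_field[OF C1])
    qed
    moreover have "x + e s = y + s *\<^sub>R w" by (simp add: e_def)
    ultimately show ?thesis by simp
  qed
  have "((\<lambda>s. integral {0..1} (F s)) has_integral (P 1 - P 0)) {0..1}"
    by (rule fundamental_theorem_of_calculus) (auto intro: P_deriv)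
  then have "P 1 - P 0 = integral {0..1} (\<lambda>s. w \<bullet> A (y + s *\<^sub>R w) - integral {0..1} (b s))"
    unfolding F_int by (simp add: integral_unique)
  also have "\<dots> = integral {0..1} (\<lambda>s. w \<bullet> A (y + s *\<^sub>R w)) - integral {0..1} (\<lambda>s. integral {0..1} (b s))"
  proof (rule Henstock_Kurzweil_Integration.integral_diff)
    show "(\<lambda>s. w \<bullet> A (y + s *\<^sub>R w)) integrable_on {0..1}"
      by (intro integrable_continuous_interval continuous_intros cA) auto
    have "continuous_on UNIV (\<lambda>s. integral (cbox 0 1) (b s))"
      by (rule integral_continuous_on_param) (rule continuous_on_subset[OF contb], auto)
    then show "(\<lambda>s. integral {0..1} (b s)) integrable_on {0..1}"
      unfolding cbox_interval by (rule integrable_continuous_interval[OF continuous_on_subset]) auto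
  qed
  finally have "P 1 - P 0 - integral {0..1} (\<lambda>s. w \<bullet> A (y + s *\<^sub>R w)) = - integral {0..1} (\<lambda>s. integral {0..1} (b s))"
    by simp
  moreover have "P 0 = - phase A x y" "P 1 = - phase A x u" "integral {0..1} (\<lambda>s. w \<bullet> A (y + s *\<^sub>R w)) = - phase A y u"
    by (simp_all add: P_def phase_inner e_def w_def)
  ultimately have "phase A x y + phase A y u - phase A x u = - integral {0..1} (\<lambda>s. integral {0..1} (b s))"
    by linarith
  then show ?thesis by (simp only: b_def[abs_def] e_def w_def)
qed

lemma phase_refl [simp]: "phase A x x = 0"
  by (simp add: phase_inner)

text \<open>The degenerate triangle \<open>x, y, x\<close> carries no flux.\<close>

lemma phase_antisym:
  assumes "C1_field A"
  shows "phase A y x = - phase A x y"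
proof -
  have "contract (mag_field A z) (y - x) \<bullet> (x - y) = 0" for z
    using contract_self[of A z "y - x"] by (simp add: inner_diff_right)
  then have "phase A x y + phase A y x - phase A x x = 0"
    unfolding phase_triangle[OF assms] by simp
  then show ?thesis by simp
qed

text \<open>\<open>u - y\<close> and \<open>u - m\<close> differ by half of \<open>y - x\<close>,
  which the antisymmetric form does not see. Measuring \<open>u\<close> from the midpoint turns
  \<open>u - m\<close> into \<open>v / s\<close>, the variable of the centred Gaussian.\<close>

lemma phase_loop:
  fixes A :: "'n::finite vector_field" and x y u :: "real^'n"
  assumes C1: "C1_field A"
  defines "m \<equiv> (1/2) *\<^sub>R (x + y)"
  shows "phase A x y + phase A y u + phase A u x = - integral {0..1} (\<lambda>s. integral {0..1} (\<lambda>t.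
      t * (contract (mag_field A (x + t *\<^sub>R (y - x + s *\<^sub>R (u - y)))) (y - x) \<bullet> (u - m))))"
proof -
  have "contract (mag_field A z) (y - x) \<bullet> (u - y) = contract (mag_field A z) (y - x) \<bullet> (u - m)" for z
  proof -
    have eq: "u - m = (u - y) + (1/2) *\<^sub>R (y - x)"
      by (simp add: m_def algebra_simps flip: scaleR_add_left)
    show ?thesis unfolding eq inner_add_right by (simp add: contract_self)
  qed
  then show ?thesis
    using phase_triangle[OF C1, of x y u] phase_antisym[OF C1, of x u] by simp
qed

lemma antisym_phase_phase:
  fixes A :: "'n::finite vector_field"
  assumes "C1_field A"
  shows "antisym_phase (\<lambda>x y. r * phase A x y)"
proof -
  have "(\<lambda>p. r * phase A (fst p) (snd p)) \<in> borel_measurable borel"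
    by (intro borel_measurable_continuous_onI continuous_on_mult continuous_on_const continuous_phase assms)
  then show ?thesis
    unfolding antisym_phase_def borel_prod case_prod_beta'
    using phase_antisym[OF assms] by (metis mult_minus_right)
qed

text \<open>A constant density \<open>r\<close> gives \<open>r / 2\<close>, the integral of the
  weight \<open>t\<close>. For the error the weight is simply bounded by one.\<close>

lemma loop_integral_bound:
  fixes f :: "real \<Rightarrow> real \<Rightarrow> real"
  assumes "continuous_on UNIV (\<lambda>(s, t). f s t)"
    and "\<And>s t. s \<in> {0..1} \<Longrightarrow> t \<in> {0..1} \<Longrightarrow> \<bar>f s t - r\<bar> \<le> b"
  shows "\<bar>integral {0..1} (\<lambda>s. integral {0..1} (\<lambda>t. t * f s t)) - r / 2\<bar> \<le> b"
proof -
  have b: "0 \<le> b" by (rule order_trans[OF abs_ge_zero assms(2)[of 0 0]]) auto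
  have ft: "continuous_on UNIV (\<lambda>(s, t). t * (f s t - r))"
    using assms(1) unfolding case_prod_beta' by (intro continuous_intros)
  have cf: "continuous_on {0..1} (\<lambda>t. t * (f s t - r))" for s
  proof -
    have "continuous_on {0..1} (\<lambda>t::real. (s, t))" by (intro continuous_intros)
    from continuous_on_compose2[OF ft this] show ?thesis by simp
  qed
  have inner: "integral {0..1} (\<lambda>t. t * f s t) = integral {0..1} (\<lambda>t. t * (f s t - r)) + r / 2" for s
  proof -
    have id: "((\<lambda>t::real. t * r) has_integral (1/2) * r) {0..1}"
    proof -
      have "((\<lambda>t::real. t) has_integral (1\<^sup>2 / 2 - 0\<^sup>2 / 2)) {0..1}"
        by (rule fundamental_theorem_of_calculus)
           (auto intro!: derivative_eq_intros simp flip: has_real_derivative_iff_has_vector_derivative)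
      then show ?thesis using has_integral_mult_left[of "\<lambda>t::real. t" "1/2" "{0..1}" r] by simp
    qed
    have "integral {0..1} (\<lambda>t. t * f s t) = integral {0..1} (\<lambda>t. t * (f s t - r) + t * r)"
      by (simp add: algebra_simps)
    also have "\<dots> = integral {0..1} (\<lambda>t. t * (f s t - r)) + integral {0..1} (\<lambda>t. t * r)"
      by (rule Henstock_Kurzweil_Integration.integral_add[OF integrable_continuous_interval[OF cf] has_integral_integrable[OF id]])
    finally show ?thesis using integral_unique[OF id] by simp
  qed
  have cint: "continuous_on UNIV (\<lambda>s. integral (cbox 0 1) (\<lambda>t. t * (f s t - r)))"
    by (rule integral_continuous_on_param) (rule continuous_on_subset[OF ft], auto)
  have inner_bd: "\<bar>integral {0..1} (\<lambda>t. t * (f s t - r))\<bar> \<le> b" if "s \<in> {0..1}" for s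
  proof -
    have "norm (integral {0..1} (\<lambda>t. t * (f s t - r))) \<le> b * (1 - 0)"
    proof (rule integral_bound)
      show "continuous_on {0..1} (\<lambda>t. t * (f s t - r))"
        by (rule cf)
      show "norm (t * (f s t - r)) \<le> b" if "t \<in> {0..1}" for t
      proof -
        have "\<bar>t\<bar> * \<bar>f s t - r\<bar> \<le> 1 * b"
          using assms(2)[OF \<open>s \<in> {0..1}\<close> that] that by (intro mult_mono) auto
        then show ?thesis by (simp add: abs_mult)
      qed
    qed simp
    then show ?thesis by simp
  qed
  have "integral {0..1} (\<lambda>s. integral {0..1} (\<lambda>t. t * f s t)) =
      integral {0..1} (\<lambda>s. integral {0..1} (\<lambda>t. t * (f s t - r)) + r / 2)"
    unfolding inner ..
  also have "\<dots> = integral {0..1} (\<lambda>s. integral {0..1} (\<lambda>t. t * (f s t - r))) + integral {0..1} (\<lambda>s::real. r / 2)"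
    using cint unfolding cbox_interval
    by (intro Henstock_Kurzweil_Integration.integral_add integrable_continuous_interval) (auto intro: continuous_on_subset)
  also have "integral {0..1} (\<lambda>s::real. r / 2) = r / 2" by simp
  finally have "integral {0..1} (\<lambda>s. integral {0..1} (\<lambda>t. t * f s t)) - r / 2 =
      integral {0..1} (\<lambda>s. integral {0..1} (\<lambda>t. t * (f s t - r)))"
    by simp
  moreover have "norm (integral {0..1} (\<lambda>s. integral {0..1} (\<lambda>t. t * (f s t - r)))) \<le> b * (1 - 0)"
    using cint inner_bd unfolding cbox_interval
    by (intro integral_bound) (auto intro: continuous_on_subset)
  ultimately show ?thesis by simp
qed

text \<open>The flux density is frozen at a reference value \<open>r\<close>: zero when the field is
  merely bounded, the density at the midpoint when the field varies slowly.\<close>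

lemma phase_loop_approx:
  fixes A :: "'n::finite vector_field" and x y u :: "real^'n"
  assumes C1: "C1_field A"
  defines "m \<equiv> (1/2) *\<^sub>R (x + y)"
  assumes est: "\<And>s t. s \<in> {0..1} \<Longrightarrow> t \<in> {0..1} \<Longrightarrow>
    \<bar>contract (mag_field A (x + t *\<^sub>R (y - x + s *\<^sub>R (u - y)))) (y - x) \<bullet> (u - m) - r\<bar> \<le> b"
  shows "\<bar>phase A x y + phase A y u + phase A u x + r / 2\<bar> \<le> b"
proof -
  let ?f = "\<lambda>s t. contract (mag_field A (x + t *\<^sub>R (y - x + s *\<^sub>R (u - y)))) (y - x) \<bullet> (u - m)"
  have "continuous_on UNIV (\<lambda>(s, t). ?f s t)"
    unfolding case_prod_beta' inner_contract
    by (intro continuous_intros continuous_contract_mag_field[OF C1])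
  then have "\<bar>integral {0..1} (\<lambda>s. integral {0..1} (\<lambda>t. t * ?f s t)) - r / 2\<bar> \<le> b"
    by (rule loop_integral_bound) (rule est)
  then show ?thesis unfolding phase_loop[OF C1, of x y u, folded m_def] by linarith
qed

text \<open>In the transverse gauge the circulation along rays from the origin vanishes, so only the
  side from \<open>x\<close> to \<open>y\<close> of the triangle \<open>0, x, y\<close> contributes
  to Stokes' theorem.\<close>

lemma phase_transverse:
  fixes A :: "'n::finite vector_field"
  assumes C1: "C1_field A" and tr: "\<And>x. x \<bullet> A x = 0"
  shows "phase A x y = - flux (mag_field A) 0 x y"
proof -
  have ray: "phase A 0 z = 0" for z
  proof -
    have "z \<bullet> A (t *\<^sub>R z) = 0" if "t \<noteq> 0" for t
      using tr[of "t *\<^sub>R z"] that by simp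
    then have "integral {0..1} (\<lambda>t. z \<bullet> A (t *\<^sub>R z)) = integral {0..1} (\<lambda>t::real. 0)"
      by (intro integral_spike[of "{0}"]) auto
    then show ?thesis by (simp add: phase_inner)
  qed
  define w where "w = y - x"
  define h where "h j k s t = t * mag_field A (t *\<^sub>R x + (t * s) *\<^sub>R w) j k" for j k s t
  note cB = continuous_contract_mag_field[OF C1]
  have ch: "continuous_on S (\<lambda>p. h j k (a p) (b p))" if "continuous_on S a" "continuous_on S b" for S :: "'z::topological_space set" and a b j k
    unfolding h_def using that by (intro continuous_intros cB)
  have inner_eq: "integral {0..1} (\<lambda>s. integral {0..1} (h j k s)) =
      integral {0..1} (\<lambda>t. integral {0..t} (\<lambda>s. mag_field A (t *\<^sub>R x + s *\<^sub>R w) j k))" for j k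
  proof -
    have swap: "integral (cbox 0 1) (\<lambda>s. integral (cbox 0 1) (h j k s)) =
        integral (cbox 0 1) (\<lambda>t. integral (cbox 0 1) (\<lambda>s. h j k s t))"
      by (rule integral_swap_continuous) (simp add: case_prod_beta' ch continuous_intros)
    \<comment> \<open>The substitution of \<open>t s\<close> by \<open>s\<close> absorbs the weight
      \<open>t\<close> and turns the unit square into the triangle over which \<open>flux\<close>
      integrates.\<close>
    have "integral {0..1} (\<lambda>s. h j k s t) = integral {0..t} (\<lambda>s. mag_field A (t *\<^sub>R x + s *\<^sub>R w) j k)"
      if t: "t \<in> {0..1}" for t
    proof -
      have "((\<lambda>s. t *\<^sub>R mag_field A (t *\<^sub>R x + (t * s) *\<^sub>R w) j k) has_integral
          integral {t * 0..t * 1} (\<lambda>s. mag_field A (t *\<^sub>R x + s *\<^sub>R w) j k)) {0..1}"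
      proof (rule has_integral_substitution[where c=0 and d=1])
        show "(*) t ` {0..1} \<subseteq> {0..1}" using t by (auto simp: mult_le_one)
        show "continuous_on {0..1} (\<lambda>s. mag_field A (t *\<^sub>R x + s *\<^sub>R w) j k)"
          by (intro cB continuous_intros)
        show "((*) t has_field_derivative t) (at s within {0..1})" for s
          by (auto intro!: derivative_eq_intros)
      qed (use t in auto)
      from integral_unique[OF this] show ?thesis
        unfolding h_def by (simp only: real_scaleR_def mult_1_right mult_zero_right)
    qed
    then have "integral {0..1} (\<lambda>t. integral {0..1} (\<lambda>s. h j k s t)) =
        integral {0..1} (\<lambda>t. integral {0..t} (\<lambda>s. mag_field A (t *\<^sub>R x + s *\<^sub>R w) j k))"
      by (rule integral_cong)
    then show ?thesis using swap by simp
  qed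
  have "phase A x y = - integral {0..1} (\<lambda>s. integral {0..1} (\<lambda>t. \<Sum>j\<in>UNIV. \<Sum>k\<in>UNIV. x $ j * w $ k * h j k s t))"
    using phase_triangle[OF C1, of 0 x y] unfolding ray
    by (simp add: inner_contract h_def w_def sum_distrib_left mult_ac scaleR_add_right)
  also have "integral {0..1} (\<lambda>s. integral {0..1} (\<lambda>t. \<Sum>j\<in>UNIV. \<Sum>k\<in>UNIV. x $ j * w $ k * h j k s t)) =
      integral {0..1} (\<lambda>s. \<Sum>j\<in>UNIV. \<Sum>k\<in>UNIV. x $ j * w $ k * integral {0..1} (h j k s))"
  proof -
    have "integral {0..1} (\<lambda>t. \<Sum>j\<in>UNIV. \<Sum>k\<in>UNIV. x $ j * w $ k * h j k s t) =
        (\<Sum>j\<in>UNIV. \<Sum>k\<in>UNIV. x $ j * w $ k * integral {0..1} (h j k s))" for s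
    proof -
      have i: "(\<lambda>t. x $ j * w $ k * h j k s t) integrable_on {0..1}" for j k
        by (intro integrable_continuous_interval continuous_intros ch)
      show ?thesis
        by (simp add: Henstock_Kurzweil_Integration.integral_sum i integrable_sum)
    qed
    then show ?thesis by simp
  qed
  also have "\<dots> = (\<Sum>j\<in>UNIV. \<Sum>k\<in>UNIV. x $ j * w $ k * integral {0..1} (\<lambda>s. integral {0..1} (h j k s)))"
  proof -
    have "continuous_on UNIV (\<lambda>s. integral (cbox 0 1) (h j k s))" for j k
      by (rule integral_continuous_on_param) (simp add: case_prod_beta' ch continuous_intros)
    then have i: "(\<lambda>s. x $ j * w $ k * integral {0..1} (h j k s)) integrable_on {0..1}" for j k
      unfolding cbox_interval
      by (intro integrable_continuous_interval continuous_intros) (auto intro: continuous_on_subset)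
    show ?thesis
      by (simp add: Henstock_Kurzweil_Integration.integral_sum i integrable_sum)
  qed
  also have "(\<Sum>j\<in>UNIV. \<Sum>k\<in>UNIV. x $ j * w $ k * integral {0..1} (\<lambda>s. integral {0..1} (h j k s))) = flux (mag_field A) 0 x y"
    unfolding inner_eq by (simp add: flux_def w_def)
  finally show ?thesis .
qed

section \<open>Gaussian averages of phase factors\<close>

text \<open>All errors below grow at most quadratically in \<open>v\<close>, so this one moment
  controls them. The type argument records that it depends only on the dimension.\<close>

definition gauss_moment :: "'a::euclidean_space itself \<Rightarrow> real" where
  "gauss_moment _ = (LINT v::'a|lborel. gauss v * (1 + (norm v)\<^sup>2))"

lemma gauss_mass_le_moment: "(LINT v::'a::euclidean_space|lborel. gauss v) \<le> gauss_moment TYPE('a)"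
  unfolding gauss_moment_def
  by (intro integral_mono integrable_gauss integrable_gauss_moment) (simp add: gauss_def)

lemma gauss_average_bound:
  fixes f :: "'a::euclidean_space \<Rightarrow> complex"
  assumes [measurable]: "f \<in> borel_measurable borel"
    and f: "\<And>v. cmod (f v) \<le> C * (1 + (norm v)\<^sup>2)"
  shows "integrable lborel (\<lambda>v. gauss v *\<^sub>R f v)"
    and "cmod (LINT v|lborel. gauss v *\<^sub>R f v) \<le> C * gauss_moment TYPE('a)"
proof -
  have g: "integrable lborel (\<lambda>v::'a. C * (gauss v * (1 + (norm v)\<^sup>2)))"
    by (intro integrable_mult_right integrable_gauss_moment)
  have le: "norm (gauss v *\<^sub>R f v) \<le> C * (gauss v * (1 + (norm v)\<^sup>2))" for v
    using mult_left_mono[OF f[of v] less_imp_le[OF gauss_pos[of v]]] gauss_pos[of v]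
    by (simp add: mult_ac)
  show i: "integrable lborel (\<lambda>v. gauss v *\<^sub>R f v)"
  proof (rule Bochner_Integration.integrable_bound[OF g])
    show "AE v in lborel. norm (gauss v *\<^sub>R f v) \<le> norm (C * (gauss v * (1 + (norm v)\<^sup>2)))"
      using le by (auto intro: order_trans[OF _ abs_ge_self])
  qed measurable
  have "cmod (LINT v|lborel. gauss v *\<^sub>R f v) \<le> (LINT v::'a|lborel. C * (gauss v * (1 + (norm v)\<^sup>2)))"
    using i g le by (intro Bochner_Integration.integral_norm_bound_integral) auto
  then show "cmod (LINT v|lborel. gauss v *\<^sub>R f v) \<le> C * gauss_moment TYPE('a)"
    by (simp add: gauss_moment_def)
qed

lemma gauss_odd:
  fixes l :: "'a::euclidean_space"
  shows "(LINT v|lborel. gauss v *\<^sub>R (\<i> * complex_of_real (l \<bullet> v))) = 0"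
proof -
  let ?f = "\<lambda>v. gauss v *\<^sub>R (\<i> * complex_of_real (l \<bullet> v))"
  have neg: "distr lborel borel (\<lambda>x::'a. 0 + (-1) *\<^sub>R x) = lborel"
    using lborel_affine[of "-1" "0::'a"] by (simp add: density_1)
  have "(LINT v|lborel. ?f v) = (LINT v|distr lborel borel (\<lambda>x::'a. 0 + (-1) *\<^sub>R x). ?f v)"
    unfolding neg ..
  also have "\<dots> = (LINT v|lborel. ?f (0 + (-1) *\<^sub>R v))"
    by (rule integral_distr) measurable
  also have "\<dots> = - (LINT v|lborel. ?f v)"
    by (simp add: gauss_def)
  finally show ?thesis by simp
qed

lemma one_minus_cos_le: "1 - cos t \<le> t\<^sup>2 / 2" for t :: real
proof -
  have "1 - cos t = 2 * (sin (t / 2))\<^sup>2"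
    using cos_double_sin[of "t / 2"] by simp
  also have "\<dots> \<le> 2 * (t / 2)\<^sup>2"
    using abs_sin_x_le_abs_x[of "t / 2"] unfolding abs_le_square_iff by simp
  finally show ?thesis by (simp add: power2_eq_square)
qed

text \<open>Interpolation between the quadratic and the trivial bound: for \<open>t <= 1\<close> the
  square is below the power, beyond that the power exceeds one. Here a second-order error is
  converted into the order of decay that the kernel has.\<close>

lemma min_square_le_powr:
  fixes t \<alpha> :: real
  assumes "0 \<le> t" "0 < \<alpha>" "\<alpha> \<le> 2" "r \<le> t\<^sup>2 / 2" "r \<le> 2"
  shows "r \<le> 2 * t powr \<alpha>"
proof (cases "t \<le> 1")
  case True
  show ?thesis
  proof (cases "t = 0")
    case False
    then have t: "0 < t" using assms by simp
    have "t\<^sup>2 = t powr 2" using t by simp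
    also have "\<dots> \<le> t powr \<alpha>"
      using True t assms by (intro powr_mono') auto
    finally have "t\<^sup>2 / 2 \<le> 2 * t powr \<alpha>" using powr_ge_zero[of t \<alpha>] by linarith
    then show ?thesis using assms by linarith
  qed (use assms in auto)
next
  case False
  then have "1 \<le> t powr \<alpha>" using assms by (intro ge_one_powr_ge_zero) auto
  then show ?thesis using assms by linarith
qed

lemma powr_le_one_plus_square:
  fixes t \<alpha> :: real
  assumes "0 \<le> t" "0 \<le> \<alpha>" "\<alpha> \<le> 2"
  shows "t powr \<alpha> \<le> 1 + t\<^sup>2"
proof (cases "t \<le> 1")
  case True
  have "t powr \<alpha> \<le> 1" using True assms by (intro powr_le1) auto
  then show ?thesis by (simp add: add_increasing2)
next
  case False
  then have "t powr \<alpha> \<le> t powr 2" using assms by (intro powr_mono) auto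
  also have "\<dots> = t\<^sup>2" using False by simp
  finally show ?thesis by simp
qed

lemma norm_le_japanese_bracket: "norm d \<le> japanese_bracket d" "1 \<le> japanese_bracket d"
  by (auto simp: japanese_bracket_def intro: real_le_rsqrt)

lemma gauss_weight_bounds:
  "0 < exp (- (s\<^sup>2 * r\<^sup>2 / 2))" "exp (- (s\<^sup>2 * r\<^sup>2 / 2)) \<le> 1"
  "1 - exp (- (s\<^sup>2 * r\<^sup>2 / 2)) \<le> (s * r)\<^sup>2 / 2" for s r :: real
  using exp_ge_add_one_self[of "- (s\<^sup>2 * r\<^sup>2 / 2)"] by (auto simp: power_mult_distrib)

section \<open>Averages of loop phases\<close>

lemma avg_phase_measurable:
  assumes q: "antisym_phase q"
  shows "(\<lambda>v. cis (q x y + q y (m + r *\<^sub>R v) + q (m + r *\<^sub>R v) x)) \<in> borel_measurable borel"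
proof -
  note [measurable] = antisym_phase_measurable[OF q]
  show ?thesis unfolding cis_conv_exp by measurable
qed

lemma antisym_phase_uminus: "antisym_phase q \<Longrightarrow> antisym_phase (\<lambda>x y. - q x y)"
proof -
  assume q: "antisym_phase q"
  note [measurable] = antisym_phase_measurable[OF q]
  have "(\<lambda>z. - q (fst z) (snd z)) \<in> borel_measurable (borel \<Otimes>\<^sub>M borel)"
    by measurable
  moreover have "- q y x = - (- q x y)" for x y
    using antisym_phaseD(2)[OF q, of y x] by linarith
  ultimately show ?thesis
    unfolding antisym_phase_def case_prod_beta' by blast
qed

text \<open>For opposite phases the first-order terms cancel: the average of \<open>cis t\<close> and \<open>cis (- t)\<close>
  is \<open>cos t\<close>.\<close>

lemma avg_phase_pair:
  fixes x y :: "'a::euclidean_space"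
  assumes q: "antisym_phase q" and s: "0 < s" and "0 \<le> D" and \<alpha>: "0 < \<alpha>" "\<alpha> \<le> 2"
    and bd: "\<And>x y v. \<bar>q x y + q y ((1/2) *\<^sub>R (x + y) + (1/s) *\<^sub>R v) + q ((1/2) *\<^sub>R (x + y) + (1/s) *\<^sub>R v) x\<bar>
      \<le> D * s * norm (x - y) * norm v"
  shows "cmod (exp (- (s\<^sup>2 * (norm (x - y))\<^sup>2 / 2)) *\<^sub>R
      ((1/2) *\<^sub>R (avg_phase s q x y + avg_phase s (\<lambda>x y. - q x y) x y)) - complex_of_real (LINT v::'a|lborel. gauss v))
    \<le> ((2 * (2 + D\<^sup>2)) * gauss_moment TYPE('a) * s powr \<alpha>) * \<bar>japanese_bracket (x - y) powr \<alpha>\<bar>"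
proof -
  define m where "m = (1/2) *\<^sub>R (x + y)"
  define \<theta> where "\<theta> v = q x y + q y (m + (1/s) *\<^sub>R v) + q (m + (1/s) *\<^sub>R v) x" for v
  define d where "d = norm (x - y)"
  define e where "e = exp (- (s\<^sup>2 * d\<^sup>2 / 2))"
  have d: "0 \<le> d" by (simp add: d_def)
  have e: "0 < e" "e \<le> 1" "1 - e \<le> (s * d)\<^sup>2 / 2"
    unfolding e_def using gauss_weight_bounds by auto
  have cis_meas [measurable]: "(\<lambda>v. cis (\<theta> v)) \<in> borel_measurable borel"
    unfolding \<theta>_def by (rule avg_phase_measurable[OF q])
  have cis_meas' [measurable]: "(\<lambda>v. cis (- \<theta> v)) \<in> borel_measurable borel"
    using avg_phase_measurable[OF antisym_phase_uminus[OF q], of x y m "1/s"]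
    unfolding \<theta>_def by (simp add: algebra_simps)
  have int: "integrable lborel (\<lambda>v. gauss v *\<^sub>R cis (\<theta> v))" "integrable lborel (\<lambda>v. gauss v *\<^sub>R cis (- \<theta> v))"
    by (rule gauss_average_bound(1)[where C=1]; simp)+
  have av: "avg_phase s q x y = (LINT v|lborel. gauss v *\<^sub>R cis (\<theta> v))"
    "avg_phase s (\<lambda>x y. - q x y) x y = (LINT v|lborel. gauss v *\<^sub>R cis (- \<theta> v))"
    unfolding avg_phase_def \<theta>_def m_def by (simp_all add: algebra_simps)
  define f where "f v = e *\<^sub>R ((1/2) *\<^sub>R (cis (\<theta> v) + cis (- \<theta> v))) - 1" for v
  have f_meas: "f \<in> borel_measurable borel" unfolding f_def by measurable
  have f_cos: "f v = complex_of_real (e * cos (\<theta> v) - 1)" for v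
    by (simp add: f_def complex_eq_iff)
  have gint: "integrable lborel (\<lambda>v::'a. gauss v *\<^sub>R (1::complex))"
    by (rule gauss_average_bound(1)[where C=1]; simp)
  have g1: "(LINT v::'a|lborel. gauss v *\<^sub>R (1::complex)) = complex_of_real (LINT v::'a|lborel. gauss v)"
    by (simp add: scaleR_conv_of_real)
  have "(LINT v|lborel. gauss v *\<^sub>R f v) =
      (LINT v|lborel. (e / 2) *\<^sub>R (gauss v *\<^sub>R cis (\<theta> v)) + (e / 2) *\<^sub>R (gauss v *\<^sub>R cis (- \<theta> v)) - gauss v *\<^sub>R (1::complex))"
    by (intro Bochner_Integration.integral_cong) (auto simp: f_def algebra_simps)
  also have "\<dots> = e *\<^sub>R ((1/2) *\<^sub>R (avg_phase s q x y + avg_phase s (\<lambda>x y. - q x y) x y)) - complex_of_real (LINT v::'a|lborel. gauss v)"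
    using int gint unfolding av g1[symmetric] by (simp add: scaleR_add_right del: scaleR_scaleR) simp
  finally have eq: "(LINT v|lborel. gauss v *\<^sub>R f v) = \<dots>" .
  have bound: "cmod (f v) \<le> (2 * (2 + D\<^sup>2) * ((s * d) powr \<alpha>)) * (1 + (norm v)\<^sup>2)" for v
  proof -
    have "cmod (f v) = \<bar>e * cos (\<theta> v) - 1\<bar>" by (simp only: f_cos norm_of_real)
    \<comment> \<open>Loss from the localisation plus loss from the phase; both are nonnegative, at
      most 2 and quadratically small, so the same interpolation serves them.\<close>
    also have "\<dots> = (1 - e) + e * (1 - cos (\<theta> v))"
    proof -
      have "e * cos (\<theta> v) \<le> e * 1" using e by (intro mult_left_mono) auto
      then have "e * cos (\<theta> v) - 1 \<le> 0" using e by linarith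
      then show ?thesis by (simp add: abs_of_nonpos algebra_simps)
    qed
    also have "\<dots> \<le> (1 - e) + 1 * (1 - cos (\<theta> v))"
      using e by (intro add_left_mono mult_right_mono) auto
    also have "1 - e \<le> 2 * (s * d) powr \<alpha>"
      using e s d by (intro min_square_le_powr \<alpha>) auto
    also have "1 * (1 - cos (\<theta> v)) \<le> 2 * \<bar>\<theta> v\<bar> powr \<alpha>"
    proof -
      have "1 - cos (\<theta> v) \<le> 2" using cos_ge_minus_one[of "\<theta> v"] by linarith
      then show ?thesis
        using one_minus_cos_le[of "\<theta> v"] by (intro min_square_le_powr \<alpha>) auto
    qed
    also have "\<bar>\<theta> v\<bar> powr \<alpha> \<le> ((s * d) * (D * norm v)) powr \<alpha>"
      using bd[of x y v] \<alpha> by (intro powr_mono2) (auto simp: \<theta>_def m_def d_def mult_ac)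
    also have "\<dots> = (s * d) powr \<alpha> * (D * norm v) powr \<alpha>"
      using s d \<open>0 \<le> D\<close> by (simp add: powr_mult)
    \<comment> \<open>The power of \<open>s d\<close> must be kept, since the kernel can pay for no
      more; the power of \<open>D |v|\<close> may be raised to a square, since the Gaussian moment
      pays for it.\<close>
    also have "\<dots> \<le> (s * d) powr \<alpha> * (1 + (D * norm v)\<^sup>2)"
      using \<alpha> \<open>0 \<le> D\<close> by (intro mult_left_mono powr_le_one_plus_square) auto
    finally have "cmod (f v) \<le> (s * d) powr \<alpha> * (2 * (2 + (D * norm v)\<^sup>2))"
      by (simp add: algebra_simps)
    also have "\<dots> \<le> (s * d) powr \<alpha> * (2 * ((2 + D\<^sup>2) * (1 + (norm v)\<^sup>2)))"
      by (intro mult_left_mono) (auto simp: algebra_simps power_mult_distrib)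
    finally show ?thesis by (simp only: mult_ac)
  qed
  have "cmod (LINT v|lborel. gauss v *\<^sub>R f v) \<le> (2 * (2 + D\<^sup>2) * ((s * d) powr \<alpha>)) * gauss_moment TYPE('a)"
    by (rule gauss_average_bound(2)[OF f_meas bound])
  also have "\<dots> \<le> (2 * (2 + D\<^sup>2) * (s powr \<alpha> * japanese_bracket (x - y) powr \<alpha>)) * gauss_moment TYPE('a)"
  proof (intro mult_right_mono mult_left_mono)
    have "d powr \<alpha> \<le> japanese_bracket (x - y) powr \<alpha>"
      using \<alpha> unfolding d_def by (intro powr_mono2 norm_le_japanese_bracket) auto
    then show "(s * d) powr \<alpha> \<le> s powr \<alpha> * japanese_bracket (x - y) powr \<alpha>"
      using s d by (simp add: powr_mult mult_left_mono)
    show "0 \<le> gauss_moment TYPE('a)"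
      using gauss_mass_pos[where 'a='a] gauss_mass_le_moment[where 'a='a] by linarith
  qed auto
  finally show ?thesis unfolding eq e_def d_def by (simp only: mult_ac abs_of_nonneg powr_ge_zero)
qed

lemma cis_approx:
  "cmod (cis a - cis b) \<le> \<bar>a - b\<bar>" "cmod (cis a - 1 - \<i> * complex_of_real a) \<le> a\<^sup>2 / 2"
proof -
  have "cis a - cis b = cis b * (cis (a - b) - 1)"
    by (simp add: algebra_simps cis_mult)
  then have "cmod (cis a - cis b) = cmod (cis (a - b) - 1)"
    by (simp add: norm_mult)
  then show "cmod (cis a - cis b) \<le> \<bar>a - b\<bar>"
    using iexp_approx1[of "a - b" 0] by (simp add: cis_conv_exp)
  show "cmod (cis a - 1 - \<i> * complex_of_real a) \<le> a\<^sup>2 / 2"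
    using iexp_approx1[of a 1] by (simp add: cis_conv_exp algebra_simps power2_eq_square)
qed

text \<open>A first-order term that is linear in \<open>v\<close> is averaged out by the symmetry of the Gaussian.\<close>

lemma avg_phase_linear:
  fixes x y l :: "'a::euclidean_space"
  assumes q: "antisym_phase q" and s: "0 < s" and "0 \<le> D"
    and l: "norm l \<le> D * s * norm (x - y)"
    and bd: "\<And>v. \<bar>q x y + q y ((1/2) *\<^sub>R (x + y) + (1/s) *\<^sub>R v) + q ((1/2) *\<^sub>R (x + y) + (1/s) *\<^sub>R v) x - l \<bullet> v\<bar>
      \<le> D * s\<^sup>2 * (1 + (norm (x - y))\<^sup>2) * (1 + (norm v)\<^sup>2)"
  shows "cmod (exp (- (s\<^sup>2 * (norm (x - y))\<^sup>2 / 2)) *\<^sub>R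
      ((1/2) *\<^sub>R (avg_phase s q x y + avg_phase s q x y)) - complex_of_real (LINT v::'a|lborel. gauss v))
    \<le> ((D + D\<^sup>2 / 2 + 1 / 2) * gauss_moment TYPE('a) * s\<^sup>2) * \<bar>japanese_bracket (x - y) powr 2\<bar>"
proof -
  define m where "m = (1/2) *\<^sub>R (x + y)"
  define \<theta> where "\<theta> v = q x y + q y (m + (1/s) *\<^sub>R v) + q (m + (1/s) *\<^sub>R v) x" for v
  define d where "d = norm (x - y)"
  define e where "e = exp (- (s\<^sup>2 * d\<^sup>2 / 2))"
  have d: "0 \<le> d" by (simp add: d_def)
  have e: "0 < e" "e \<le> 1" "1 - e \<le> (s * d)\<^sup>2 / 2"
    unfolding e_def using gauss_weight_bounds by auto
  have cis_meas [measurable]: "(\<lambda>v. cis (\<theta> v)) \<in> borel_measurable borel"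
    unfolding \<theta>_def by (rule avg_phase_measurable[OF q])
  have int: "integrable lborel (\<lambda>v. gauss v *\<^sub>R cis (\<theta> v))"
    by (rule gauss_average_bound(1)[where C=1]; simp)
  have lv: "\<bar>l \<bullet> v\<bar> \<le> norm l * (1 + (norm v)\<^sup>2)" for v
  proof -
    have "norm v \<le> 1 + (norm v)\<^sup>2"
      using powr_le_one_plus_square[of "norm v" 1] by simp
    then show ?thesis
      by (intro order_trans[OF Cauchy_Schwarz_ineq2 mult_left_mono]) auto
  qed
  have lint: "integrable lborel (\<lambda>v. gauss v *\<^sub>R (\<i> * complex_of_real (l \<bullet> v)))"
    by (rule gauss_average_bound(1)[where C="norm l"]) (use lv in \<open>auto simp: norm_mult\<close>)
  have gint: "integrable lborel (\<lambda>v::'a. gauss v *\<^sub>R (1::complex))"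
    by (rule gauss_average_bound(1)[where C=1]; simp)
  have g1: "(LINT v::'a|lborel. gauss v *\<^sub>R (1::complex)) = complex_of_real (LINT v::'a|lborel. gauss v)"
    by (simp add: scaleR_conv_of_real)
  \<comment> \<open>The linear term is subtracted inside the average, where it contributes
    zero.\<close>
  define f where "f v = e *\<^sub>R (cis (\<theta> v) - \<i> * complex_of_real (l \<bullet> v)) - 1" for v
  have f_meas: "f \<in> borel_measurable borel" unfolding f_def by measurable
  have "(LINT v|lborel. gauss v *\<^sub>R f v) =
      (LINT v|lborel. e *\<^sub>R (gauss v *\<^sub>R cis (\<theta> v)) - e *\<^sub>R (gauss v *\<^sub>R (\<i> * complex_of_real (l \<bullet> v))) - gauss v *\<^sub>R (1::complex))"
    by (intro Bochner_Integration.integral_cong) (auto simp: f_def scaleR_diff_right mult_ac)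
  also have "\<dots> = e *\<^sub>R (LINT v|lborel. gauss v *\<^sub>R cis (\<theta> v)) - complex_of_real (LINT v::'a|lborel. gauss v)"
    using int gint lint gauss_odd[of l] unfolding g1[symmetric] by (simp del: scaleR_scaleR)
  also have "(LINT v|lborel. gauss v *\<^sub>R cis (\<theta> v)) = (1/2) *\<^sub>R (avg_phase s q x y + avg_phase s q x y)"
    unfolding avg_phase_def \<theta>_def m_def by (simp flip: scaleR_2)
  finally have eq: "(LINT v|lborel. gauss v *\<^sub>R f v) = e *\<^sub>R ((1/2) *\<^sub>R (avg_phase s q x y + avg_phase s q x y)) - complex_of_real (LINT v::'a|lborel. gauss v)" .
  have bound: "cmod (f v) \<le> ((D + D\<^sup>2 / 2 + 1 / 2) * (s\<^sup>2 * (1 + d\<^sup>2))) * (1 + (norm v)\<^sup>2)" for v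
  proof -
    let ?Y = "(s\<^sup>2 * (1 + d\<^sup>2)) * (1 + (norm v)\<^sup>2)"
    have "f v = e *\<^sub>R ((cis (\<theta> v) - cis (l \<bullet> v)) + (cis (l \<bullet> v) - 1 - \<i> * complex_of_real (l \<bullet> v))) - complex_of_real (1 - e)"
      by (simp add: f_def scaleR_conv_of_real algebra_simps)
    then have "cmod (f v) \<le> e * cmod ((cis (\<theta> v) - cis (l \<bullet> v)) + (cis (l \<bullet> v) - 1 - \<i> * complex_of_real (l \<bullet> v))) + (1 - e)"
      using norm_triangle_ineq4 e by (metis abs_of_nonneg diff_ge_0_iff_ge less_imp_le norm_of_real norm_scaleR)
    \<comment> \<open>Three second-order errors: the deviation of the loop phase from its linear
      part, the Taylor remainder of the exponential, and the loss from the localisation. They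
      contribute \<open>D\<close>, \<open>D^2 / 2\<close> and \<open>1 / 2\<close> to the
      constant.\<close>
    also have "\<dots> \<le> 1 * (\<bar>\<theta> v - l \<bullet> v\<bar> + (l \<bullet> v)\<^sup>2 / 2) + (s * d)\<^sup>2 / 2"
      using e by (intro add_mono mult_mono order_trans[OF norm_triangle_ineq add_mono] cis_approx) auto
    also have "\<bar>\<theta> v - l \<bullet> v\<bar> \<le> D * ?Y"
      using bd[of v] by (simp add: \<theta>_def m_def d_def mult_ac)
    also have "(l \<bullet> v)\<^sup>2 / 2 \<le> D\<^sup>2 / 2 * ?Y"
    proof -
      have "\<bar>l \<bullet> v\<bar> \<le> (D * s * d) * norm v"
        using l by (intro order_trans[OF Cauchy_Schwarz_ineq2 mult_right_mono]) (auto simp: d_def)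
      then have "\<bar>l \<bullet> v\<bar>\<^sup>2 \<le> ((D * s * d) * norm v)\<^sup>2"
        by (intro power_mono) auto
      also have "\<dots> = D\<^sup>2 * (s\<^sup>2 * (d\<^sup>2 * (norm v)\<^sup>2))" by (simp add: power_mult_distrib)
      also have "\<dots> \<le> D\<^sup>2 * (s\<^sup>2 * ((1 + d\<^sup>2) * (1 + (norm v)\<^sup>2)))"
        by (intro mult_left_mono mult_mono) auto
      finally show ?thesis by (simp add: mult_ac)
    qed
    also have "(s * d)\<^sup>2 / 2 \<le> 1 / 2 * ?Y"
    proof -
      have "d\<^sup>2 * 1 \<le> (1 + d\<^sup>2) * (1 + (norm v)\<^sup>2)" by (intro mult_mono) auto
      from mult_left_mono[OF this, of "s\<^sup>2"] show ?thesis by (simp add: power_mult_distrib mult_ac)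
    qed
    finally show ?thesis by (simp add: algebra_simps add_divide_distrib)
  qed
  have jb: "japanese_bracket (x - y) powr 2 = 1 + d\<^sup>2"
    using norm_le_japanese_bracket(2)[of "x - y"] by (simp add: japanese_bracket_def d_def add_nonneg_nonneg)
  have "cmod (LINT v|lborel. gauss v *\<^sub>R f v) \<le> ((D + D\<^sup>2 / 2 + 1 / 2) * (s\<^sup>2 * (1 + d\<^sup>2))) * gauss_moment TYPE('a)"
    by (rule gauss_average_bound(2)[OF f_meas bound])
  then show ?thesis unfolding eq jb e_def d_def by (simp add: mult_ac)
qed

section \<open>Regularity of the spectral edge\<close>

lemma kernel_norm_mono:
  assumes "\<beta> \<le> \<alpha>"
  shows "kernel_norm \<beta> K \<le> kernel_norm \<alpha> K"
proof -
  have le: "ennreal (cmod (K x y) * japanese_bracket (x - y) powr \<beta>) \<le> ennreal (cmod (K x y) * japanese_bracket (x - y) powr \<alpha>)" for x y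
    using norm_le_japanese_bracket(2)[of "x - y"] assms
    by (intro ennreal_leI mult_left_mono powr_mono) auto
  show ?thesis
    unfolding kernel_norm_def by (intro max.mono SUP_mono' nn_integral_mono le)
qed

lemma decay_class_mono: "(c, K) \<in> decay_class \<alpha> \<Longrightarrow> \<beta> \<le> \<alpha> \<Longrightarrow> (c, K) \<in> decay_class \<beta>"
  using order_le_less_trans[OF kernel_norm_mono] by (auto simp: decay_class_def)

text \<open>The weighted kernel receives the error estimates and the plain one defines the
  operators; one \<open>B\<close> serves both since the bracket is at least one.\<close>

lemma decay_class_schur:
  assumes K: "(c, K) \<in> decay_class \<alpha>" and "0 \<le> \<alpha>"
  defines "B \<equiv> enn2real (kernel_norm \<alpha> K)"
  shows "schur_bound B (\<lambda>x y. K x y * complex_of_real (japanese_bracket (x - y) powr \<alpha>))"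
    and "schur_bound B K"
proof -
  have K_meas: "(\<lambda>(x, y). K x y) \<in> borel_measurable (borel \<Otimes>\<^sub>M borel)" and fin: "kernel_norm \<alpha> K < \<infinity>"
    using K by (auto simp: decay_class_def)
  have B: "ennreal B = kernel_norm \<alpha> K"
    using fin by (simp add: B_def)
  note [measurable] = measurable_uncurry_comp[OF K_meas]
  have eq: "cmod (K x y * complex_of_real (japanese_bracket (x - y) powr \<alpha>)) = cmod (K x y) * japanese_bracket (x - y) powr \<alpha>" for x y
    by (simp add: norm_mult)
  have meas: "(\<lambda>z. K (fst z) (snd z) * complex_of_real (japanese_bracket (fst z - snd z) powr \<alpha>)) \<in> borel_measurable (borel \<Otimes>\<^sub>M borel)"
    unfolding japanese_bracket_def by measurable
  have b1: "(\<integral>\<^sup>+ y. ennreal (cmod (K x y) * japanese_bracket (x - y) powr \<alpha>) \<partial>lborel) \<le> ennreal B" for x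
    unfolding B kernel_norm_def by (intro max.coboundedI1 SUP_upper) auto
  have b2: "(\<integral>\<^sup>+ x. ennreal (cmod (K x y) * japanese_bracket (x - y) powr \<alpha>) \<partial>lborel) \<le> ennreal B" for y
    unfolding B kernel_norm_def by (intro max.coboundedI2 SUP_upper) auto
  show "schur_bound B (\<lambda>x y. K x y * complex_of_real (japanese_bracket (x - y) powr \<alpha>))"
    unfolding schur_bound_def eq case_prod_beta' using meas b1 b2 by (auto simp: B_def)
  have le: "ennreal (cmod (K x y)) \<le> ennreal (cmod (K x y) * japanese_bracket (x - y) powr \<alpha>)" for x y
  proof -
    have "1 \<le> japanese_bracket (x - y) powr \<alpha>"
      using norm_le_japanese_bracket(2)[of "x - y"] \<open>0 \<le> \<alpha>\<close> by (rule ge_one_powr_ge_zero)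
    then show ?thesis by (intro ennreal_leI) (simp add: mult_le_cancel_left1)
  qed
  show "schur_bound B K"
    unfolding schur_bound_def
    using K_meas order_trans[OF nn_integral_mono[OF le] b1] order_trans[OF nn_integral_mono[OF le] b2]
    by (auto simp: B_def)
qed

lemma transverse_potentialD:
  fixes A :: "'n::finite vector_field"
  assumes "transverse_potential M A"
  shows "C1_field A" "x \<bullet> A x = 0" "\<bar>mag_field A x j k\<bar> \<le> M" "0 \<le> M"
proof -
  show "C1_field A" "x \<bullet> A x = 0" and M: "\<bar>mag_field A x j k\<bar> \<le> M" for x j k
    using assms by (auto simp: transverse_potential_def C1_field_def inner_vec_def)
  show "0 \<le> M" using order_trans[OF abs_ge_zero M] .
qed

lemma edge_eq: "edge A c K \<epsilon> = phase_edge c K (\<lambda>x y. \<epsilon> * phase A x y)"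
  by (simp add: edge_def phase_edge_def phase_scaleR)

lemma slow_edge_eq: "slow_edge A c K \<epsilon> = phase_edge c K (slow_phase \<epsilon> A)"
  by (simp add: slow_edge_def phase_edge_def)

text \<open>The bound of the averaged multiplier divided by the mass of the Gaussian. In
  \<open>2 * (2 + D^2)\<close>, one unit of the inner 2 comes from the localisation, the rest from
  \<open>1 - cos\<close> of the loop phase. The value does not depend on \<alpha>.\<close>

definition midpoint_const :: "'a::euclidean_space itself \<Rightarrow> real \<Rightarrow> real" where
  "midpoint_const _ D = 2 * (2 + D\<^sup>2) * gauss_moment TYPE('a) / (LINT v::'a|lborel. gauss v)"

definition linear_const :: "'a::euclidean_space itself \<Rightarrow> real \<Rightarrow> real" where
  "linear_const _ D = (D + D\<^sup>2 / 2 + 1 / 2) * gauss_moment TYPE('a) / (LINT v::'a|lborel. gauss v)"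

lemma gauss_moment_pos: "0 < gauss_moment TYPE('a::euclidean_space)"
  using gauss_mass_pos[where 'a='a] gauss_mass_le_moment[where 'a='a] by linarith

lemma edge_midpoint:
  fixes A :: "'n::finite vector_field"
  assumes A: "transverse_potential M A" and \<alpha>: "0 < \<alpha>" "\<alpha> \<le> 2"
    and K: "(c, K) \<in> decay_class \<alpha>" "L2_selfadjoint (kernel_op c K)" and h: "0 < h"
  defines "D \<equiv> real CARD('n) ^ 2 * M"
  shows "edge A c K \<epsilon> \<le> (edge A c K (\<epsilon> + h) + edge A c K (\<epsilon> - h)) / 2 +
    midpoint_const TYPE(real^'n) D * decay_norm \<alpha> c K * h powr (\<alpha> / 2)"
proof -
  note C1 = transverse_potentialD(1)[OF A]
  define s where "s = sqrt h"
  have s: "0 < s" "s\<^sup>2 = h" using h by (auto simp: s_def)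
  have D: "0 \<le> D" using transverse_potentialD(4)[OF A] by (simp add: D_def)
  define q where "q x y = h * phase A x y" for x y
  have q: "antisym_phase q" unfolding q_def[abs_def] by (rule antisym_phase_phase[OF C1])
  have p: "antisym_phase (\<lambda>x y. \<epsilon> * phase A x y)" by (rule antisym_phase_phase[OF C1])
  have bd: "\<bar>q x y + q y ((1/2) *\<^sub>R (x + y) + (1/s) *\<^sub>R v) + q ((1/2) *\<^sub>R (x + y) + (1/s) *\<^sub>R v) x\<bar>
      \<le> D * s * norm (x - y) * norm v" for x y v
  proof -
    let ?u = "(1/2) *\<^sub>R (x + y) + (1/s) *\<^sub>R v"
    \<comment> \<open>The reference density is zero: a bounded field allows only a bound on the size
      of the loop phase, and its sign is left to the cancellation between \<open>q\<close> and
      \<open>- q\<close>.\<close>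
    have "\<bar>phase A x y + phase A y ?u + phase A ?u x + 0 / 2\<bar> \<le> D * norm (x - y) * (norm v / s)"
    proof (rule phase_loop_approx[OF C1])
      fix r t :: real
      let ?z = "x + t *\<^sub>R (y - x + r *\<^sub>R (?u - y))"
      have "\<bar>contract (mag_field A ?z) (y - x) \<bullet> (?u - (1/2) *\<^sub>R (x + y))\<bar> \<le>
          norm (contract (mag_field A ?z) (y - x)) * norm (?u - (1/2) *\<^sub>R (x + y))"
        by (rule Cauchy_Schwarz_ineq2)
      also have "\<dots> \<le> (real CARD('n) ^ 2 * M * norm (y - x)) * (norm v / s)"
        using s by (intro mult_mono norm_contract_le transverse_potentialD(3)[OF A])
          (auto intro!: mult_nonneg_nonneg simp: transverse_potentialD(4)[OF A])
      finally show "\<bar>contract (mag_field A ?z) (y - x) \<bullet> (?u - (1/2) *\<^sub>R (x + y)) - 0\<bar> \<le> D * norm (x - y) * (norm v / s)"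
        by (simp add: D_def norm_minus_commute)
    qed
    then have "h * \<bar>phase A x y + phase A y ?u + phase A ?u x\<bar> \<le> h * (D * norm (x - y) * (norm v / s))"
      using h by (intro mult_left_mono) auto
    also have "\<dots> = D * s * norm (x - y) * norm v"
      using s(1) by (simp add: s(2)[symmetric] power2_eq_square)
    finally show ?thesis
      using h by (simp add: q_def abs_mult flip: distrib_left)
  qed
  have avg: "phase_edge c K (\<lambda>x y. \<epsilon> * phase A x y) -
      ((2 * (2 + D\<^sup>2)) * gauss_moment TYPE(real^'n) * s powr \<alpha>) * enn2real (kernel_norm \<alpha> K) / (LINT v::real^'n|lborel. gauss v)
    \<le> (phase_edge c K (\<lambda>x y. \<epsilon> * phase A x y + q x y) + phase_edge c K (\<lambda>x y. \<epsilon> * phase A x y + - q x y)) / 2"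
  proof (rule phase_edge_average[OF decay_class_schur(2)[OF K(1)] K(2) p q antisym_phase_uminus[OF q] s(1) decay_class_schur(1)[OF K(1)]])
    show "0 \<le> (2 * (2 + D\<^sup>2)) * gauss_moment TYPE(real^'n) * s powr \<alpha>"
      using gauss_moment_pos[where 'a="real^'n"] by (simp add: add_nonneg_nonneg)
  qed (use avg_phase_pair[OF q s(1) D \<alpha> bd] \<alpha> in auto)
  have shift: "(\<lambda>x y. \<epsilon> * phase A x y + q x y) = (\<lambda>x y. (\<epsilon> + h) * phase A x y)"
    "(\<lambda>x y. \<epsilon> * phase A x y + - q x y) = (\<lambda>x y. (\<epsilon> - h) * phase A x y)"
    by (auto simp: q_def algebra_simps)
  have "s powr \<alpha> = h powr (\<alpha> / 2)"
    using h by (simp add: s_def powr_half_sqrt[symmetric] powr_powr)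
  then have const: "((2 * (2 + D\<^sup>2)) * gauss_moment TYPE(real^'n) * s powr \<alpha>) * enn2real (kernel_norm \<alpha> K) / (LINT v::real^'n|lborel. gauss v)
      = midpoint_const TYPE(real^'n) D * h powr (\<alpha> / 2) * enn2real (kernel_norm \<alpha> K)"
    by (simp add: midpoint_const_def)
  have "edge A c K \<epsilon> \<le> (edge A c K (\<epsilon> + h) + edge A c K (\<epsilon> - h)) / 2 +
      midpoint_const TYPE(real^'n) D * h powr (\<alpha> / 2) * enn2real (kernel_norm \<alpha> K)"
    using avg unfolding edge_eq shift const by linarith
  also have "\<dots> \<le> (edge A c K (\<epsilon> + h) + edge A c K (\<epsilon> - h)) / 2 +
      midpoint_const TYPE(real^'n) D * h powr (\<alpha> / 2) * decay_norm \<alpha> c K"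
    using gauss_moment_pos[where 'a="real^'n"] gauss_mass_pos[where 'a="real^'n"]
    by (intro add_left_mono mult_left_mono) (auto simp: decay_norm_def midpoint_const_def add_nonneg_nonneg)
  finally show ?thesis by (simp add: mult_ac)
qed

section \<open>A priori bound and dyadic iteration\<close>

lemma edge_bound:
  fixes A :: "'n::finite vector_field"
  assumes A: "C1_field A" and \<alpha>: "0 \<le> \<alpha>"
    and K: "(c, K) \<in> decay_class \<alpha>" "L2_selfadjoint (kernel_op c K)"
  shows "\<bar>edge A c K \<epsilon>\<bar> \<le> decay_norm \<alpha> c K"
  unfolding edge_eq decay_norm_def
  by (rule phase_edge_bound[OF decay_class_schur(2)[OF K(1) \<alpha>] K(2) antisym_phase_phase[OF A]])

text \<open>With step \<open>h = |x|\<close> the neighbours of \<open>x\<close> are \<open>0\<close>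
  and \<open>2 x\<close>, so each application halves the difference quotient problem at twice the
  distance. The error of step \<open>j\<close> is \<open>(1/2)^j |2^j e| powr \<beta>\<close>, a
  geometric sequence of ratio \<open>2 powr (\<beta> - 1)\<close>: summable for
  \<open>\<beta> < 1\<close>, constant for \<open>\<beta> = 1\<close>, which is where the logarithm
  originates.\<close>

lemma midpoint_upper_iterate:
  fixes f :: "real \<Rightarrow> real"
  assumes mid: "\<And>x h. 0 < h \<Longrightarrow> f x \<le> (f (x + h) + f (x - h)) / 2 + G * h powr \<beta>"
    and e: "e \<noteq> 0"
  shows "f e - f 0 \<le> (1/2) ^ n * (f (2 ^ n * e) - f 0) + G * \<bar>e\<bar> powr \<beta> * (\<Sum>j<n. (2 powr (\<beta> - 1)) ^ j)"
proof (induction n)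
  case (Suc n)
  let ?x = "2 ^ n * e"
  have pos: "0 < \<bar>?x\<bar>" using e by simp
  have "f ?x \<le> (f (?x + \<bar>?x\<bar>) + f (?x - \<bar>?x\<bar>)) / 2 + G * \<bar>?x\<bar> powr \<beta>"
    by (rule mid[OF pos])
  also have "f (?x + \<bar>?x\<bar>) + f (?x - \<bar>?x\<bar>) = f (2 ^ Suc n * e) + f 0"
    by (cases "0 \<le> e") (auto simp: abs_mult abs_of_nonpos mult_ac)
  finally have step: "f ?x - f 0 \<le> (1/2) * (f (2 ^ Suc n * e) - f 0) + G * \<bar>?x\<bar> powr \<beta>"
    by (simp add: field_simps)
  have "\<bar>?x\<bar> powr \<beta> = (2 ^ n) powr \<beta> * \<bar>e\<bar> powr \<beta>"
    by (simp add: abs_mult powr_mult)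
  moreover have "(1/2) ^ n * (2 ^ n) powr \<beta> = (2 powr (\<beta> - 1)) ^ n"
    by (simp add: powr_diff power_divide powr_power powr_realpow[symmetric] powr_powr mult.commute)
  ultimately have scale: "(1/2) ^ n * (G * \<bar>?x\<bar> powr \<beta>) = G * \<bar>e\<bar> powr \<beta> * (2 powr (\<beta> - 1)) ^ n"
    by (simp add: mult_ac)
  have "(1/2) ^ n * (f ?x - f 0) \<le> (1/2) ^ n * ((1/2) * (f (2 ^ Suc n * e) - f 0) + G * \<bar>?x\<bar> powr \<beta>)"
    by (intro mult_left_mono step) auto
  also have "\<dots> = (1/2) ^ Suc n * (f (2 ^ Suc n * e) - f 0) + G * \<bar>e\<bar> powr \<beta> * (2 powr (\<beta> - 1)) ^ n"
    unfolding distrib_left scale by simp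
  finally show ?case using Suc by (simp add: distrib_left)
qed simp

text \<open>The upper bound iterates the midpoint inequality between \<open>0\<close> and \<open>2 ^ n * e\<close>; the lower bound
  follows from the upper bound at \<open>- e\<close> and the midpoint inequality at \<open>0\<close>.\<close>

lemma midpoint_modulus:
  fixes f :: "real \<Rightarrow> real"
  assumes mid: "\<And>x h. 0 < h \<Longrightarrow> f x \<le> (f (x + h) + f (x - h)) / 2 + G * h powr \<beta>"
    and bd: "\<And>x. \<bar>f x\<bar> \<le> F" and e: "e \<noteq> 0" and "0 \<le> G"
    and n: "1 \<le> 2 ^ n * \<bar>e\<bar>" and S: "(\<Sum>j<n. (2 powr (\<beta> - 1)) ^ j) \<le> S"
  shows "\<bar>f e - f 0\<bar> \<le> 2 * F * \<bar>e\<bar> + G * \<bar>e\<bar> powr \<beta> * (S + 2)"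
proof -
  have up: "f x - f 0 \<le> 2 * F * \<bar>e\<bar> + G * \<bar>e\<bar> powr \<beta> * S" if x: "\<bar>x\<bar> = \<bar>e\<bar>" for x
  proof -
    have "x \<noteq> 0" using x e by auto
    then have "f x - f 0 \<le> (1/2) ^ n * (f (2 ^ n * x) - f 0) + G * \<bar>e\<bar> powr \<beta> * (\<Sum>j<n. (2 powr (\<beta> - 1)) ^ j)"
      using midpoint_upper_iterate[OF mid, of x n] x by simp
    \<comment> \<open>The far end point is controlled only by the a priori bound; the choice of
      \<open>n\<close> makes its weight at most \<open>|e|\<close>.\<close>
    also have "(1/2) ^ n * (f (2 ^ n * x) - f 0) \<le> \<bar>e\<bar> * (2 * F)"
    proof (rule order_trans[OF mult_left_mono mult_right_mono])
      show "f (2 ^ n * x) - f 0 \<le> 2 * F" using bd[of "2 ^ n * x"] bd[of 0] by linarith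
      show "(1/2) ^ n \<le> \<bar>e\<bar>" using n by (simp add: power_one_over field_simps)
      show "0 \<le> 2 * F" using bd[of 0] by linarith
    qed auto
    also have "G * \<bar>e\<bar> powr \<beta> * (\<Sum>j<n. (2 powr (\<beta> - 1)) ^ j) \<le> G * \<bar>e\<bar> powr \<beta> * S"
      using \<open>0 \<le> G\<close> by (intro mult_left_mono S) auto
    finally show ?thesis by (simp only: mult_ac)
  qed
  have "f 0 \<le> (f (0 + \<bar>e\<bar>) + f (0 - \<bar>e\<bar>)) / 2 + G * \<bar>e\<bar> powr \<beta>"
    using e by (intro mid) auto
  then have "f 0 - f e \<le> f (- e) - f 0 + 2 * (G * \<bar>e\<bar> powr \<beta>)"
    by (cases "0 \<le> e") (auto simp: abs_of_nonpos field_simps)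
  moreover have "0 \<le> G * \<bar>e\<bar> powr \<beta>" using \<open>0 \<le> G\<close> by simp
  ultimately show ?thesis
    using up[OF refl] up[OF abs_minus_cancel] unfolding distrib_left abs_le_iff by linarith
qed

section \<open>Slowly varying fields\<close>

text \<open>The hypothesis supplies derivatives along the axes only. The path from \<open>z'\<close>
  to \<open>z\<close> therefore changes one coordinate at a time, with the mean value inequality on
  each piece; hence the factor \<open>CARD('n)\<close>.\<close>

lemma mag_field_lipschitz:
  fixes A :: "'n::finite vector_field"
  assumes grad: "bounded_field_gradient M A"
  shows "\<bar>mag_field A z j k - mag_field A z' j k\<bar> \<le> real CARD('n) * M * norm (z - z')"
proof -
  define f where "f y = mag_field A y j k" for y
  have diff: "(\<lambda>t. f (y + t *\<^sub>R axis i 1)) differentiable (at (0::real))"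
    and pd: "\<bar>partial_deriv i f y\<bar> \<le> M" for y i
    using grad by (auto simp: bounded_field_gradient_def f_def[abs_def])
  have M: "0 \<le> M" using order_trans[OF abs_ge_zero pd] .
  have one: "\<bar>f (y + r *\<^sub>R axis i 1) - f y\<bar> \<le> M * \<bar>r\<bar>" for y i r
  proof -
    define g where "g t = f (y + t *\<^sub>R axis i 1)" for t
    have "(g has_field_derivative partial_deriv i f (y + t *\<^sub>R axis i 1)) (at t)" for t
    proof -
      have "((\<lambda>u. f (y + t *\<^sub>R axis i 1 + u *\<^sub>R axis i 1)) has_field_derivative partial_deriv i f (y + t *\<^sub>R axis i 1)) (at 0)"
        unfolding partial_deriv_def using diff DERIV_deriv_iff_real_differentiable by blast
      then have "((\<lambda>u. g (t + u)) has_field_derivative partial_deriv i f (y + t *\<^sub>R axis i 1)) (at 0)"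
        by (simp add: g_def scaleR_add_left add.assoc)
      then show ?thesis
        using DERIV_at_within_shift[of g _ t 0 UNIV] by (simp add: add.commute)
    qed
    then have "norm (g r - g 0) \<le> M * norm (r - 0)"
      using pd by (intro field_differentiable_bound[where S=UNIV and f'="\<lambda>t. partial_deriv i f (y + t *\<^sub>R axis i 1)"]) auto
    then show ?thesis by (simp add: g_def)
  qed
  define v where "v = z - z'"
  have "\<bar>f (z' + (\<Sum>i\<in>S. v $ i *\<^sub>R axis i 1)) - f z'\<bar> \<le> (\<Sum>i\<in>S. M * \<bar>v $ i\<bar>)" if "finite S" for S
    using that
  proof (induction S rule: finite_induct)
    case (insert i S)
    let ?y = "z' + (\<Sum>i\<in>S. v $ i *\<^sub>R axis i 1)"
    have "\<bar>f (?y + v $ i *\<^sub>R axis i 1) - f ?y\<bar> \<le> M * \<bar>v $ i\<bar>" by (rule one)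
    moreover have "?y + v $ i *\<^sub>R axis i 1 = z' + (\<Sum>i\<in>insert i S. v $ i *\<^sub>R axis i 1)"
      using insert by (simp add: algebra_simps)
    ultimately show ?case using insert by simp
  qed simp
  from this[of UNIV] have "\<bar>f z - f z'\<bar> \<le> (\<Sum>i\<in>UNIV. M * \<bar>v $ i\<bar>)"
    using basis_expansion[of v] by (simp add: scalar_mult_eq_scaleR v_def)
  also have "\<dots> \<le> (\<Sum>i\<in>(UNIV::'n set). M * norm v)"
    using M by (intro sum_mono mult_left_mono component_le_norm_cart)
  finally show ?thesis by (simp add: f_def v_def)
qed

lemma C1_field_dilate:
  fixes A :: "'n::finite vector_field"
  assumes "C1_field A"
  shows "C1_field (\<lambda>z. A (\<epsilon> *\<^sub>R z))"
    and "mag_field (\<lambda>z. A (\<epsilon> *\<^sub>R z)) z j k = \<epsilon> * mag_field A (\<epsilon> *\<^sub>R z) j k"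
proof -
  obtain A' where A': "\<And>x. (A has_derivative blinfun_apply (A' x)) (at x)" "continuous_on UNIV A'"
    using C1_fieldE[OF assms] by metis
  have d: "((\<lambda>z. A (\<epsilon> *\<^sub>R z)) has_derivative blinfun_apply (\<epsilon> *\<^sub>R A' (\<epsilon> *\<^sub>R z))) (at z)" for z
  proof -
    have "((\<lambda>z. \<epsilon> *\<^sub>R z) has_derivative (\<lambda>h. \<epsilon> *\<^sub>R h)) (at z)"
      by (auto intro!: derivative_eq_intros)
    from has_derivative_compose[OF this A'(1)[of "\<epsilon> *\<^sub>R z"]] show ?thesis
      by (simp add: blinfun.scaleR_right scaleR_blinfun.rep_eq)
  qed
  moreover have "continuous_on UNIV (\<lambda>z. \<epsilon> *\<^sub>R A' (\<epsilon> *\<^sub>R z))"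
    by (intro continuous_intros continuous_on_compose2[OF A'(2)]) auto
  ultimately show "C1_field (\<lambda>z. A (\<epsilon> *\<^sub>R z))"
    unfolding C1_field_def by (intro exI[of _ "\<lambda>z. \<epsilon> *\<^sub>R A' (\<epsilon> *\<^sub>R z)"]) blast
  show "mag_field (\<lambda>z. A (\<epsilon> *\<^sub>R z)) z j k = \<epsilon> * mag_field A (\<epsilon> *\<^sub>R z) j k"
    unfolding mag_field_def partial_deriv_component[OF d] partial_deriv_component[OF A'(1)]
    by (simp add: blinfun.scaleR_left right_diff_distrib)
qed

lemma flux_cmult: "flux (\<lambda>z j k. r * B z j k) x y u = r * flux B x y u"
  by (simp add: flux_def sum_distrib_left mult_ac)

text \<open>Dilation preserves the transverse gauge: the condition at \<open>\<epsilon> x\<close> is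
  divided by \<epsilon>. The flux that defines the slow phase is therefore a circulation, and the
  loop identities apply to it.\<close>

lemma slow_phase_eq:
  fixes A :: "'n::finite vector_field"
  assumes A: "transverse_potential M A" and "\<epsilon> \<noteq> 0"
  shows "slow_phase \<epsilon> A x y = phase (\<lambda>z. A (\<epsilon> *\<^sub>R z)) x y"
proof -
  note C1 = transverse_potentialD(1)[OF A]
  have "x \<bullet> A (\<epsilon> *\<^sub>R x) = 0" for x
    using transverse_potentialD(2)[OF A, of "\<epsilon> *\<^sub>R x"] \<open>\<epsilon> \<noteq> 0\<close> by simp
  from phase_transverse[OF C1_field_dilate(1)[OF C1] this]
  have "phase (\<lambda>z. A (\<epsilon> *\<^sub>R z)) x y = - flux (\<lambda>z j k. \<epsilon> * mag_field A (\<epsilon> *\<^sub>R z) j k) 0 x y"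
    unfolding C1_field_dilate(2)[OF C1, abs_def] .
  then show ?thesis
    by (simp add: flux_cmult[of \<epsilon> "\<lambda>z. mag_field A (\<epsilon> *\<^sub>R z)"] slow_phase_def)
qed

text \<open>Relative to the midpoint, a point of the triangle is a combination of half the side
  \<open>x - y\<close> and of \<open>u - m\<close>, with coefficients of modulus at most
  one.\<close>

lemma triangle_dist_midpoint:
  fixes x y u :: "'a::real_normed_vector"
  assumes "r \<in> {0..1}" "t \<in> {0..1}"
  shows "norm (x + t *\<^sub>R (y - x + r *\<^sub>R (u - y)) - (1/2) *\<^sub>R (x + y)) \<le> norm (x - y) + norm (u - (1/2) *\<^sub>R (x + y))"
proof -
  define m where "m = (1/2) *\<^sub>R (x + y)"
  define w where "w = (1/2) *\<^sub>R (x - y)"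
  have x: "x = m + w" and y: "y = m - w"
    by (simp_all add: m_def w_def algebra_simps flip: scaleR_add_left)
  have "x + t *\<^sub>R (y - x + r *\<^sub>R (u - y)) - m = ((1 - t) - t * (1 - r)) *\<^sub>R w + (t * r) *\<^sub>R (u - m)"
    unfolding x y by (simp add: algebra_simps) (simp flip: scaleR_add_left)
  also have "norm \<dots> \<le> \<bar>(1 - t) - t * (1 - r)\<bar> * (norm (x - y) / 2) + \<bar>t * r\<bar> * norm (u - m)"
    by (rule order_trans[OF norm_triangle_ineq]) (simp add: w_def)
  also have "\<dots> \<le> 1 * (norm (x - y) / 2) + 1 * norm (u - m)"
  proof (intro add_mono mult_right_mono)
    have "0 \<le> t * (1 - r)" using assms by simp
    moreover have "t * (1 - r) \<le> t * 1" using assms by (intro mult_left_mono) auto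
    ultimately show "\<bar>(1 - t) - t * (1 - r)\<bar> \<le> 1" using assms by auto
    show "\<bar>t * r\<bar> \<le> 1" using assms by (auto simp: abs_mult intro: mult_le_one)
  qed auto
  also have "\<dots> \<le> norm (x - y) + norm (u - m)" by simp
  finally show ?thesis by (simp add: m_def)
qed

text \<open>The base phase and the sign are free so that one inequality gives both directions: the
  slow phase is added to zero, or subtracted from itself. The loop phase is linear in
  \<open>v\<close> up to second order, and the linear part averages out.\<close>

lemma slow_phase_edge_step:
  fixes A :: "'n::finite vector_field"
  assumes A: "transverse_potential M A" and "0 \<le> L"
    and lip: "\<And>z z' j k. \<bar>mag_field A z j k - mag_field A z' j k\<bar> \<le> L * norm (z - z')"
    and K: "(c, K) \<in> decay_class 2" "L2_selfadjoint (kernel_op c K)"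
    and e: "e \<noteq> 0" "\<bar>e\<bar> \<le> 1" and \<sigma>: "\<sigma> = 1 \<or> \<sigma> = - 1" and p: "antisym_phase p"
  defines "D \<equiv> real CARD('n) ^ 2 * (L + M)"
  shows "phase_edge c K p \<le> phase_edge c K (\<lambda>x y. p x y + \<sigma> * slow_phase e A x y) +
    linear_const TYPE(real^'n) D * decay_norm 2 c K * \<bar>e\<bar>"
proof -
  define A\<^sub>e where "A\<^sub>e z = A (e *\<^sub>R z)" for z
  note C1 = C1_field_dilate(1)[OF transverse_potentialD(1)[OF A], of e, folded A\<^sub>e_def]
  have mag: "mag_field A\<^sub>e z = (\<lambda>j k. e * mag_field A (e *\<^sub>R z) j k)" for z
    using C1_field_dilate(2)[OF transverse_potentialD(1)[OF A], of e]
    unfolding A\<^sub>e_def[abs_def] by (simp add: fun_eq_iff)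
  have M: "0 \<le> M" by (rule transverse_potentialD(4)[OF A])
  have D: "0 \<le> D" using M \<open>0 \<le> L\<close> by (simp add: D_def)
  define s where "s = sqrt \<bar>e\<bar>"
  have s: "0 < s" "s\<^sup>2 = \<bar>e\<bar>" "s \<le> 1" using e by (auto simp: s_def)
  define q where "q x y = \<sigma> * phase A\<^sub>e x y" for x y
  have q: "antisym_phase q" unfolding q_def[abs_def] by (rule antisym_phase_phase[OF C1])
  \<comment> \<open>The density of the dilated field at the midpoint, paired with
    \<open>u - m = v / s\<close>. The half comes from the area of the triangle and the sign from the
    orientation of the phase.\<close>
  define l where "l x y = (- (\<sigma> * e / (2 * s))) *\<^sub>R contract (mag_field A (e *\<^sub>R ((1/2) *\<^sub>R (x + y)))) (y - x)" for x y
  have \<sigma>1: "\<bar>\<sigma>\<bar> = 1" using \<sigma> by auto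
  have l: "norm (l x y) \<le> D * s * norm (x - y)" for x y
  proof -
    have "norm (l x y) = (s / 2) * norm (contract (mag_field A (e *\<^sub>R ((1/2) *\<^sub>R (x + y)))) (y - x))"
      using s(1) by (simp add: l_def abs_mult \<sigma>1 s(2)[symmetric] power2_eq_square)
    also have "\<dots> \<le> (s / 2) * (real CARD('n) ^ 2 * M * norm (y - x))"
      using s(1) by (intro mult_left_mono norm_contract_le transverse_potentialD(3)[OF A]) auto
    also have "\<dots> \<le> s * (D * norm (y - x))"
      unfolding D_def using s(1) M \<open>0 \<le> L\<close> by (intro mult_mono) (auto intro!: mult_left_mono)
    finally show ?thesis by (simp add: mult_ac norm_minus_commute)
  qed
  have bd: "\<bar>q x y + q y ((1/2) *\<^sub>R (x + y) + (1/s) *\<^sub>R v) + q ((1/2) *\<^sub>R (x + y) + (1/s) *\<^sub>R v) x - l x y \<bullet> v\<bar>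
      \<le> D * s\<^sup>2 * (1 + (norm (x - y))\<^sup>2) * (1 + (norm v)\<^sup>2)" for x y v
  proof -
    define m where "m = (1/2) *\<^sub>R (x + y)"
    define u where "u = m + (1/s) *\<^sub>R v"
    define d where "d = norm (x - y)"
    \<comment> \<open>The dilation gives one factor \<open>e\<close> in the field and another in its
      variation over the triangle. The second offsets the diameter of order \<open>1/s\<close>, and
      with \<open>|e| = s^2\<close> the product has order \<open>s^2\<close>.\<close>
    define b where "b = real CARD('n) ^ 2 * (L * (\<bar>e\<bar> * (d + norm v / s))) * d * (s * norm v)"
    have um: "norm (u - m) = norm v / s" using s(1) by (simp add: u_def)
    define r where "r = contract (mag_field A\<^sub>e m) (y - x) \<bullet> (u - m)"
    have "\<bar>phase A\<^sub>e x y + phase A\<^sub>e y u + phase A\<^sub>e u x + r / 2\<bar> \<le> b"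
    proof (rule phase_loop_approx[OF C1])
      fix \<rho> t :: real assume \<rho>: "\<rho> \<in> {0..1}" and t: "t \<in> {0..1}"
      let ?z = "x + t *\<^sub>R (y - x + \<rho> *\<^sub>R (u - y))"
      have diff: "\<bar>mag_field A (e *\<^sub>R ?z) j k - mag_field A (e *\<^sub>R m) j k\<bar> \<le> L * (\<bar>e\<bar> * (d + norm v / s))" for j k
      proof -
        have "\<bar>mag_field A (e *\<^sub>R ?z) j k - mag_field A (e *\<^sub>R m) j k\<bar> \<le> L * (\<bar>e\<bar> * norm (?z - m))"
          using lip[of "e *\<^sub>R ?z" j k "e *\<^sub>R m"] by (simp flip: scaleR_diff_right)
        also have "\<dots> \<le> L * (\<bar>e\<bar> * (d + norm v / s))"
          using triangle_dist_midpoint[OF \<rho> t, of x y u] \<open>0 \<le> L\<close>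
          by (intro mult_left_mono) (auto simp: um[unfolded m_def] m_def d_def)
        finally show ?thesis .
      qed
      have "contract (mag_field A\<^sub>e ?z) (y - x) \<bullet> (u - m) - r =
          e * (contract (\<lambda>j k. mag_field A (e *\<^sub>R ?z) j k - mag_field A (e *\<^sub>R m) j k) (y - x) \<bullet> (u - m))"
        unfolding r_def mag contract_scale contract_diff[symmetric] by (simp add: inner_diff_left right_diff_distrib)
      also have "\<bar>\<dots>\<bar> \<le> \<bar>e\<bar> * ((real CARD('n) ^ 2 * (L * (\<bar>e\<bar> * (d + norm v / s))) * norm (y - x)) * norm (u - m))"
        unfolding abs_mult
        by (intro mult_left_mono order_trans[OF Cauchy_Schwarz_ineq2] mult_right_mono norm_contract_le diff) auto
      also have "\<dots> = b"
        using s(1) unfolding b_def um s(2)[symmetric] d_def by (simp add: norm_minus_commute power2_eq_square)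
      finally show "\<bar>contract (mag_field A\<^sub>e ?z) (y - x) \<bullet> (u - (1/2) *\<^sub>R (x + y)) - r\<bar> \<le> b"
        by (simp add: m_def)
    qed
    then have "\<bar>\<sigma> * (phase A\<^sub>e x y + phase A\<^sub>e y u + phase A\<^sub>e u x + r / 2)\<bar> \<le> b"
      by (simp add: abs_mult \<sigma>1)
    moreover have "\<sigma> * (r / 2) = - (l x y \<bullet> v)"
      unfolding r_def l_def mag contract_scale m_def[symmetric] by (simp add: u_def)
    ultimately have "\<bar>q x y + q y u + q u x - l x y \<bullet> v\<bar> \<le> b"
      unfolding q_def by (simp add: distrib_left)
    also have "b \<le> D * s\<^sup>2 * (1 + d\<^sup>2) * (1 + (norm v)\<^sup>2)"
    proof -
      have "b = real CARD('n) ^ 2 * L * (s\<^sup>2 * (s * d\<^sup>2 * norm v + d * (norm v)\<^sup>2))"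
        using s(1) unfolding b_def s(2)[symmetric] by (simp add: power2_eq_square field_simps)
      also have "\<dots> \<le> real CARD('n) ^ 2 * (L + M) * (s\<^sup>2 * ((1 + d\<^sup>2) * (1 + (norm v)\<^sup>2)))"
      proof (intro mult_mono)
        have half: "a \<le> (1 + a\<^sup>2) / 2" for a :: real
          using sum_squares_bound[of 1 a] by simp
        have "s * d\<^sup>2 * norm v \<le> 1 * (1 + d\<^sup>2) * ((1 + (norm v)\<^sup>2) / 2)"
          using s by (intro mult_mono half) auto
        moreover have "d * (norm v)\<^sup>2 \<le> (1 + d\<^sup>2) / 2 * (1 + (norm v)\<^sup>2)"
          by (intro mult_mono half) auto
        ultimately show "s * d\<^sup>2 * norm v + d * (norm v)\<^sup>2 \<le> (1 + d\<^sup>2) * (1 + (norm v)\<^sup>2)"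
          by (simp add: field_simps)
        show "0 \<le> s\<^sup>2 * (s * d\<^sup>2 * norm v + d * (norm v)\<^sup>2)"
          using s(1) by (simp add: d_def)
      qed (use M \<open>0 \<le> L\<close> s(1) in \<open>auto simp: d_def\<close>)
      finally show ?thesis by (simp add: D_def mult_ac)
    qed
    finally show ?thesis by (simp add: u_def m_def d_def)
  qed
  have avg: "phase_edge c K p -
      ((D + D\<^sup>2 / 2 + 1 / 2) * gauss_moment TYPE(real^'n) * s\<^sup>2) * enn2real (kernel_norm 2 K) / (LINT v::real^'n|lborel. gauss v)
    \<le> (phase_edge c K (\<lambda>x y. p x y + q x y) + phase_edge c K (\<lambda>x y. p x y + q x y)) / 2"
  proof (rule phase_edge_average[OF decay_class_schur(2)[OF K(1) zero_le_numeral] K(2) p q q s(1) decay_class_schur(1)[OF K(1) zero_le_numeral]])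
    show "0 \<le> (D + D\<^sup>2 / 2 + 1 / 2) * gauss_moment TYPE(real^'n) * s\<^sup>2"
      using gauss_moment_pos[where 'a="real^'n"] D by simp
    show "cmod (exp (- (s\<^sup>2 * (norm (x - y))\<^sup>2 / 2)) *\<^sub>R ((1/2) *\<^sub>R (avg_phase s q x y + avg_phase s q x y)) -
        complex_of_real (LINT v::real^'n|lborel. gauss v))
      \<le> ((D + D\<^sup>2 / 2 + 1 / 2) * gauss_moment TYPE(real^'n) * s\<^sup>2) * \<bar>japanese_bracket (x - y) powr 2\<bar>" for x y
      by (rule avg_phase_linear[OF q s(1) D l[of x y] bd[of x y]])
  qed
  have const: "((D + D\<^sup>2 / 2 + 1 / 2) * gauss_moment TYPE(real^'n) * s\<^sup>2) * enn2real (kernel_norm 2 K) / (LINT v::real^'n|lborel. gauss v)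
      = linear_const TYPE(real^'n) D * \<bar>e\<bar> * enn2real (kernel_norm 2 K)"
    by (simp add: linear_const_def s(2))
  have "linear_const TYPE(real^'n) D * \<bar>e\<bar> * enn2real (kernel_norm 2 K) \<le> linear_const TYPE(real^'n) D * \<bar>e\<bar> * decay_norm 2 c K"
    using gauss_moment_pos[where 'a="real^'n"] gauss_mass_pos[where 'a="real^'n"] D
    by (intro mult_left_mono) (auto simp: decay_norm_def linear_const_def)
  note le = this
  have "phase_edge c K p \<le> phase_edge c K (\<lambda>x y. p x y + q x y) + linear_const TYPE(real^'n) D * \<bar>e\<bar> * decay_norm 2 c K"
  proof -
    have "a \<le> b + Y" if "a - X \<le> (b + b) / 2" "X \<le> Y" for a b X Y :: real
      using that by simp
    from this[OF avg[unfolded const] le] show ?thesis .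
  qed
  moreover have "(\<lambda>x y. p x y + q x y) = (\<lambda>x y. p x y + \<sigma> * slow_phase e A x y)"
    unfolding q_def A\<^sub>e_def slow_phase_eq[OF A e(1)] ..
  ultimately show ?thesis by (simp only: mult_ac)
qed

lemma slow_edge_lipschitz:
  fixes A :: "'n::finite vector_field"
  assumes A: "transverse_potential M A" and "0 \<le> L"
    and lip: "\<And>z z' j k. \<bar>mag_field A z j k - mag_field A z' j k\<bar> \<le> L * norm (z - z')"
    and K: "(c, K) \<in> decay_class 2" "L2_selfadjoint (kernel_op c K)"
    and e: "\<bar>e\<bar> \<le> 1"
  shows "\<bar>slow_edge A c K e - slow_edge A c K 0\<bar> \<le>
    linear_const TYPE(real^'n) (real CARD('n) ^ 2 * (L + M)) * decay_norm 2 c K * \<bar>e\<bar>"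
proof (cases "e = 0")
  case False
  note step = slow_phase_edge_step[OF A \<open>0 \<le> L\<close> lip K False e]
  have zero: "slow_phase 0 A = (\<lambda>x y. 0)"
    by (simp add: slow_phase_def fun_eq_iff)
  have p0: "antisym_phase (slow_phase 0 A)"
    unfolding zero by (simp add: antisym_phase_def)
  have pe: "antisym_phase (slow_phase e A)"
    using antisym_phase_phase[OF C1_field_dilate(1)[OF transverse_potentialD(1)[OF A], of e], of 1]
    unfolding slow_phase_eq[OF A False, abs_def] by simp
  have "slow_edge A c K 0 \<le> slow_edge A c K e +
      linear_const TYPE(real^'n) (real CARD('n) ^ 2 * (L + M)) * decay_norm 2 c K * \<bar>e\<bar>"
    using step[of 1, OF _ p0] unfolding slow_edge_eq zero by simp
  moreover have "slow_edge A c K e \<le> slow_edge A c K 0 +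
      linear_const TYPE(real^'n) (real CARD('n) ^ 2 * (L + M)) * decay_norm 2 c K * \<bar>e\<bar>"
    using step[of "- 1", OF _ pe] unfolding slow_edge_eq zero by simp
  ultimately show ?thesis by linarith
qed simp

text \<open>Dilation does not change a constant field, so both perturbations coincide and the
  constant case reduces to the slowly varying one.\<close>

lemma slow_edge_constant_field:
  fixes A :: "'n::finite vector_field"
  assumes A: "transverse_potential M A" and const: "constant_field A"
  shows "slow_edge A c K e = edge A c K e"
proof -
  have "slow_phase e A x y = e * phase A x y" for x y
  proof -
    have "(\<lambda>y. mag_field A (e *\<^sub>R y)) = mag_field A"
      using const unfolding constant_field_def by blast
    then show ?thesis
      unfolding slow_phase_def phase_transverse[OF transverse_potentialD(1,2)[OF A]] by simp
  qed
  then have "slow_phase e A = (\<lambda>x y. e * phase A x y)" by (simp add: fun_eq_iff)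
  then show ?thesis by (simp add: slow_edge_eq edge_eq)
qed

section \<open>Constants and the final estimates\<close>

lemma midpoint_const_pos: "0 < midpoint_const TYPE('a::euclidean_space) D"
  using gauss_moment_pos[where 'a='a] gauss_mass_pos[where 'a='a]
  by (simp add: midpoint_const_def add_pos_nonneg)

lemma decay_norm_nonneg: "0 \<le> decay_norm \<alpha> c K"
  by (simp add: decay_norm_def)

lemma sum_power_le_geometric:
  fixes x :: real
  assumes "0 \<le> x" "x < 1"
  shows "(\<Sum>j<n. x ^ j) \<le> 1 / (1 - x)"
proof -
  have "(\<Sum>j<n. x ^ j) \<le> (\<Sum>j. x ^ j)"
    using assms by (intro sum_le_suminf summable_geometric) auto
  then show ?thesis using assms by (simp add: suminf_geometric)
qed

text \<open>The summands are the a priori bound at the far end point, the geometric sum of the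
  iteration, and the price of the lower bound. The ratio tends to one as \<alpha> approaches 2,
  which makes the constant diverge.\<close>

definition hoelder_const :: "real \<Rightarrow> real \<Rightarrow> real" where
  "hoelder_const G \<alpha> = 2 + G * (1 / (1 - 2 powr (\<alpha> / 2 - 1)) + 2)"

lemma hoelder_const_pos:
  assumes "0 < G" "\<alpha> < 2"
  shows "0 < hoelder_const G \<alpha>"
proof -
  have "2 powr (\<alpha> / 2 - 1) < 2 powr 0" using assms by (intro powr_less_mono) auto
  then have "0 < 1 / (1 - 2 powr (\<alpha> / 2 - 1)) + 2" by (simp add: add_pos_pos)
  then show ?thesis using assms by (simp add: hoelder_const_def add_pos_pos)
qed

lemma hoelder_const_at_top:
  assumes "0 < G"
  shows "filterlim (hoelder_const G) at_top (at_left 2)"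
proof -
  have "filterlim (\<lambda>\<alpha>. 1 / (1 - 2 powr (\<alpha> / 2 - 1)) + 2 :: real) at_top (at_left 2)"
    by real_asymp
  then have "filterlim (\<lambda>\<alpha>. G * (1 / (1 - 2 powr (\<alpha> / 2 - 1)) + 2)) at_top (at_left 2)"
    using assms by (intro filterlim_tendsto_pos_mult_at_top[OF tendsto_const])
  then show ?thesis
    unfolding hoelder_const_def[abs_def] by (intro filterlim_tendsto_add_at_top[OF tendsto_const])
qed

lemma edge_hoelder:
  fixes A :: "'n::finite vector_field"
  assumes A: "transverse_potential M A" and \<alpha>: "1 \<le> \<alpha>" "\<alpha> < 2"
    and K: "(c, K) \<in> decay_class \<alpha>" "L2_selfadjoint (kernel_op c K)" and e: "\<bar>e\<bar> \<le> 1 / 2"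
  shows "\<bar>edge A c K e - edge A c K 0\<bar> \<le>
    hoelder_const (midpoint_const TYPE(real^'n) (real CARD('n) ^ 2 * M)) \<alpha> * decay_norm \<alpha> c K * \<bar>e\<bar> powr (\<alpha> / 2)"
proof (cases "e = 0")
  case False
  define G where "G = midpoint_const TYPE(real^'n) (real CARD('n) ^ 2 * M)"
  define d where "d = decay_norm \<alpha> c K"
  define S where "S = 1 / (1 - 2 powr (\<alpha> / 2 - 1) :: real)"
  have G: "0 < G" and d: "0 \<le> d"
    by (simp_all add: G_def d_def midpoint_const_pos decay_norm_nonneg)
  have x: "2 powr (\<alpha> / 2 - 1) < (1::real)"
    using powr_less_mono[of "\<alpha> / 2 - 1" 0 "2::real"] \<alpha> by simp
  obtain n where "1 / \<bar>e\<bar> < 2 ^ n" using real_arch_pow[of 2 "1 / \<bar>e\<bar>"] by auto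
  then have n: "1 \<le> 2 ^ n * \<bar>e\<bar>" using False by (simp add: field_simps)
  have "\<bar>edge A c K e - edge A c K 0\<bar> \<le> 2 * d * \<bar>e\<bar> + (G * d) * \<bar>e\<bar> powr (\<alpha> / 2) * (S + 2)"
  proof (rule midpoint_modulus[OF _ _ False _ n])
    show "edge A c K x \<le> (edge A c K (x + h) + edge A c K (x - h)) / 2 + G * d * h powr (\<alpha> / 2)"
      if "0 < h" for x h
      using edge_midpoint[OF A _ _ K that] \<alpha> by (simp add: G_def d_def)
    show "\<bar>edge A c K x\<bar> \<le> d" for x
      unfolding d_def using \<alpha> by (intro edge_bound[OF transverse_potentialD(1)[OF A] _ K]) auto
    show "0 \<le> G * d" using G d by simp
    show "(\<Sum>j<n. (2 powr (\<alpha> / 2 - 1)) ^ j) \<le> S"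
      unfolding S_def by (rule sum_power_le_geometric) (use x in auto)
  qed
  also have "2 * d * \<bar>e\<bar> \<le> 2 * d * \<bar>e\<bar> powr (\<alpha> / 2)"
  proof (rule mult_left_mono)
    have "\<bar>e\<bar> powr 1 \<le> \<bar>e\<bar> powr (\<alpha> / 2)"
      using \<alpha> e by (intro powr_mono') auto
    then show "\<bar>e\<bar> \<le> \<bar>e\<bar> powr (\<alpha> / 2)" using False by simp
  qed (use d in auto)
  also have "2 * d * \<bar>e\<bar> powr (\<alpha> / 2) + (G * d) * \<bar>e\<bar> powr (\<alpha> / 2) * (S + 2) = hoelder_const G \<alpha> * d * \<bar>e\<bar> powr (\<alpha> / 2)"
    by (simp add: hoelder_const_def S_def[symmetric] algebra_simps)
  finally show ?thesis by (simp add: G_def d_def)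
qed simp

text \<open>At \<alpha> = 2 all steps of the iteration cost the same, so the sum equals their
  number, about \<open>log 2 (1 / |e|)\<close>.\<close>

lemma edge_log_lipschitz:
  fixes A :: "'n::finite vector_field"
  assumes A: "transverse_potential M A"
    and K: "(c, K) \<in> decay_class 2" "L2_selfadjoint (kernel_op c K)" and e: "\<bar>e\<bar> \<le> 1 / 2"
  defines "G \<equiv> midpoint_const TYPE(real^'n) (real CARD('n) ^ 2 * M)"
  shows "\<bar>edge A c K e - edge A c K 0\<bar> \<le> (2 + 4 * G) / ln 2 * decay_norm 2 c K * \<bar>e\<bar> * ln (1 / \<bar>e\<bar>)"
proof (cases "e = 0")
  case False
  define d where "d = decay_norm 2 c K"
  define x where "x = log 2 (1 / \<bar>e\<bar>)"
  have G: "0 < G" and d: "0 \<le> d"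
    by (simp_all add: G_def d_def midpoint_const_pos decay_norm_nonneg)
  have inv: "2 \<le> 1 / \<bar>e\<bar>" using e False by (simp add: field_simps)
  have x: "1 \<le> x"
    using inv False le_log_iff[of 2 "1 / \<bar>e\<bar>" 1] by (simp add: x_def)
  define n where "n = nat \<lceil>x\<rceil>"
  have nx: "x \<le> real n" "real n \<le> x + 1" using x by (auto simp: n_def)
  have "1 / \<bar>e\<bar> = 2 powr x" using False by (simp add: x_def)
  also have "\<dots> \<le> 2 powr real n" using nx by (intro powr_mono) auto
  finally have "1 / \<bar>e\<bar> \<le> 2 ^ n" by (simp add: powr_realpow)
  then have n: "1 \<le> 2 ^ n * \<bar>e\<bar>" using False by (simp add: field_simps)
  have "\<bar>edge A c K e - edge A c K 0\<bar> \<le> 2 * d * \<bar>e\<bar> + (G * d) * \<bar>e\<bar> powr 1 * ((x + 1) + 2)"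
  proof (rule midpoint_modulus[OF _ _ False _ n])
    show "edge A c K y \<le> (edge A c K (y + h) + edge A c K (y - h)) / 2 + G * d * h powr 1"
      if "0 < h" for y h
      using edge_midpoint[OF A _ _ K that] by (simp add: G_def d_def)
    show "\<bar>edge A c K y\<bar> \<le> d" for y
      unfolding d_def by (intro edge_bound[OF transverse_potentialD(1)[OF A] _ K]) auto
    show "0 \<le> G * d" using G d by simp
    show "(\<Sum>j<n. (2 powr (1 - 1)) ^ j) \<le> x + 1" using nx by simp
  qed
  also have "\<dots> = d * \<bar>e\<bar> * (2 + G * (x + 3))"
    using False by (simp add: algebra_simps)
  also have "\<dots> \<le> d * \<bar>e\<bar> * ((2 + 4 * G) * x)"
  proof (intro mult_left_mono)
    \<comment> \<open>\<open>|e| <= 1/2\<close> ensures \<open>1 <= x\<close>, so all additive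
      constants are absorbed into multiples of the logarithm.\<close>
    have "G * (x + 3) \<le> G * (4 * x)" using x G by (intro mult_left_mono) auto
    then show "2 + G * (x + 3) \<le> (2 + 4 * G) * x" using x by (simp add: algebra_simps)
  qed (use d in auto)
  also have "\<dots> = (2 + 4 * G) / ln 2 * d * \<bar>e\<bar> * ln (1 / \<bar>e\<bar>)"
    by (simp add: x_def log_def)
  finally show ?thesis by (simp add: d_def)
qed simp

theorem theorem1p2:
  fixes M :: real
  shows
  "(\<exists>C::real \<Rightarrow> real.
      (\<forall>\<alpha>\<in>{1..<2}. 0 < C \<alpha>) \<and> filterlim C at_top (at_left 2) \<and>
      (\<forall>(A :: real^'n \<Rightarrow> real^'n) \<alpha> c K \<epsilon>.
         transverse_potential M A \<and> 1 \<le> \<alpha> \<and> \<alpha> < 2 \<and>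
         (c, K) \<in> decay_class \<alpha> \<and> L2_selfadjoint (kernel_op c K) \<and> \<bar>\<epsilon>\<bar> \<le> 1/2 \<longrightarrow>
         \<bar>edge A c K \<epsilon> - edge A c K 0\<bar> \<le> C \<alpha> * decay_norm \<alpha> c K * \<bar>\<epsilon>\<bar> powr (\<alpha>/2)))
   \<and>
   (\<exists>C>0. \<forall>(A :: real^'n \<Rightarrow> real^'n) \<alpha> c K \<epsilon>.
      transverse_potential M A \<and> 2 \<le> \<alpha> \<and>
      (c, K) \<in> decay_class \<alpha> \<and> L2_selfadjoint (kernel_op c K) \<and> \<bar>\<epsilon>\<bar> \<le> 1/2 \<longrightarrow>
      \<bar>edge A c K \<epsilon> - edge A c K 0\<bar> \<le> C * decay_norm 2 c K * \<bar>\<epsilon>\<bar> * ln (1/\<bar>\<epsilon>\<bar>))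
   \<and>
   (\<exists>C>0. \<forall>(A :: real^'n \<Rightarrow> real^'n) \<alpha> c K \<epsilon>.
      transverse_potential M A \<and> 2 \<le> \<alpha> \<and>
      (c, K) \<in> decay_class \<alpha> \<and> L2_selfadjoint (kernel_op c K) \<and> \<bar>\<epsilon>\<bar> \<le> 1/2 \<longrightarrow>
      (constant_field A \<longrightarrow>
         max \<bar>edge A c K \<epsilon> - edge A c K 0\<bar> \<bar>slow_edge A c K \<epsilon> - slow_edge A c K 0\<bar>
           \<le> C * decay_norm 2 c K * \<bar>\<epsilon>\<bar>) \<and>
      (bounded_field_gradient M A \<longrightarrow>
         \<bar>slow_edge A c K \<epsilon> - slow_edge A c K 0\<bar> \<le> C * decay_norm 2 c K * \<bar>\<epsilon>\<bar>))"
proof (intro conjI, goal_cases)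
  case 1
  define G where "G = midpoint_const TYPE(real^'n) (real CARD('n) ^ 2 * M)"
  have G: "0 < G" by (simp add: G_def midpoint_const_pos)
  show ?case
    using hoelder_const_pos[OF G] hoelder_const_at_top[OF G] edge_hoelder[where 'n='n and M=M]
    by (intro exI[of _ "hoelder_const G"]) (auto simp: G_def)
next
  case 2
  define G where "G = midpoint_const TYPE(real^'n) (real CARD('n) ^ 2 * M)"
  have G: "0 < G" by (simp add: G_def midpoint_const_pos)
  show ?case
  proof (intro exI[of _ "(2 + 4 * G) / ln 2"] conjI allI impI; (elim conjE)?)
    show "0 < (2 + 4 * G) / ln 2" using G by simp
    fix A :: "real^'n \<Rightarrow> real^'n" and \<alpha> \<epsilon> :: real and c and K :: "real^'n \<Rightarrow> real^'n \<Rightarrow> complex"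
    assume "transverse_potential M A" "2 \<le> \<alpha>" "(c, K) \<in> decay_class \<alpha>"
      "L2_selfadjoint (kernel_op c K)" "\<bar>\<epsilon>\<bar> \<le> 1/2"
    then show "\<bar>edge A c K \<epsilon> - edge A c K 0\<bar> \<le> (2 + 4 * G) / ln 2 * decay_norm 2 c K * \<bar>\<epsilon>\<bar> * ln (1/\<bar>\<epsilon>\<bar>)"
      unfolding G_def by (intro edge_log_lipschitz decay_class_mono[of c K \<alpha> 2])
  qed
next
  case 3
  \<comment> \<open>\<open>M\<close> is an arbitrary real here; the absolute values and the added
    one ensure \<open>0 < D\<close> before a potential, and with it \<open>0 <= M\<close>, is at
    hand.\<close>
  define D where "D = \<bar>linear_const TYPE(real^'n) (real CARD('n) ^ 2 * (real CARD('n) * \<bar>M\<bar> + M))\<bar> + 1"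
  show ?case
  proof (intro exI[of _ D] conjI[of "0 < D"] allI impI; (elim conjE)?)
    show "0 < D" by (simp add: D_def)
    fix A :: "real^'n \<Rightarrow> real^'n" and \<alpha> \<epsilon> :: real and c and K :: "real^'n \<Rightarrow> real^'n \<Rightarrow> complex"
    assume A: "transverse_potential M A" and "2 \<le> \<alpha>" "(c, K) \<in> decay_class \<alpha>"
      and sa: "L2_selfadjoint (kernel_op c K)" and e: "\<bar>\<epsilon>\<bar> \<le> 1/2"
    then have K: "(c, K) \<in> decay_class 2" by (intro decay_class_mono[of c K \<alpha> 2])
    have M: "0 \<le> M" by (rule transverse_potentialD(4)[OF A])
    have slow: "\<bar>slow_edge A c K \<epsilon> - slow_edge A c K 0\<bar> \<le> D * decay_norm 2 c K * \<bar>\<epsilon>\<bar>"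
      if "\<And>z z' j k. \<bar>mag_field A z j k - mag_field A z' j k\<bar> \<le> real CARD('n) * \<bar>M\<bar> * norm (z - z')"
    proof -
      have "\<bar>slow_edge A c K \<epsilon> - slow_edge A c K 0\<bar> \<le>
          linear_const TYPE(real^'n) (real CARD('n) ^ 2 * (real CARD('n) * \<bar>M\<bar> + M)) * decay_norm 2 c K * \<bar>\<epsilon>\<bar>"
        using e by (intro slow_edge_lipschitz[OF A _ that K sa]) auto
      also have "\<dots> \<le> D * decay_norm 2 c K * \<bar>\<epsilon>\<bar>"
        unfolding D_def by (intro mult_right_mono decay_norm_nonneg) auto
      finally show ?thesis .
    qed
    show "(constant_field A \<longrightarrow>
         max \<bar>edge A c K \<epsilon> - edge A c K 0\<bar> \<bar>slow_edge A c K \<epsilon> - slow_edge A c K 0\<bar>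
           \<le> D * decay_norm 2 c K * \<bar>\<epsilon>\<bar>) \<and>
      (bounded_field_gradient M A \<longrightarrow>
         \<bar>slow_edge A c K \<epsilon> - slow_edge A c K 0\<bar> \<le> D * decay_norm 2 c K * \<bar>\<epsilon>\<bar>)"
    proof (intro conjI impI)
      assume const: "constant_field A"
      have "\<bar>mag_field A z j k - mag_field A z' j k\<bar> \<le> real CARD('n) * \<bar>M\<bar> * norm (z - z')" for z z' j k
      proof -
        have "mag_field A z = mag_field A z'" using const unfolding constant_field_def by blast
        then show ?thesis by simp
      qed
      from slow[OF this]
      show "max \<bar>edge A c K \<epsilon> - edge A c K 0\<bar> \<bar>slow_edge A c K \<epsilon> - slow_edge A c K 0\<bar> \<le> D * decay_norm 2 c K * \<bar>\<epsilon>\<bar>"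
        unfolding slow_edge_constant_field[OF A const] by simp
    next
      assume "bounded_field_gradient M A"
      then show "\<bar>slow_edge A c K \<epsilon> - slow_edge A c K 0\<bar> \<le> D * decay_norm 2 c K * \<bar>\<epsilon>\<bar>"
        using mag_field_lipschitz M by (intro slow) auto
    qed
  qed
qed

end
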